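(* Let $p\ge 3$ be an odd integer. Then $$ \begin{aligned} V_{0}(q) &=-2\sum_{r=0}^{p-1}(-1)^{r}q^{-(2r+1)^2}\,m\Big (q^{8p\left (\frac{p-1}{2}-r\right )},-1;q^{8p^2}\Big )\\ &\qquad +\frac{J_{8p}^3}{J_{1,8}\,\overline{J}_{0,8p^2}}\sum_{r=0}^{p-1} \frac{(-1)^r q^{4r(r-p)-1}\,q^{r-(p-1)/2}\,j(-q^{8r+1};q^{8p})\,j(-q^{p(8r+1)};q^{8p^2})}{\overline{J}_{0,8p}\,j(q^{8r+1};q^{8p})}\\ &\qquad +\frac{J_{8p}^3}{J_{3,8}\,\overline{J}_{0,8p^2}}\sum_{r=0}^{p-1} \frac{(-1)^r q^{4r(r-p)-1}\,q^{3r-3(p-1)/2}\,j(-q^{8r+3};q^{8p})\,j(-q^{p(8r+3)};q^{8p^2})}{\overline{J}_{0,8p}\,j(q^{8r+3};q^{8p})}. \end{aligned} $$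
   Context: Throughout, $q=e^{2\pi i\tau}$ with $\tau\in\mathbb{C}$, $\mathrm{Im}(\tau)>0$ (so $0<|q|<1$), and $\mathbb{C}^*=\mathbb{C}\setminus\{0\}$. Pochhammer symbols: $(x;q)_n=\prod_{i=0}^{n-1}(1-q^i x)$ and $(x;q)_\infty=\prod_{i\ge 0}(1-q^i x)$. Theta functions: for $x\in\mathbb{C}^*$, $$j(x;q)=(x;q)_\infty (q/x;q)_\infty (q;q)_\infty=\sum_{n=-\infty}^{\infty}(-1)^n q^{\binom n2}x^n .$$ For integers $a,m$ with $m>0$: $J_{a,m}=j(q^a;q^m)$, $\overline{J}_{a,m}=j(-q^a;q^m)$, and $J_m=J_{m,3m}=\prod_{i\ge1}(1-q^{mi})$. Appell function (for $x,z\in\mathbb{C}^*$ such that no denominator vanishes): $$m(x,z;q)=\frac{1}{j(z;q)}\sum_{r=-\infty}^{\infty}\frac{(-1)^r q^{\binom r2}z^r}{1-q^{r-1}xz}.$$ In all of these, $q$ may be replaced by a positive power $q^k$ as the base (last argument). The eighth order mock theta function $V_0$ is $$V_0(q)=-1+2\sum_{n\ge 0}\frac{q^{n^2}(-q;q^2)_n}{(q;q^2)_n}.$$ The following known equivalent expressions may be used: $$V_0(q)=-1+2\sum_{n\ge0}\frac{q^{2n^2}(-q^2;q^4)_n}{(q;q^2)_{2n+1}}=-q^{-1}m(1,q;q^8)-q^{-1}m(1,q^3;q^8).$$ *)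

theory Defs
  imports "HOL-Analysis.Analysis"
begin

text \<open>All exponents of the base that occur are integers, so integer powers (\<open>powi\<close>) are used
  throughout and no branch of a complex power has to be chosen.\<close>

definition qpoch :: "complex \<Rightarrow> complex \<Rightarrow> nat \<Rightarrow> complex" where
  "qpoch x q n = (\<Prod>i<n. 1 - q ^ i * x)"

definition qpoch_inf :: "complex \<Rightarrow> complex \<Rightarrow> complex" where
  "qpoch_inf x q = (\<Prod>i. 1 - q ^ i * x)"

definition theta_j :: "complex \<Rightarrow> complex \<Rightarrow> complex" where
  "theta_j x q = qpoch_inf x q * qpoch_inf (q / x) q * qpoch_inf q q"

definition theta_J :: "complex \<Rightarrow> int \<Rightarrow> int \<Rightarrow> complex" where
  "theta_J q a m = theta_j (q powi a) (q powi m)"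

definition theta_Jbar :: "complex \<Rightarrow> int \<Rightarrow> int \<Rightarrow> complex" where
  "theta_Jbar q a m = theta_j (- (q powi a)) (q powi m)"

definition theta_J1 :: "complex \<Rightarrow> int \<Rightarrow> complex" where
  "theta_J1 q m = theta_J q m (3 * m)"

text \<open>The bilateral series converges absolutely for \<open>0 < norm q < 1\<close>, \<open>x \<noteq> 0\<close>, \<open>z \<noteq> 0\<close>
  whenever no denominator vanishes, so summing unconditionally over the integers agrees with the
  bilateral sum. The division \<open>div\<close> is exact.\<close>

definition appell_m :: "complex \<Rightarrow> complex \<Rightarrow> complex \<Rightarrow> complex" where
  "appell_m x z q = 1 / theta_j z q *
     (\<Sum>\<^sub>\<infinity>r\<in>(UNIV :: int set).
        (-1) powi r * q powi (r * (r - 1) div 2) * z powi r / (1 - q powi (r - 1) * x * z))"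

definition mock_V0 :: "complex \<Rightarrow> complex" where
  "mock_V0 q = -1 + 2 * (\<Sum>n. q ^ (n ^ 2) * qpoch (- q) (q ^ 2) n / qpoch q (q ^ 2) n)"

end

theory Submission
  imports Defs
begin

text \<open>Write j for the theta function and m for the Appell function. The identity comes from

  V0(q) = - m(1, q; q^8) / q - m(1, q^3; q^8) / q

by multisecting each of the two Appell functions modulo p, so the proof has two independent halves.

Multisection. Put Q = q^8 and f(z) = j(z; Q) m(1, z; Q). In the annulus |Q| < |z| < 1 the Laurent
coefficients of f are (-1)^N Q^(N(N-1)/2) times the partial sums of a divergent series with terms
(-1)^k Q^(-k(k+1)/2) (\<open>appell_sum_laurent\<close>). A second family of Laurent series with a
coefficient of that shape arises as follows. For each residue r modulo n, multiply a theta function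
in the variable z^n, of base Q^(n^2), by Kronecker's series, the sum over s of
a^s / (1 - b Q^(ns)) with a = Q^r z, and add over r. The coefficient of z^N is
(-1)^N Q^(N(N-1)/2) D(N), where D(N) is itself a series over s in which N occurs only through the
exponent \<open>(N - s) div n\<close> (\<open>multisection_product\<close>). Therefore
D(N) - D(N - 1) collapses to the terms with s congruent to N modulo n, and these add up to a
theta constant times (-1)^N Q^(-N(N-1)/2) (\<open>section_kernel_step\<close>). So D and the
partial sums have proportional differences, and the sum of the products is D(0) j(z; Q) minus the
theta constant times f(z) (\<open>appell_multisection\<close>). Kronecker's formula turns the products into theta
quotients. The constant D(0) does not involve z. For odd n it is a combination of the values
m(Q^(n(h-r)), -1; Q^(n^2)), where n = 2h + 1, which gives the two sections of the theorem
(\<open>appell_m_odd_section\<close>). For n = 1 it is an Appell series at a second point, and the same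
identity becomes the formula for the change of the argument z
(\<open>appell_m_change_z\<close>), which the other half of the proof needs.

The mock theta function. The defining series of V0 is first transformed into a series with
denominators (q; q^2)_(2k+1) by a telescoping argument (\<open>mock_V0_rearranged\<close>). The
reciprocals of these denominators have a finite partial fraction expansion
(\<open>finite_partial_fractions\<close>), after which the summation over k can be carried out in
closed form (\<open>gauss_weight_moment\<close>) and leaves a bilateral series with denominators
1 - q^(4r+1) (\<open>bilateral_form\<close>). This step is a limiting case of the argument behind
Bailey's lemma. Extending the fractions to the denominators 1 - q^(8r+2) produces Appell functions
of base q^8 (\<open>mock_V0_half_shift\<close>); changing their arguments z to q and q^3 leaves theta
quotients, which cancel by product formulas and by the identity

  j(q^3; q^8)^2 - q j(q; q^8)^2 = j(q; q^4) j(-q^2; q^4).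

Everything rests on Jacobi's triple product, on the expansion of 1 / j and on Kronecker's formula.
The first two are limits of finite identities proved by induction, and the third follows from a
recurrence for Laurent coefficients.\<close>

section \<open>Triangular numbers and bilateral series\<close>

definition tri :: "int \<Rightarrow> int" where
  "tri n = n * (n - 1) div 2"

lemma two_tri: "2 * tri n = n * (n - 1)"
  unfolding tri_def by (cases "even n") auto

lemma tri_0 [simp]: "tri 0 = 0" and tri_1 [simp]: "tri 1 = 0"
  by (simp_all add: tri_def)

lemma tri_add: "tri (m + n) = tri m + tri n + m * n"
proof -
  have "2 * tri (m + n) = 2 * (tri m + tri n + m * n)"
    unfolding distrib_left two_tri by (simp add: algebra_simps)
  then show ?thesis by simp
qed

lemma tri_minus: "tri (- n) = tri n + n"
proof -
  have "2 * tri (- n) = 2 * (tri n + n)"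
    unfolding distrib_left two_tri by (simp add: algebra_simps)
  then show ?thesis by simp
qed

lemma tri_diff: "tri (m - n) = tri m + tri n + n - m * n"
  using tri_add[of m "- n"] by (simp add: tri_minus)

lemma tri_succ: "tri (n + 1) = tri n + n"
  by (simp add: tri_add)

lemma tri_pred: "tri (n - 1) = tri n - n + 1"
  using tri_succ[of "n - 1"] by simp

lemma tri_mult: "tri (n * t) = n\<^sup>2 * tri t + tri n * t"
proof -
  have "2 * tri (n * t) = 2 * (n\<^sup>2 * tri t + tri n * t)"
  proof -
    have "2 * (n\<^sup>2 * tri t + tri n * t) = n\<^sup>2 * (2 * tri t) + (2 * tri n) * t"
      by (simp add: algebra_simps)
    then show ?thesis unfolding two_tri by (simp add: algebra_simps power2_eq_square)
  qed
  then show ?thesis by simp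
qed

lemma abs_summable_times:
  fixes f :: "'a \<Rightarrow> complex" and g :: "'b \<Rightarrow> complex"
  assumes "(\<lambda>x. norm (f x)) summable_on A" "(\<lambda>y. norm (g y)) summable_on B"
  shows "(\<lambda>(x, y). norm (f x * g y)) summable_on A \<times> B"
proof (rule summable_on_SigmaI)
  fix x assume "x \<in> A"
  show "((\<lambda>y. case (x, y) of (x, y) \<Rightarrow> norm (f x * g y)) has_sum norm (f x) * infsum (\<lambda>y. norm (g y)) B) B"
    using has_sum_cmult_right[OF has_sum_infsum[OF assms(2)], of "norm (f x)"]
    by (simp add: norm_mult)
next
  show "(\<lambda>x. norm (f x) * infsum (\<lambda>y. norm (g y)) B) summable_on A"
    by (rule summable_on_cmult_left[OF assms(1)])
qed auto

lemma infsum_times: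
  fixes f :: "'a \<Rightarrow> complex" and g :: "'b \<Rightarrow> complex"
  assumes "(\<lambda>x. norm (f x)) summable_on A" "(\<lambda>y. norm (g y)) summable_on B"
  shows "infsum f A * infsum g B = (\<Sum>\<^sub>\<infinity>(x, y)\<in>A \<times> B. f x * g y)"
proof -
  have "(\<lambda>(x, y). f x * g y) summable_on A \<times> B"
    using abs_summable_summable[of "\<lambda>(x, y). f x * g y"] abs_summable_times[OF assms]
    by (simp add: case_prod_unfold)
  from infsum_Sigma'_banach[OF this] show ?thesis
    by (simp add: infsum_cmult_right' infsum_cmult_left')
qed

text \<open>Both iterated sums rearrange one absolutely convergent double sum, by rows and by
  antidiagonals. The antidiagonals collect the coefficient of a fixed power in a product of two
  Laurent series.\<close>

lemma infsum_diagonal: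
  fixes F :: "int \<Rightarrow> int \<Rightarrow> complex"
  assumes "(\<lambda>(r, k). norm (F r k)) summable_on UNIV \<times> UNIV"
  shows infsum_diagonal_eq: "(\<Sum>\<^sub>\<infinity>(r, k)\<in>UNIV \<times> UNIV. F r k) = (\<Sum>\<^sub>\<infinity>N. \<Sum>\<^sub>\<infinity>k. F (N - k) k)"
    and infsum_rows_eq: "(\<Sum>\<^sub>\<infinity>(r, k)\<in>UNIV \<times> UNIV. F r k) = (\<Sum>\<^sub>\<infinity>r. \<Sum>\<^sub>\<infinity>k. F r k)"
    and diagonal_summable: "(\<lambda>k. F (N - k) k) summable_on UNIV"
    and diagonal_sums_summable: "(\<lambda>N. \<Sum>\<^sub>\<infinity>k. F (N - k) k) summable_on UNIV"
proof -
  have bij: "bij_betw (\<lambda>(N, k). (N - k, k)) (UNIV \<times> UNIV) (UNIV \<times> (UNIV :: int set))"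
    by (rule bij_betwI[of _ _ _ "\<lambda>(r, s). (r + s, s)"]) auto
  have sum: "(\<lambda>(r, k). F r k) summable_on UNIV \<times> UNIV"
    using abs_summable_summable[of "\<lambda>(r, k). F r k"] assms by (simp add: case_prod_unfold)
  have sum': "(\<lambda>(N, k). F (N - k) k) summable_on UNIV \<times> UNIV"
    using summable_on_reindex_bij_betw[OF bij, of "\<lambda>(r, k). F r k"] sum
    by (simp add: case_prod_unfold)
  show "(\<Sum>\<^sub>\<infinity>(r, k)\<in>UNIV \<times> UNIV. F r k) = (\<Sum>\<^sub>\<infinity>r. \<Sum>\<^sub>\<infinity>k. F r k)"
    by (rule infsum_Sigma'_banach[OF sum, symmetric])
  have "(\<Sum>\<^sub>\<infinity>(r, k)\<in>UNIV \<times> UNIV. F r k) = (\<Sum>\<^sub>\<infinity>(N, k)\<in>UNIV \<times> UNIV. F (N - k) k)"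
    using infsum_reindex_bij_betw[OF bij, of "\<lambda>(r, k). F r k"]
    by (simp add: case_prod_unfold)
  also have "\<dots> = (\<Sum>\<^sub>\<infinity>N. \<Sum>\<^sub>\<infinity>k. F (N - k) k)"
    by (rule infsum_Sigma'_banach[OF sum', symmetric])
  finally show "(\<Sum>\<^sub>\<infinity>(r, k)\<in>UNIV \<times> UNIV. F r k) = (\<Sum>\<^sub>\<infinity>N. \<Sum>\<^sub>\<infinity>k. F (N - k) k)" .
  show "(\<lambda>k. F (N - k) k) summable_on UNIV"
    using summable_on_SigmaD1[OF sum', of N] by simp
  show "(\<lambda>N. \<Sum>\<^sub>\<infinity>k. F (N - k) k) summable_on UNIV"
    by (rule summable_on_Sigma_banach[OF sum'])
qed

lemma infsum_convolution:
  fixes f g :: "int \<Rightarrow> complex"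
  assumes "(\<lambda>n. norm (f n)) summable_on UNIV" "(\<lambda>n. norm (g n)) summable_on UNIV"
  shows "infsum f UNIV * infsum g UNIV = (\<Sum>\<^sub>\<infinity>N. \<Sum>\<^sub>\<infinity>s. f (N - s) * g s)"
  unfolding infsum_times[OF assms] by (rule infsum_diagonal_eq[OF abs_summable_times[OF assms]])

lemma int_shift_invariant:
  fixes F :: "int \<Rightarrow> 'a"
  assumes "\<And>n. F (n + 1) = F n"
  shows "F n = F 0"
proof (induction n rule: int_induct[of _ 0])
  case (step2 i)
  then show ?case using assms[of "i - 1"] by simp
qed (use assms in auto)

lemma infsum_int_shift:
  fixes f :: "int \<Rightarrow> 'a::{comm_monoid_add, t2_space}"
  shows "(\<Sum>\<^sub>\<infinity>k. f (k + m)) = (\<Sum>\<^sub>\<infinity>k. f k)"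
  by (rule infsum_reindex_bij_witness[of _ "\<lambda>k. k - m" "\<lambda>k. k + m"]) auto

lemma summable_int_shift:
  fixes f :: "int \<Rightarrow> 'a::{comm_monoid_add, t2_space}"
  shows "(\<lambda>k. f (k + m)) summable_on UNIV \<longleftrightarrow> f summable_on UNIV"
  by (rule summable_on_reindex_bij_witness[of _ "\<lambda>k. k - m" "\<lambda>k. k + m"]) auto

lemma infsum_int_uminus:
  fixes f :: "int \<Rightarrow> 'a::{comm_monoid_add, t2_space}"
  shows "(\<Sum>\<^sub>\<infinity>k. f (- k)) = (\<Sum>\<^sub>\<infinity>k. f k)"
  by (rule infsum_reindex_bij_witness[of _ uminus uminus]) auto

text \<open>Tannery's theorem, carried from series over the naturals to series over the integers
  along a bijection. All passages from finite to infinite q-identities go through it.\<close>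

lemma tendsto_infsum_int_dominated:
  fixes f :: "nat \<Rightarrow> int \<Rightarrow> complex"
  assumes lim: "\<And>k. (\<lambda>n. f n k) \<longlonglongrightarrow> h k"
    and bound: "\<And>n k. norm (f n k) \<le> g k"
    and g: "g summable_on UNIV"
  shows "(\<lambda>n. \<Sum>\<^sub>\<infinity>k. f n k) \<longlonglongrightarrow> (\<Sum>\<^sub>\<infinity>k. h k)"
proof -
  define e where "e = int_decode"
  have e: "bij_betw e UNIV UNIV"
    unfolding e_def by (rule bij_int_decode)
  have ge: "(\<lambda>k. g (e k)) summable_on UNIV"
    using summable_on_reindex_bij_betw[OF e, of g] g by simp
  have norm_h: "norm (h k) \<le> g k" for k
    by (rule tendsto_upperbound[OF tendsto_norm[OF lim[of k]]]) (use bound in auto)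
  have eq: "(\<Sum>\<^sub>\<infinity>k. u k) = (\<Sum>k. u (e k))" if "\<And>k. norm (u k) \<le> g k" for u :: "int \<Rightarrow> complex"
  proof -
    have "(\<lambda>k. norm (u (e k))) summable_on UNIV"
      by (rule Infinite_Sum.abs_summable_on_comparison_test'[OF ge]) (use that in auto)
    then have "(\<lambda>k. u (e k)) summable_on UNIV"
      by (rule abs_summable_summable)
    from has_sum_imp_sums[OF has_sum_infsum[OF this]] show ?thesis
      using infsum_reindex_bij_betw[OF e, of u] by (simp add: sums_iff)
  qed
  have ev: "\<forall>\<^sub>F (k, n) in sequentially \<times>\<^sub>F sequentially. norm (f n (e k)) \<le> g (e k)"
    by (rule always_eventually) (simp add: bound)
  have "(\<lambda>n. \<Sum>k. f n (e k)) \<longlonglongrightarrow> (\<Sum>k. h (e k))"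
    using tannerys_theorem[where a = "\<lambda>k n. f n (e k)" and b = "\<lambda>k. h (e k)",
        OF lim ev summable_on_imp_summable[OF ge]]
    by simp
  then show ?thesis
    using eq[OF norm_h] eq[OF bound] by simp
qed

lemma summable_on_int_split:
  fixes f :: "int \<Rightarrow> complex"
  assumes "summable (\<lambda>n. norm (f (int n)))" "summable (\<lambda>n. norm (f (- int n)))"
  shows "(\<lambda>n. norm (f n)) summable_on UNIV"
proof -
  have 1: "(\<lambda>n. norm (f n)) summable_on {0..}"
  proof -
    have "(\<lambda>n. norm (f (int n))) summable_on UNIV"
      using norm_summable_imp_summable_on[of "\<lambda>n. norm (f (int n))"] assms(1) by simp
    moreover have "bij_betw int UNIV {0..}"
      by (rule bij_betwI[of _ _ _ nat]) auto
    ultimately show ?thesis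
      using summable_on_reindex_bij_betw[of int UNIV "{0..}" "\<lambda>n. norm (f n)"] by simp
  qed
  have 2: "(\<lambda>n. norm (f n)) summable_on {..0}"
  proof -
    have "(\<lambda>n. norm (f (- int n))) summable_on UNIV"
      using norm_summable_imp_summable_on[of "\<lambda>n. norm (f (- int n))"] assms(2) by simp
    moreover have "bij_betw (\<lambda>n. - int n) UNIV {..0}"
      by (rule bij_betwI[of _ _ _ "\<lambda>n. nat (- n)"]) auto
    ultimately show ?thesis
      using summable_on_reindex_bij_betw[of "\<lambda>n. - int n" UNIV "{..0}" "\<lambda>n. norm (f n)"] by simp
  qed
  have "(\<lambda>n. norm (f n)) summable_on ({0..} \<union> {..0})"
    by (rule summable_on_union[OF 1 2])
  moreover have "{0..} \<union> {..0} = (UNIV :: int set)" by auto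
  ultimately show ?thesis by simp
qed

text \<open>Gaussian decay beats any geometric growth.\<close>

lemma summable_tri_nat:
  fixes q x :: complex
  assumes "norm q < 1" "q \<noteq> 0"
  shows "summable (\<lambda>n. norm (q powi tri (int n) * x ^ n))"
proof -
  have "(\<lambda>n. norm q ^ n * norm x) \<longlonglongrightarrow> 0"
    using assms by (intro tendsto_mult_left_zero LIMSEQ_power_zero) simp
  then have "eventually (\<lambda>n. norm q ^ n * norm x < 1/2) sequentially"
    by (rule order_tendstoD) simp
  then obtain N where N: "\<And>n. n \<ge> N \<Longrightarrow> norm q ^ n * norm x < 1/2"
    unfolding eventually_sequentially by blast
  show ?thesis
  proof (rule summable_ratio_test[of "1/2" N])
    fix n assume "n \<ge> N"
    have "q powi tri (int (Suc n)) = q powi tri (int n) * q ^ n"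
      using tri_succ[of "int n"] assms by (simp add: power_int_add add.commute)
    then have "norm (norm (q powi tri (int (Suc n)) * x ^ Suc n))
        = norm (q powi tri (int n) * x ^ n) * (norm q ^ n * norm x)"
      by (simp add: norm_mult norm_power)
    also have "\<dots> \<le> norm (q powi tri (int n) * x ^ n) * (1/2)"
      by (rule mult_left_mono) (use N[OF \<open>n \<ge> N\<close>] in auto)
    finally show "norm (norm (q powi tri (int (Suc n)) * x ^ Suc n))
        \<le> 1/2 * norm (norm (q powi tri (int n) * x ^ n))" by simp
  qed simp
qed

lemma theta_terms_abs_summable:
  fixes q x :: complex
  assumes "norm q < 1" "q \<noteq> 0" "x \<noteq> 0"
  shows "(\<lambda>n. norm (q powi tri n * x powi n)) summable_on UNIV"
proof (rule summable_on_int_split)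
  show "summable (\<lambda>n. norm (q powi tri (int n) * x powi int n))"
    using summable_tri_nat[OF assms(1,2), of x] by simp
next
  have "q powi tri (- int n) * x powi (- int n) = q powi tri (int n) * (q / x) ^ n" for n
    using assms by (simp add: tri_minus power_int_add power_int_minus power_divide divide_simps)
  then show "summable (\<lambda>n. norm (q powi tri (- int n) * x powi (- int n)))"
    using summable_tri_nat[OF assms(1,2), of "q / x"] by simp
qed

lemma theta_terms_summable:
  fixes q x :: complex
  assumes "norm q < 1" "q \<noteq> 0" "x \<noteq> 0"
  shows "(\<lambda>n. q powi tri n * x powi n) summable_on UNIV"
  by (rule abs_summable_summable[OF theta_terms_abs_summable[OF assms]])

section \<open>Infinite products\<close>

lemma power_mult_ne_1:
  fixes q x :: complex
  assumes "norm q < 1" "norm x < 1"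
  shows "q ^ i * x \<noteq> 1"
proof
  assume "q ^ i * x = 1"
  then have "norm q ^ i * norm x = 1" by (metis norm_mult norm_one norm_power)
  moreover have "norm q ^ i * norm x \<le> 1 * norm x"
    by (intro mult_right_mono power_le_one) (use assms in auto)
  ultimately show False using assms by simp
qed

lemma powi_ne_1:
  fixes q :: complex
  assumes "norm q < 1" "q \<noteq> 0" "k \<noteq> 0"
  shows "q powi k \<noteq> 1"
proof
  assume "q powi k = 1"
  then have "norm q powi k = 1" by (simp flip: norm_power_int)
  moreover have "norm q powi k < 1" if "k > 0"
    using power_int_strict_decreasing[of 0 k "norm q"] assms that by simp
  moreover have "norm q powi k > 1" if "k < 0"
    using power_int_strict_decreasing[of k 0 "norm q"] assms that by simp
  ultimately show False using assms(3) by (cases k "0::int" rule: linorder_cases) auto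
qed

lemma qpoch_0 [simp]: "qpoch x q 0 = 1"
  and qpoch_Suc: "qpoch x q (Suc n) = qpoch x q n * (1 - q ^ n * x)"
  by (simp_all add: qpoch_def)

lemma convergent_prod_qpoch:
  fixes q x :: complex
  assumes "norm q < 1"
  shows "convergent_prod (\<lambda>i. 1 - q ^ i * x)"
proof -
  have "summable (\<lambda>i. norm (q ^ i * x))"
    unfolding norm_mult norm_power by (intro summable_mult2 summable_geometric) (use assms in simp)
  then have "summable (\<lambda>i. norm ((1 - q ^ i * x) - 1))"
    by (simp add: norm_minus_commute)
  then show ?thesis
    by (intro abs_convergent_prod_imp_convergent_prod summable_imp_abs_convergent_prod)
qed

lemma qpoch_LIMSEQ:
  assumes "norm q < 1"
  shows "(\<lambda>n. qpoch x q n) \<longlonglongrightarrow> qpoch_inf x q"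
  unfolding qpoch_def qpoch_inf_def LIMSEQ_lessThan_iff_atMost
  by (rule convergent_prod_LIMSEQ[OF convergent_prod_qpoch[OF assms]])

lemma qpoch_inf_nonzero:
  assumes "norm q < 1" "\<And>i. q ^ i * x \<noteq> 1"
  shows "qpoch_inf x q \<noteq> 0"
  unfolding qpoch_inf_def
  by (rule prodinf_nonzero[OF convergent_prod_qpoch[OF assms(1)]]) (use assms(2) in \<open>simp add: eq_commute[of 1]\<close>)

lemma qpoch_nonzero:
  assumes "\<And>i. q ^ i * x \<noteq> 1"
  shows "qpoch x q n \<noteq> 0"
  unfolding qpoch_def using assms by (simp add: eq_commute[of 1])

lemma qpoch_bounded:
  assumes "norm q < 1"
  obtains C where "C > 0" "\<And>n. norm (qpoch x q n) \<le> C"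
proof -
  have "Bseq (\<lambda>n. qpoch x q n)"
    using qpoch_LIMSEQ[OF assms] by (intro convergent_imp_Bseq convergentI)
  then show ?thesis
    using that unfolding Bseq_def by blast
qed

lemma inverse_qpoch_bounded:
  assumes "norm q < 1" "\<And>i. q ^ i * x \<noteq> 1"
  obtains C where "C > 0" "\<And>n. norm (inverse (qpoch x q n)) \<le> C"
proof -
  have "(\<lambda>n. inverse (qpoch x q n)) \<longlonglongrightarrow> inverse (qpoch_inf x q)"
    by (intro tendsto_inverse qpoch_LIMSEQ qpoch_inf_nonzero assms)
  then have "Bseq (\<lambda>n. inverse (qpoch x q n))"
    by (intro convergent_imp_Bseq convergentI)
  then show ?thesis
    using that unfolding Bseq_def by blast
qed

text \<open>The factors are sorted by the residue of their exponent modulo k.\<close>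

lemma qpoch_inf_dissect:
  assumes "norm q < 1" "k > 0"
  shows "qpoch_inf x q = (\<Prod>i<k. qpoch_inf (q ^ i * x) (q ^ k))"
proof (rule LIMSEQ_unique)
  have qk: "norm (q ^ k) < 1"
    using assms by (simp add: norm_power power_less_one_iff)
  show "(\<lambda>n. \<Prod>i<k. qpoch (q ^ i * x) (q ^ k) n) \<longlonglongrightarrow> (\<Prod>i<k. qpoch_inf (q ^ i * x) (q ^ k))"
    by (intro tendsto_prod qpoch_LIMSEQ qk)
  have eq: "qpoch x q (k * n) = (\<Prod>i<k. qpoch (q ^ i * x) (q ^ k) n)" for n
  proof (induction n)
    case (Suc n)
    have "qpoch x q (k * Suc n) = qpoch x q (k * n) * (\<Prod>i<k. 1 - q ^ (k * n + i) * x)"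
    proof -
      have "qpoch x q (k * Suc n) = (\<Prod>i\<in>{0..<k * n + k}. 1 - q ^ i * x)"
        by (simp add: qpoch_def lessThan_atLeast0 add.commute)
      also have "\<dots> = qpoch x q (k * n) * (\<Prod>i\<in>{k * n..<k * n + k}. 1 - q ^ i * x)"
        by (subst prod.atLeastLessThan_concat[of 0 "k * n", symmetric]) (simp_all add: qpoch_def lessThan_atLeast0)
      also have "(\<Prod>i\<in>{k * n..<k * n + k}. 1 - q ^ i * x) = (\<Prod>i<k. 1 - q ^ (k * n + i) * x)"
        using prod.shift_bounds_nat_ivl[of "\<lambda>i. 1 - q ^ i * x" 0 "k * n" k]
        by (simp add: add.commute lessThan_atLeast0)
      finally show ?thesis .
    qed
    also have "\<dots> = (\<Prod>i<k. qpoch (q ^ i * x) (q ^ k) (Suc n))"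
    proof -
      have "1 - q ^ (k * n + i) * x = 1 - (q ^ k) ^ n * (q ^ i * x)" for i
        by (simp only: power_add power_mult mult.assoc)
      then show ?thesis
        unfolding Suc.IH qpoch_Suc prod.distrib by (simp only:)
    qed
    finally show ?case .
  qed simp
  have "(\<lambda>n. qpoch x q (k * n)) \<longlonglongrightarrow> qpoch_inf x q"
    by (rule filterlim_compose[OF qpoch_LIMSEQ[OF assms(1)]])
       (rule mult_nat_left_at_top[OF assms(2)])
  then show "(\<lambda>n. \<Prod>i<k. qpoch (q ^ i * x) (q ^ k) n) \<longlonglongrightarrow> qpoch_inf x q"
    by (simp add: eq)
qed

lemma qpoch_inf_bisect:
  assumes "norm q < 1"
  shows "qpoch_inf x q = qpoch_inf x (q\<^sup>2) * qpoch_inf (q * x) (q\<^sup>2)"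
  using qpoch_inf_dissect[OF assms, of 2 x] by (simp add: lessThan_nat_numeral mult.commute)

lemma qpoch_inf_mult_minus:
  assumes "norm q < 1"
  shows "qpoch_inf x q * qpoch_inf (- x) q = qpoch_inf (x\<^sup>2) (q\<^sup>2)"
proof (rule LIMSEQ_unique)
  have q2: "norm (q\<^sup>2) < 1"
    using assms by (simp add: norm_power power_less_one_iff)
  show "(\<lambda>n. qpoch x q n * qpoch (- x) q n) \<longlonglongrightarrow> qpoch_inf x q * qpoch_inf (- x) q"
    by (intro tendsto_mult qpoch_LIMSEQ assms)
  have "qpoch x q n * qpoch (- x) q n = qpoch (x\<^sup>2) (q\<^sup>2) n" for n
  proof (induction n)
    case (Suc n)
    have "(1 - q ^ n * x) * (1 - q ^ n * - x) = 1 - (q\<^sup>2) ^ n * x\<^sup>2"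
      by (simp add: algebra_simps power2_eq_square power_mult_distrib)
    with Suc show ?case unfolding qpoch_Suc by (metis mult.assoc mult.left_commute)
  qed simp
  then show "(\<lambda>n. qpoch x q n * qpoch (- x) q n) \<longlonglongrightarrow> qpoch_inf (x\<^sup>2) (q\<^sup>2)"
    using qpoch_LIMSEQ[OF q2, of "x\<^sup>2"] by simp
qed

section \<open>The triple product\<close>

text \<open>The reciprocal of \<open>qpoch q q k\<close>, extended by 0 to negative k. With this
  extension the recurrence \<open>rfac_pred\<close> holds for every integer, so sums with Gaussian
  binomial coefficients can range over all integers and be shifted freely.\<close>

definition rfac :: "complex \<Rightarrow> int \<Rightarrow> complex" where
  "rfac q k = (if k < 0 then 0 else inverse (qpoch q q (nat k)))"

lemma qpoch_self_nonzero:
  assumes "norm q < 1"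
  shows "qpoch q q n \<noteq> 0"
  by (rule qpoch_nonzero) (use power_mult_ne_1[OF assms assms] in auto)

lemma qpoch_inf_self_nonzero:
  assumes "norm q < 1"
  shows "qpoch_inf q q \<noteq> 0"
  by (rule qpoch_inf_nonzero[OF assms]) (use power_mult_ne_1[OF assms assms] in auto)

lemma rfac_pred:
  assumes "norm q < 1"
  shows "rfac q (k - 1) = (1 - q powi k) * rfac q k"
proof (cases "k \<le> 0")
  case True
  then show ?thesis by (cases "k = 0") (auto simp: rfac_def)
next
  case False
  then obtain m where m: "k = int (Suc m)"
    by (metis not0_implies_Suc not_le of_nat_0 of_nat_0_less_iff of_nat_le_0_iff pos_int_cases)
  have pk: "q powi k = q ^ Suc m"
    unfolding m by (rule power_int_of_nat)
  have "qpoch q q (Suc m) = qpoch q q m * (1 - q powi k)"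
    unfolding pk by (simp add: qpoch_Suc mult.commute)
  moreover have "qpoch q q (Suc m) \<noteq> 0" "qpoch q q m \<noteq> 0"
    using qpoch_self_nonzero[OF assms] by auto
  moreover have "rfac q k = inverse (qpoch q q (Suc m))" "rfac q (k - 1) = inverse (qpoch q q m)"
    unfolding m rfac_def nat_int by simp_all
  ultimately show ?thesis by simp
qed

lemma rfac_bounded:
  assumes "norm q < 1"
  obtains C where "C > 0" "\<And>k. norm (rfac q k) \<le> C"
proof -
  obtain C where C: "C > 0" "\<And>n. norm (inverse (qpoch q q n)) \<le> C"
    using inverse_qpoch_bounded[OF assms power_mult_ne_1[OF assms assms]] by blast
  then show ?thesis
    by (intro that[of C]) (auto simp: rfac_def)
qed

lemma rfac_LIMSEQ:
  assumes "norm q < 1"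
  shows "(\<lambda>n. rfac q (int n + k)) \<longlonglongrightarrow> inverse (qpoch_inf q q)"
proof -
  have "(\<lambda>n. inverse (qpoch q q n)) \<longlonglongrightarrow> inverse (qpoch_inf q q)"
    by (intro tendsto_inverse qpoch_LIMSEQ assms qpoch_inf_self_nonzero)
  moreover have "filterlim (\<lambda>n. nat (int n + k)) sequentially sequentially"
    unfolding filterlim_at_top
  proof
    fix Z :: nat
    show "\<forall>\<^sub>F n in sequentially. Z \<le> nat (int n + k)"
      using eventually_ge_at_top[of "Z + nat (- k)"] by eventually_elim linarith
  qed
  ultimately have "(\<lambda>n. inverse (qpoch q q (nat (int n + k)))) \<longlonglongrightarrow> inverse (qpoch_inf q q)"
    by (rule filterlim_compose)
  moreover have "eventually (\<lambda>n. inverse (qpoch q q (nat (int n + k))) = rfac q (int n + k)) sequentially"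
    using eventually_ge_at_top[of "nat (- k)"] by eventually_elim (simp add: rfac_def)
  ultimately show ?thesis by (rule Lim_transform_eventually)
qed

lemma rfac_product_finite_support: "finite {k. rfac q (int n - k) * rfac q (int n + k) \<noteq> 0}"
proof (rule finite_subset)
  show "{k. rfac q (int n - k) * rfac q (int n + k) \<noteq> 0} \<subseteq> {- int n..int n}"
    by (auto simp: rfac_def split: if_splits)
qed simp

lemma summable_rfac_product:
  "(\<lambda>k. f k * (rfac q (int n - k) * rfac q (int n + k))) summable_on UNIV"
  by (rule finite_nonzero_values_imp_summable_on)
     (rule finite_subset[OF _ rfac_product_finite_support[of q n]], auto)

text \<open>The q-binomial theorem with centred summation index. Passing from n to n + 1 multiplies
  the right-hand side by two factors that are linear in x and 1/x; coefficientwise this is a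
  relation between three neighbouring coefficients, and after division by a common factor it is a
  polynomial identity in A = q^(n+1-k) and B = q^(n+1+k).\<close>

lemma finite_triple_product:
  assumes "norm q < 1" "q \<noteq> 0" "x \<noteq> 0"
  shows "(\<Sum>\<^sub>\<infinity>k. q powi tri k * (- x) powi k * (rfac q (int n - k) * rfac q (int n + k)))
    = qpoch x q n * qpoch (q / x) q n / qpoch q q (2 * n)"
proof (induction n)
  case 0
  have "(\<Sum>\<^sub>\<infinity>k. q powi tri k * (- x) powi k * (rfac q (- k) * rfac q k))
      = (\<Sum>\<^sub>\<infinity>k\<in>{0::int}. q powi tri k * (- x) powi k * (rfac q (- k) * rfac q k))"
    by (rule infsum_cong_neutral) (auto simp: rfac_def)
  then show ?case by (simp add: rfac_def)
next
  case (Suc n)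
  define c where "c = (\<lambda>n k. q powi tri k * (- x) powi k * (rfac q (int n - k) * rfac q (int n + k)))"
  define T where "T = (\<lambda>n. \<Sum>\<^sub>\<infinity>k. c n k)"
  have sum_c: "c n summable_on UNIV" for n
    unfolding c_def by (rule summable_rfac_product)
  have rec: "(1 - q ^ (2 * n + 2)) * (1 - q ^ (2 * n + 1)) * c (Suc n) k
     = (1 + q ^ (2 * n + 1)) * c n k + (- (x * q ^ n)) * c n (k + - 1) + (- (q ^ Suc n / x)) * c n (k + 1)" for k
  proof -
    define A where "A = q powi (int (Suc n) - k)"
    define B where "B = q powi (int (Suc n) + k)"
    define R where "R = rfac q (int (Suc n) - k) * rfac q (int (Suc n) + k)"
    define E where "E = q powi tri k * (- x) powi k"
    have nz: "q \<noteq> 0" "x \<noteq> 0" by fact+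
    \<comment> \<open>In terms of A and B the recurrence becomes an identity of polynomials.\<close>
    have AB: "q ^ (2 * n + 2) = A * B"
      using nz by (simp add: A_def B_def flip: power_int_add power_int_of_nat)
    have AB': "q ^ (2 * n + 1) = A * B / q"
      using AB nz by (simp add: field_simps)
    have Aq: "q powi (int n - k) = A / q" and Bq: "q powi (int n + k) = B / q"
      using nz by (simp_all add: A_def B_def power_int_diff power_int_add)
    have c1: "c (Suc n) k = E * R" by (simp add: c_def E_def R_def)
    have "rfac q (int n - k) = (1 - A) * rfac q (int (Suc n) - k)"
      using rfac_pred[OF assms(1), of "int (Suc n) - k"] by (simp add: A_def)
    moreover have "rfac q (int n + k) = (1 - B) * rfac q (int (Suc n) + k)"
      using rfac_pred[OF assms(1), of "int (Suc n) + k"] by (simp add: B_def)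
    ultimately have rf: "rfac q (int n - k) = (1 - A) * rfac q (int (Suc n) - k)"
      "rfac q (int n + k) = (1 - B) * rfac q (int (Suc n) + k)" by auto
    have rf2: "rfac q (int n - k - 1) = (1 - A / q) * (1 - A) * rfac q (int (Suc n) - k)"
      "rfac q (int n + k - 1) = (1 - B / q) * (1 - B) * rfac q (int (Suc n) + k)"
      using rfac_pred[OF assms(1), of "int n - k"] rfac_pred[OF assms(1), of "int n + k"]
      unfolding rf Aq Bq by (simp_all only: mult.assoc)
    have c2: "c n k = E * R * ((1 - A) * (1 - B))"
      unfolding c_def rf by (simp add: E_def R_def)
    have c3: "- (x * q ^ n) * c n (k + - 1) = E * R * (A * ((1 - B / q) * (1 - B)))"
    proof -
      have 1: "int n - (k + - 1) = int (Suc n) - k" "int n + (k + - 1) = int n + k - 1" by auto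
      have "- (x * q ^ n) * (q powi tri (k + - 1) * (- x) powi (k + - 1)) = E * A"
      proof -
        have "(- x) powi (k + - 1) = (- x) powi k / (- x)"
          using nz power_int_diff[of "- x" k 1] by simp
        moreover have "q powi tri (k + - 1) * q ^ n = q powi tri k * A"
        proof -
          have "tri (k + - 1) + int n = tri k + (int (Suc n) - k)"
            using tri_pred[of k] by simp
          then have "q powi (tri (k + - 1) + int n) = q powi (tri k + (int (Suc n) - k))"
            by (simp only:)
          then show ?thesis
            using nz by (simp add: A_def power_int_add del: add_uminus_conv_diff)
        qed
        moreover have "- (x * a) * (p * y) = (p * a) * (- x * y)" for a p y
          by (simp add: mult_ac)
        ultimately show ?thesis
          using nz by (simp add: E_def mult.commute[of "q ^ n"])
      qed
      moreover have "- (x * q ^ n) * c n (k + - 1) = (- (x * q ^ n) * (q powi tri (k + - 1) * (- x) powi (k + - 1)))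
          * (rfac q (int n - (k + - 1)) * rfac q (int n + (k + - 1)))"
        unfolding c_def by (rule mult.assoc[symmetric])
      ultimately have "- (x * q ^ n) * c n (k + - 1) = E * A * (rfac q (int n - (k + - 1)) * rfac q (int n + (k + - 1)))"
        by (simp only:)
      then show ?thesis
        unfolding 1 rf2 by (simp only: R_def mult_ac)
    qed
    have c4: "- (q ^ Suc n / x) * c n (k + 1) = E * R * (B * ((1 - A / q) * (1 - A)))"
    proof -
      have 1: "int n - (k + 1) = int n - k - 1" "int n + (k + 1) = int (Suc n) + k" by auto
      have "- (q ^ Suc n / x) * (q powi tri (k + 1) * (- x) powi (k + 1)) = E * B"
      proof -
        have "(- x) powi (k + 1) = (- x) powi k * (- x)"
          using nz by (simp add: power_int_add)
        moreover have "q powi tri (k + 1) * q ^ Suc n = q powi tri k * B"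
        proof -
          have "tri (k + 1) + int (Suc n) = tri k + (int (Suc n) + k)"
            using tri_succ[of k] by simp
          then have "q powi (tri (k + 1) + int (Suc n)) = q powi (tri k + (int (Suc n) + k))"
            by (simp only:)
          then show ?thesis
            using nz by (simp add: B_def power_int_add)
        qed
        ultimately show ?thesis
          using nz by (simp add: E_def field_simps)
      qed
      moreover have "- (q ^ Suc n / x) * c n (k + 1) = (- (q ^ Suc n / x) * (q powi tri (k + 1) * (- x) powi (k + 1)))
          * (rfac q (int n - (k + 1)) * rfac q (int n + (k + 1)))"
        unfolding c_def by (rule mult.assoc[symmetric])
      ultimately have "- (q ^ Suc n / x) * c n (k + 1) = E * B * (rfac q (int n - (k + 1)) * rfac q (int n + (k + 1)))"
        by (simp only:)
      then show ?thesis
        unfolding 1 rf2 by (simp only: R_def mult_ac)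
    qed
    have "(1 - A * B) * (1 - A * B / q) = (1 + A * B / q) * ((1 - A) * (1 - B))
        + A * ((1 - B / q) * (1 - B)) + B * ((1 - A / q) * (1 - A))"
      using nz by (simp add: field_simps)
    then have "E * R * ((1 - A * B) * (1 - A * B / q)) = E * R * ((1 + A * B / q) * ((1 - A) * (1 - B))
        + A * ((1 - B / q) * (1 - B)) + B * ((1 - A / q) * (1 - A)))" by simp
    then show ?thesis
      unfolding c1 c2 c3 c4 AB AB' by (simp only: distrib_left mult_ac)
  qed
  have s1: "(\<lambda>k. (1 + q ^ (2 * n + 1)) * c n k) summable_on UNIV"
    by (rule summable_on_cmult_right[OF sum_c])
  have s2: "(\<lambda>k. (- (x * q ^ n)) * c n (k + - 1)) summable_on UNIV"
    by (rule summable_on_cmult_right) (rule summable_int_shift[THEN iffD2, OF sum_c])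
  have s3: "(\<lambda>k. (- (q ^ Suc n / x)) * c n (k + 1)) summable_on UNIV"
    by (rule summable_on_cmult_right) (rule summable_int_shift[THEN iffD2, OF sum_c])
  have "(1 - q ^ (2 * n + 2)) * (1 - q ^ (2 * n + 1)) * T (Suc n)
      = (\<Sum>\<^sub>\<infinity>k. (1 - q ^ (2 * n + 2)) * (1 - q ^ (2 * n + 1)) * c (Suc n) k)"
    unfolding T_def by (rule infsum_cmult_right'[symmetric])
  also have "\<dots> = (\<Sum>\<^sub>\<infinity>k. (1 + q ^ (2 * n + 1)) * c n k + (- (x * q ^ n)) * c n (k + - 1) + (- (q ^ Suc n / x)) * c n (k + 1))"
    by (simp only: rec)
  also have "\<dots> = (\<Sum>\<^sub>\<infinity>k. (1 + q ^ (2 * n + 1)) * c n k) + (\<Sum>\<^sub>\<infinity>k. (- (x * q ^ n)) * c n (k + - 1))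
      + (\<Sum>\<^sub>\<infinity>k. (- (q ^ Suc n / x)) * c n (k + 1))"
    by (simp only: infsum_add[OF summable_on_add[OF s1 s2] s3] infsum_add[OF s1 s2])
  also have "\<dots> = (1 + q ^ (2 * n + 1)) * T n + (- (x * q ^ n)) * T n + (- (q ^ Suc n / x)) * T n"
    unfolding infsum_cmult_right' infsum_int_shift T_def ..
  also have "\<dots> = (1 - q ^ n * x) * (1 - q ^ n * (q / x)) * T n"
    using assms by (simp add: field_simps mult_2_right power_add)
  finally have *: "(1 - q ^ (2 * n + 2)) * (1 - q ^ (2 * n + 1)) * T (Suc n)
    = (1 - q ^ n * x) * (1 - q ^ n * (q / x)) * T n" .
  have q2: "qpoch q q (2 * Suc n) = qpoch q q (2 * n) * ((1 - q ^ (2 * n + 2)) * (1 - q ^ (2 * n + 1)))"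
    by (simp add: qpoch_Suc mult_ac)
  have "qpoch q q (2 * Suc n) \<noteq> 0" "qpoch q q (2 * n) \<noteq> 0"
    using qpoch_self_nonzero[OF assms(1)] by auto
  then have nz: "(1 - q ^ (2 * n + 2)) * (1 - q ^ (2 * n + 1)) \<noteq> 0" "qpoch q q (2 * n) \<noteq> 0"
    using q2 by auto
  have IH: "T n = qpoch x q n * qpoch (q / x) q n / qpoch q q (2 * n)"
    using Suc by (simp add: T_def c_def)
  have "T (Suc n) = (1 - q ^ n * x) * (1 - q ^ n * (q / x)) * T n / ((1 - q ^ (2 * n + 2)) * (1 - q ^ (2 * n + 1)))"
    using * nz(1) by (metis nonzero_mult_div_cancel_left)
  also have "\<dots> = qpoch x q (Suc n) * qpoch (q / x) q (Suc n) / qpoch q q (2 * Suc n)"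
    unfolding IH q2 qpoch_Suc[of x] qpoch_Suc[of "q / x"] using nz by (simp add: mult_ac)
  finally show ?case by (simp add: T_def c_def)
qed

text \<open>Jacobi's triple product, the limit of \<open>finite_triple_product\<close>.\<close>

lemma theta_j_series:
  assumes "norm q < 1" "q \<noteq> 0" "x \<noteq> 0"
  shows "theta_j x q = (\<Sum>\<^sub>\<infinity>k. q powi tri k * (- x) powi k)"
proof -
  define J where "J = qpoch_inf q q"
  have J: "J \<noteq> 0" unfolding J_def by (rule qpoch_inf_self_nonzero[OF assms(1)])
  obtain C where C: "C > 0" "\<And>k. norm (rfac q k) \<le> C"
    using rfac_bounded[OF assms(1)] by blast
  have "(\<lambda>n. \<Sum>\<^sub>\<infinity>k. q powi tri k * (- x) powi k * (rfac q (int n - k) * rfac q (int n + k)))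
      \<longlonglongrightarrow> (\<Sum>\<^sub>\<infinity>k. q powi tri k * (- x) powi k * (inverse J * inverse J))"
  proof (rule tendsto_infsum_int_dominated)
    fix k
    show "(\<lambda>n. q powi tri k * (- x) powi k * (rfac q (int n - k) * rfac q (int n + k)))
        \<longlonglongrightarrow> q powi tri k * (- x) powi k * (inverse J * inverse J)"
      using rfac_LIMSEQ[OF assms(1), of "- k"] rfac_LIMSEQ[OF assms(1), of k] unfolding J_def
      by (intro tendsto_mult tendsto_const) simp_all
  next
    fix n k
    show "norm (q powi tri k * (- x) powi k * (rfac q (int n - k) * rfac q (int n + k)))
        \<le> norm (q powi tri k * (- x) powi k) * (C * C)"
      unfolding norm_mult[of _ "rfac q (int n - k) * rfac q (int n + k)"]
      unfolding norm_mult[of "rfac q (int n - k)"]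
      by (intro mult_left_mono mult_mono C) (use C in \<open>auto simp: less_imp_le\<close>)
  next
    show "(\<lambda>k. norm (q powi tri k * (- x) powi k) * (C * C)) summable_on UNIV"
      by (rule summable_on_cmult_left) (rule theta_terms_abs_summable, use assms in auto)
  qed
  moreover have "(\<lambda>n. \<Sum>\<^sub>\<infinity>k. q powi tri k * (- x) powi k * (rfac q (int n - k) * rfac q (int n + k)))
      \<longlonglongrightarrow> qpoch_inf x q * qpoch_inf (q / x) q / J"
    unfolding finite_triple_product[OF assms] J_def
    by (intro tendsto_divide tendsto_mult qpoch_LIMSEQ assms(1) qpoch_inf_self_nonzero
        filterlim_compose[OF qpoch_LIMSEQ[OF assms(1)]] mult_nat_left_at_top) simp
  ultimately have "(\<Sum>\<^sub>\<infinity>k. q powi tri k * (- x) powi k * (inverse J * inverse J))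
      = qpoch_inf x q * qpoch_inf (q / x) q / J"
    by (rule LIMSEQ_unique)
  then have "(\<Sum>\<^sub>\<infinity>k. q powi tri k * (- x) powi k) * (inverse J * inverse J)
      = qpoch_inf x q * qpoch_inf (q / x) q / J"
    by (simp only: infsum_cmult_left')
  then show ?thesis
    using J by (simp add: theta_j_def J_def[symmetric] field_simps)
qed

lemma theta_j_nonzero:
  assumes "norm q < 1" "q \<noteq> 0" "x \<noteq> 0" "\<And>i::int. x * q powi i \<noteq> 1"
  shows "theta_j x q \<noteq> 0"
proof -
  have "qpoch_inf x q \<noteq> 0"
    by (rule qpoch_inf_nonzero[OF assms(1)]) (use assms(4)[of "int _"] in \<open>auto simp: mult.commute\<close>)
  moreover have "qpoch_inf (q / x) q \<noteq> 0"
  proof (rule qpoch_inf_nonzero[OF assms(1)])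
    fix i show "q ^ i * (q / x) \<noteq> 1"
      using assms(4)[of "- int (Suc i)"] assms(2,3)
      unfolding power_int_minus power_int_of_nat by (auto simp: field_simps)
  qed
  ultimately show ?thesis
    using qpoch_inf_self_nonzero[OF assms(1)] by (simp add: theta_j_def)
qed

lemma theta_j_reflect:
  assumes "q \<noteq> 0"
  shows "theta_j (q / x) q = theta_j x q"
  using assms by (simp add: theta_j_def mult_ac)

lemma theta_j_shift:
  assumes "norm q < 1" "q \<noteq> 0" "x \<noteq> 0"
  shows "theta_j (q powi m * x) q = (- x) powi (- m) * q powi (- tri m) * theta_j x q"
proof -
  have "theta_j (q powi m * x) q = (\<Sum>\<^sub>\<infinity>k. q powi tri k * (- (q powi m * x)) powi k)"
    by (rule theta_j_series) (use assms in auto)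
  also have "\<dots> = (\<Sum>\<^sub>\<infinity>k. ((- x) powi (- m) * q powi (- tri m)) * (q powi tri (k + m) * (- x) powi (k + m)))"
  proof (rule infsum_cong)
    fix k
    have "q powi tri (k + m) = q powi tri k * q powi tri m * q powi (m * k)"
      using assms by (simp add: tri_add power_int_add mult_ac)
    moreover have "(- (q powi m * x)) powi k = q powi (m * k) * (- x) powi k"
      using power_int_mult_distrib[of "q powi m" "- x" k] by (simp add: power_int_mult)
    moreover have "(- x) powi (k + m) = (- x) powi k * (- x) powi m"
      using assms by (simp add: power_int_add)
    moreover have "q powi tri m \<noteq> 0" "(- x) powi m \<noteq> 0"
      using assms by simp_all
    ultimately show "q powi tri k * (- (q powi m * x)) powi k
        = ((- x) powi (- m) * q powi (- tri m)) * (q powi tri (k + m) * (- x) powi (k + m))"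
      using assms by (simp add: power_int_minus_divide field_simps)
  qed
  also have "\<dots> = (- x) powi (- m) * q powi (- tri m) * theta_j x q"
    unfolding infsum_cmult_right' infsum_int_shift[of "\<lambda>k. q powi tri k * (- x) powi k"]
    by (simp add: theta_j_series[OF assms])
  finally show ?thesis .
qed

lemma theta_j_inverse:
  assumes "norm q < 1" "q \<noteq> 0" "x \<noteq> 0"
  shows "theta_j (1 / x) q = - theta_j x q / x"
proof -
  have "theta_j (q powi 1 * (1 / x)) q = (- (1 / x)) powi (- 1) * q powi (- tri 1) * theta_j (1 / x) q"
    by (rule theta_j_shift) (use assms in auto)
  then show ?thesis
    using theta_j_reflect[of q x] assms by (simp add: power_int_minus divide_simps)
qed

section \<open>Partial fractions and Kronecker's formula\<close>

text \<open>The reciprocals tend to 1 in one direction and decay geometrically in the other. The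
  decay rate in the negative direction is what makes Kronecker's series converge in the full
  annulus between |q| and 1.\<close>

lemma inverse_one_minus_bounded:
  fixes q b :: complex
  assumes "norm q < 1" "q \<noteq> 0" "b \<noteq> 0" "\<And>s::int. b * q powi s \<noteq> 1"
  obtains C where "C > 0" "\<And>s. norm (1 / (1 - b * q powi s)) \<le> C"
    "\<And>n. norm (1 / (1 - b * q powi (- int n))) \<le> C * norm q ^ n"
proof -
  have q0: "(\<lambda>n. q ^ n) \<longlonglongrightarrow> 0"
    by (rule LIMSEQ_power_zero[OF assms(1)])
  have "(\<lambda>n. 1 / (1 - b * q ^ n)) \<longlonglongrightarrow> 1 / (1 - b * 0)"
    by (intro tendsto_intros q0) simp
  then have "Bseq (\<lambda>n. 1 / (1 - b * q ^ n))"
    by (intro convergent_imp_Bseq convergentI)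
  then obtain C1 where C1: "C1 > 0" "\<And>n. norm (1 / (1 - b * q ^ n)) \<le> C1"
    unfolding Bseq_def by blast
  have "(\<lambda>n. 1 / (q ^ n - b)) \<longlonglongrightarrow> 1 / (0 - b)"
    by (intro tendsto_intros q0) (use assms in simp)
  then have "Bseq (\<lambda>n. 1 / (q ^ n - b))"
    by (intro convergent_imp_Bseq convergentI)
  then obtain C2 where C2: "C2 > 0" "\<And>n. norm (1 / (q ^ n - b)) \<le> C2"
    unfolding Bseq_def by blast
  have neg: "norm (1 / (1 - b * q powi (- int n))) \<le> C2 * norm q ^ n" for n
  proof -
    have "1 / (1 - b * q powi (- int n)) = q ^ n * (1 / (q ^ n - b))"
      using assms(2) by (simp add: power_int_minus divide_simps)
    then have "norm (1 / (1 - b * q powi (- int n))) = norm q ^ n * norm (1 / (q ^ n - b))"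
      by (simp add: norm_mult norm_power norm_divide)
    also have "\<dots> \<le> norm q ^ n * C2"
      by (intro mult_left_mono C2) simp
    finally show ?thesis by (simp add: mult.commute)
  qed
  show ?thesis
  proof (rule that[of "max C1 C2"])
    fix s :: int
    show "norm (1 / (1 - b * q powi s)) \<le> max C1 C2"
    proof (cases s rule: int_cases2)
      case (nonneg n)
      then show ?thesis using C1(2)[of n] by simp
    next
      case (nonpos n)
      have "norm q ^ n \<le> 1" using assms(1) by (simp add: power_le_one)
      then have "C2 * norm q ^ n \<le> C2 * 1"
        using C2(1) by (intro mult_left_mono) auto
      with neg[of n] nonpos show ?thesis by simp
    qed
  next
    fix n
    show "norm (1 / (1 - b * q powi (- int n))) \<le> max C1 C2 * norm q ^ n"
      by (rule order_trans[OF neg]) (intro mult_right_mono, auto)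
  qed (use C1 in auto)
qed

text \<open>The partial fraction expansion in x of the right-hand side, which has its poles at
  x = q^(-r) with r between -n and n. Clearing the two new denominators in the step from n to
  n + 1 leaves, apart from the sum for n, a remainder free of poles. It is a combination of the
  finite triple products at 1 and at q, which vanish.\<close>

lemma finite_partial_fractions:
  fixes q x :: complex
  assumes "norm q < 1" "q \<noteq> 0" "x \<noteq> 0" "\<And>s::int. x * q powi s \<noteq> 1"
  shows "(\<Sum>\<^sub>\<infinity>r. (- 1) powi r * q powi (tri r + r) / (1 - x * q powi r) * (rfac q (int n - r) * rfac q (int n + r)))
    = 1 / (qpoch x q (Suc n) * qpoch (q / x) q n)"
proof (induction n)
  case 0
  have "(\<Sum>\<^sub>\<infinity>r. (- 1) powi r * q powi (tri r + r) / (1 - x * q powi r) * (rfac q (- r) * rfac q r))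
      = (\<Sum>\<^sub>\<infinity>r\<in>{0::int}. (- 1) powi r * q powi (tri r + r) / (1 - x * q powi r) * (rfac q (- r) * rfac q r))"
    by (rule infsum_cong_neutral) (auto simp: rfac_def)
  then show ?case by (simp add: rfac_def qpoch_Suc)
next
  case (Suc n)
  define m where "m = Suc n"
  define d where "d = (\<lambda>n r. (- 1) powi r * q powi (tri r + r) / (1 - x * q powi r) * (rfac q (int n - r) * rfac q (int n + r)))"
  define c where "c = (\<lambda>y r. q powi tri r * (- y) powi r * (rfac q (int m - r) * rfac q (int m + r)))"
  have sums: "d n summable_on UNIV" "c y summable_on UNIV" for n y
    unfolding d_def c_def by (rule summable_rfac_product)+
  have zero: "(\<Sum>\<^sub>\<infinity>r. c 1 r) = 0" "(\<Sum>\<^sub>\<infinity>r. c q r) = 0"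
  proof -
    have "qpoch 1 q m = 0"
      unfolding qpoch_def m_def by (rule prod_zero[OF _ bexI[of _ 0]]) auto
    then show "(\<Sum>\<^sub>\<infinity>r. c 1 r) = 0" "(\<Sum>\<^sub>\<infinity>r. c q r) = 0"
      unfolding c_def using finite_triple_product[OF assms(1,2), of 1 m]
        finite_triple_product[OF assms(1,2), of q m] assms(2) by simp_all
  qed
  have rec: "(1 - q ^ m * x) * (1 - q ^ n * (q / x)) * d m r
      = d n r + (q ^ m * c 1 r + (- (q ^ m / x)) * c q r)" for r
  proof -
    define A where "A = q powi (int m - r)"
    define B where "B = q powi (int m + r)"
    define Y where "Y = q powi r"
    define R where "R = rfac q (int m - r) * rfac q (int m + r)"
    define E where "E = (- 1) powi r * q powi tri r"
    have Y: "Y \<noteq> 0" "x * Y \<noteq> 1" using assms by (auto simp: Y_def)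
    have A: "A = q ^ m / Y" and B: "B = q ^ m * Y"
      using assms(2) by (simp_all add: A_def B_def Y_def power_int_diff power_int_add)
    have "int n - r = int m - r - 1" "int n + r = int m + r - 1" by (simp_all add: m_def)
    then have rf: "rfac q (int n - r) * rfac q (int n + r) = (1 - A) * (1 - B) * R"
      by (simp only: rfac_pred[OF assms(1)] A_def B_def R_def mult_ac)
    have d1: "d m r = E * Y / (1 - x * Y) * R"
      unfolding d_def R_def E_def Y_def using assms(2) by (simp add: power_int_add)
    have d2: "d n r = E * Y / (1 - x * Y) * ((1 - A) * (1 - B) * R)"
      unfolding d_def rf E_def Y_def using assms(2) by (simp add: power_int_add)
    have c1: "c 1 r = E * R"
      unfolding c_def R_def E_def by (simp add: mult_ac)
    have c2: "c q r = E * Y * R"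
      unfolding c_def R_def E_def Y_def using power_int_mult_distrib[of "-1" q r] by (simp add: mult_ac)
    have qn: "q ^ n * (q / x) = q ^ m / x" by (simp add: m_def)
    have "(1 - q ^ m * x) * (1 - q ^ m / x) * (Y / (1 - x * Y))
        = Y / (1 - x * Y) * ((1 - A) * (1 - B)) + (q ^ m - q ^ m / x * Y)"
    proof -
      have "(1 - q ^ m * x) * (1 - q ^ m / x) * Y = Y * ((1 - A) * (1 - B)) + (q ^ m - q ^ m / x * Y) * (1 - x * Y)"
        unfolding A B using Y(1) assms(3) by (simp add: field_simps)
      then show ?thesis using Y(2) by (simp add: field_simps)
    qed
    moreover have "P * (E * y / D * R) = E * y / D * (M * R) + (u * (E * R) + (- w) * (E * y * R))"
      if "P * (y / D) = y / D * M + (u - w * y)" for P D M u w y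
    proof -
      have "P * (E * y / D * R) = P * (y / D) * (E * R)" by (simp add: mult_ac)
      also have "\<dots> = E * y / D * (M * R) + (u * (E * R) + (- w) * (E * y * R))"
        unfolding that by (simp add: ring_distribs mult_ac)
      finally show ?thesis .
    qed
    ultimately show ?thesis
      unfolding d1 d2 c1 c2 qn by blast
  qed
  have "(1 - q ^ m * x) * (1 - q ^ n * (q / x)) * (\<Sum>\<^sub>\<infinity>r. d m r)
      = (\<Sum>\<^sub>\<infinity>r. d n r + (q ^ m * c 1 r + (- (q ^ m / x)) * c q r))"
    unfolding rec[symmetric] by (rule infsum_cmult_right'[symmetric])
  also have "\<dots> = (\<Sum>\<^sub>\<infinity>r. d n r) + (q ^ m * (\<Sum>\<^sub>\<infinity>r. c 1 r) + (- (q ^ m / x)) * (\<Sum>\<^sub>\<infinity>r. c q r))"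
    using sums by (simp only: infsum_add summable_on_add summable_on_cmult_right infsum_cmult_right')
  also have "\<dots> = 1 / (qpoch x q (Suc n) * qpoch (q / x) q n)"
    unfolding zero using Suc by (simp add: d_def)
  finally have *: "(1 - q ^ m * x) * (1 - q ^ n * (q / x)) * (\<Sum>\<^sub>\<infinity>r. d m r)
      = 1 / (qpoch x q (Suc n) * qpoch (q / x) q n)" .
  have nz: "1 - q ^ m * x \<noteq> 0" "1 - q ^ n * (q / x) \<noteq> 0"
  proof -
    show "1 - q ^ m * x \<noteq> 0" using assms(4)[of "int m"] by (simp add: mult.commute)
    show "1 - q ^ n * (q / x) \<noteq> 0"
    proof
      assume "1 - q ^ n * (q / x) = 0"
      then have "q ^ m = x" using assms(3) by (simp add: m_def field_simps)
      then have "x * q powi (- int m) = 1"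
        using assms(3) by (simp add: power_int_minus)
      then show False using assms(4) by blast
    qed
  qed
  have "(\<Sum>\<^sub>\<infinity>r. d m r) = 1 / (qpoch x q (Suc n) * qpoch (q / x) q n) / ((1 - q ^ m * x) * (1 - q ^ n * (q / x)))"
    unfolding *[symmetric] using nz by simp
  also have "\<dots> = 1 / (qpoch x q (Suc m) * qpoch (q / x) q m)"
    by (simp add: m_def qpoch_Suc mult_ac)
  finally show ?case by (simp add: m_def d_def)
qed

lemma reciprocal_theta_terms_summable:
  fixes q x y :: complex
  assumes "norm q < 1" "q \<noteq> 0" "x \<noteq> 0" "\<And>s::int. x * q powi s \<noteq> 1" "y \<noteq> 0"
  shows "(\<lambda>r. norm (q powi tri r * y powi r / (1 - x * q powi r))) summable_on UNIV"
proof -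
  obtain C where C: "C > 0" "\<And>s. norm (1 / (1 - x * q powi s)) \<le> C"
    by (rule inverse_one_minus_bounded[OF assms(1-4)]) (rule that)
  have "norm (q powi tri r * y powi r / (1 - x * q powi r)) \<le> norm (q powi tri r * y powi r) * C" for r
  proof -
    have "norm (q powi tri r * y powi r / (1 - x * q powi r))
        = norm (q powi tri r * y powi r) * norm (1 / (1 - x * q powi r))"
      by (simp add: norm_divide)
    also have "\<dots> \<le> norm (q powi tri r * y powi r) * C"
      by (intro mult_left_mono C) simp
    finally show ?thesis .
  qed
  then show ?thesis
    by (intro Infinite_Sum.abs_summable_on_comparison_test'[OF
          summable_on_cmult_left[OF theta_terms_abs_summable[OF assms(1,2,5)]]]) auto
qed

text \<open>The expansion of the reciprocal of a theta function, as the limit of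
  \<open>finite_partial_fractions\<close>.\<close>

lemma reciprocal_theta_series:
  assumes "norm q < 1" "q \<noteq> 0" "x \<noteq> 0" "\<And>s::int. x * q powi s \<noteq> 1"
  shows "(\<Sum>\<^sub>\<infinity>r. q powi tri r * (- q) powi r / (1 - x * q powi r)) = qpoch_inf q q ^ 3 / theta_j x q"
proof -
  define J where "J = qpoch_inf q q"
  have J: "J \<noteq> 0" unfolding J_def by (rule qpoch_inf_self_nonzero[OF assms(1)])
  have th: "theta_j x q \<noteq> 0" by (rule theta_j_nonzero[OF assms])
  then have pq: "qpoch_inf x q \<noteq> 0" "qpoch_inf (q / x) q \<noteq> 0" by (auto simp: theta_j_def)
  define e where "e = (\<lambda>r. q powi tri r * (- q) powi r / (1 - x * q powi r))"
  have e: "(- 1) powi r * q powi (tri r + r) / (1 - x * q powi r) = e r" for r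
  proof -
    have "(- q) powi r = (- 1) powi r * q powi r"
      using power_int_mult_distrib[of "-1" q r] by simp
    moreover have "q powi (tri r + r) = q powi tri r * q powi r"
      using assms(2) by (simp add: power_int_add)
    ultimately show ?thesis by (simp only: e_def mult_ac)
  qed
  obtain C where C: "C > 0" "\<And>k. norm (rfac q k) \<le> C"
    using rfac_bounded[OF assms(1)] by blast
  have "(\<lambda>n. \<Sum>\<^sub>\<infinity>r. e r * (rfac q (int n - r) * rfac q (int n + r)))
      \<longlonglongrightarrow> (\<Sum>\<^sub>\<infinity>r. e r * (inverse J * inverse J))"
  proof (rule tendsto_infsum_int_dominated)
    fix k
    show "(\<lambda>n. e k * (rfac q (int n - k) * rfac q (int n + k)))
        \<longlonglongrightarrow> e k * (inverse J * inverse J)"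
      using rfac_LIMSEQ[OF assms(1), of "- k"] rfac_LIMSEQ[OF assms(1), of k] unfolding J_def
      by (intro tendsto_mult tendsto_const) simp_all
  next
    fix n k
    show "norm (e k * (rfac q (int n - k) * rfac q (int n + k))) \<le> norm (e k) * (C * C)"
      unfolding norm_mult[of _ "rfac q (int n - k) * rfac q (int n + k)"]
      unfolding norm_mult[of "rfac q (int n - k)"]
      by (intro mult_left_mono mult_mono C) (use C in \<open>auto simp: less_imp_le\<close>)
  next
    show "(\<lambda>k. norm (e k) * (C * C)) summable_on UNIV"
      unfolding e_def
      by (rule summable_on_cmult_left) (rule reciprocal_theta_terms_summable, use assms in auto)
  qed
  moreover have "(\<lambda>n. \<Sum>\<^sub>\<infinity>r. e r * (rfac q (int n - r) * rfac q (int n + r)))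
      \<longlonglongrightarrow> 1 / (qpoch_inf x q * qpoch_inf (q / x) q)"
    unfolding finite_partial_fractions[OF assms, unfolded e]
    using LIMSEQ_Suc[OF qpoch_LIMSEQ[OF assms(1), of x]] qpoch_LIMSEQ[OF assms(1), of "q / x"] pq
    by (intro tendsto_divide tendsto_mult tendsto_const) simp_all
  ultimately have "(\<Sum>\<^sub>\<infinity>r. e r * (inverse J * inverse J)) = 1 / (qpoch_inf x q * qpoch_inf (q / x) q)"
    by (rule LIMSEQ_unique)
  then have "(\<Sum>\<^sub>\<infinity>r. e r) * (inverse J * inverse J) = 1 / (qpoch_inf x q * qpoch_inf (q / x) q)"
    by (simp only: infsum_cmult_left')
  then have "(\<Sum>\<^sub>\<infinity>r. e r) = J ^ 3 / theta_j x q"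
    using J pq by (simp add: theta_j_def J_def[symmetric] field_simps power3_eq_cube)
  then show ?thesis by (simp add: e_def J_def)
qed

lemma kronecker_terms_summable:
  fixes q a b :: complex
  assumes "norm q < 1" "q \<noteq> 0" "b \<noteq> 0" "\<And>s::int. b * q powi s \<noteq> 1"
    and a: "norm q < norm a" "norm a < 1"
  shows "(\<lambda>s. norm (a powi s / (1 - b * q powi s))) summable_on UNIV"
proof (rule summable_on_int_split)
  obtain C where C: "C > 0" "\<And>s. norm (1 / (1 - b * q powi s)) \<le> C"
    "\<And>n. norm (1 / (1 - b * q powi (- int n))) \<le> C * norm q ^ n"
    by (rule inverse_one_minus_bounded[OF assms(1-4)]) (rule that)
  have a0: "a \<noteq> 0" using a(1) assms(2) by auto
  have "norm (norm (a powi int n / (1 - b * q powi int n))) \<le> C * norm a ^ n" for n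
  proof -
    have "norm (a powi int n / (1 - b * q powi int n)) = norm a ^ n * norm (1 / (1 - b * q powi int n))"
      by (simp add: norm_divide norm_power)
    also have "\<dots> \<le> norm a ^ n * C" by (intro mult_left_mono C) simp
    finally show ?thesis by (simp add: mult.commute)
  qed
  note bound = this
  have "summable (\<lambda>n. C * norm a ^ n)"
    using a by (intro summable_mult summable_geometric) simp
  then show "summable (\<lambda>n. norm (a powi int n / (1 - b * q powi int n)))"
    by (rule summable_comparison_test'[where N = 0]) (rule bound)
  have "norm (norm (a powi (- int n) / (1 - b * q powi (- int n)))) \<le> C * (norm q / norm a) ^ n" for n
  proof -
    have "norm (a powi (- int n) / (1 - b * q powi (- int n)))
        = inverse (norm a ^ n) * norm (1 / (1 - b * q powi (- int n)))"
      by (simp add: norm_divide norm_power power_int_minus norm_inverse)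
    also have "\<dots> \<le> inverse (norm a ^ n) * (C * norm q ^ n)" by (intro mult_left_mono C) simp
    finally show ?thesis by (simp add: power_divide field_simps)
  qed
  note bound = this
  have "summable (\<lambda>n. C * (norm q / norm a) ^ n)"
    using a a0 by (intro summable_mult summable_geometric) (simp add: divide_simps)
  then show "summable (\<lambda>n. norm (a powi (- int n) / (1 - b * q powi (- int n))))"
    by (rule summable_comparison_test'[where N = 0]) (rule bound)
qed

text \<open>Kronecker's formula. Multiplied by j(a; q), the series has Laurent coefficients g(N) in a
  that satisfy the same first-order recurrence as those of j(ab; q): from
  b q^s / (1 - b q^s) = 1 / (1 - b q^s) - 1 one obtains it up to a multiple of the series for
  j(1; q), which is 0. The factor of proportionality g(0) is a constant divided by j(b; q),
  by \<open>reciprocal_theta_series\<close>.\<close>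

lemma kronecker:
  fixes q a b :: complex
  assumes "norm q < 1" "q \<noteq> 0" "b \<noteq> 0" "\<And>s::int. b * q powi s \<noteq> 1"
    and a: "norm q < norm a" "norm a < 1"
  shows "(\<Sum>\<^sub>\<infinity>s. a powi s / (1 - b * q powi s))
    = qpoch_inf q q ^ 3 * theta_j (a * b) q / (theta_j a q * theta_j b q)"
proof -
  have a0: "a \<noteq> 0" using a(1) assms(2) by auto
  have tha: "theta_j a q \<noteq> 0"
  proof (rule theta_j_nonzero[OF assms(1,2) a0])
    fix i :: int
    show "a * q powi i \<noteq> 1"
    proof
      assume *: "a * q powi i = 1"
      show False
      proof (cases i rule: int_cases2)
        case (nonneg n)
        with * power_mult_ne_1[OF assms(1) a(2), of n] show False by (simp add: mult.commute)
      next
        case (nonpos n)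
        with * have eq: "a = q ^ n" using assms(2) by (simp add: power_int_minus field_simps)
        then have "n \<noteq> 0" using a(2) by (intro notI) auto
        then have "norm q ^ n \<le> norm q ^ 1" using assms(1) by (intro power_decreasing) auto
        with a(1) eq show False by (simp add: norm_power)
      qed
    qed
  qed
  define g where "g = (\<lambda>N. \<Sum>\<^sub>\<infinity>s. q powi tri (N - s) * (- 1) powi (N - s) / (1 - b * q powi s))"
  have summand: "q powi tri (N - s) * (- 1) powi (N - s) / (1 - b * q powi s)
      = (q powi tri N * (- 1) powi N) * (q powi tri s * (- (q powi (1 - N))) powi s / (1 - b * q powi s))" for N s
  proof -
    have "q powi tri (N - s) = q powi tri N * (q powi tri s * (q powi (1 - N)) powi s)"
    proof -
      have "tri (N - s) = tri N + (tri s + (1 - N) * s)"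
        unfolding tri_diff by (simp add: algebra_simps)
      then show ?thesis using assms(2) by (simp add: power_int_add power_int_mult)
    qed
    moreover have "(- 1 :: complex) powi (N - s) = (- 1) powi N * (- 1) powi s"
      by (simp add: power_int_diff power_int_minus_left)
    moreover have "(- (q powi (1 - N))) powi s = (- 1) powi s * (q powi (1 - N)) powi s"
      using power_int_mult_distrib[of "-1" "q powi (1 - N)" s] by simp
    ultimately show ?thesis by (simp add: mult_ac)
  qed
  have g_sum: "(\<lambda>s. q powi tri (N - s) * (- 1) powi (N - s) / (1 - b * q powi s)) summable_on UNIV" for N
    unfolding summand
    by (rule summable_on_cmult_right[OF abs_summable_summable[OF reciprocal_theta_terms_summable]])
       (use assms in auto)
  have g_rec: "g (N + 1) = - b * q powi N * g N" for N
  proof -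
    define v where "v = (\<lambda>N s. q powi tri (N - s) * (- 1) powi (N - s) / (1 - b * q powi s))"
    have v: "v N summable_on UNIV" for N unfolding v_def by (rule g_sum)
    \<comment> \<open>The theta series at 1 vanishes because its product contains the factor 1 - 1.\<close>
    have th0: "(\<Sum>\<^sub>\<infinity>s. q powi tri (N + 1 - s) * (- 1) powi (N + 1 - s)) = 0"
    proof -
      have "(\<Sum>\<^sub>\<infinity>s. q powi tri (N + 1 - s) * (- 1) powi (N + 1 - s)) = (\<Sum>\<^sub>\<infinity>k. q powi tri k * (- 1) powi k)"
        by (rule infsum_reindex_bij_witness[of _ "\<lambda>k. N + 1 - k" "\<lambda>k. N + 1 - k"]) auto
      also have "\<dots> = theta_j 1 q" using theta_j_series[OF assms(1,2), of 1] by simp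
      also have "\<dots> = 0"
      proof -
        have "(\<lambda>n. qpoch 1 q (Suc n)) \<longlonglongrightarrow> qpoch_inf 1 q"
          by (rule LIMSEQ_Suc[OF qpoch_LIMSEQ[OF assms(1)]])
        moreover have "qpoch 1 q (Suc n) = 0" for n
          unfolding qpoch_def by (rule prod_zero[OF _ bexI[of _ 0]]) auto
        ultimately have "qpoch_inf 1 q = 0" by (simp add: LIMSEQ_const_iff)
        then show ?thesis by (simp add: theta_j_def)
      qed
      finally show ?thesis .
    qed
    have eq: "- b * q powi N * v N s = v (N + 1) s - q powi tri (N + 1 - s) * (- 1) powi (N + 1 - s)" for s
    proof -
      have 1: "q powi tri (N + 1 - s) = q powi tri (N - s) * q powi N / q powi s"
      proof -
        have "tri (N + 1 - s) = tri (N - s) + N - s"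
          using tri_succ[of "N - s"] by (simp add: algebra_simps)
        then show ?thesis using assms(2) by (simp add: power_int_add power_int_diff)
      qed
      have 2: "(- 1 :: complex) powi (N + 1 - s) = - ((- 1) powi (N - s))"
        by (simp add: power_int_minus_left)
      have nz: "1 - b * q powi s \<noteq> 0" "q powi s \<noteq> 0" using assms by auto
      have "- b * (T * Y) / D = - (T * Y / S) / D + T * Y / S" if "D = 1 - b * S" "D \<noteq> 0" "S \<noteq> 0" for T Y D S :: complex
        using that(2,3) by (simp add: divide_simps) (simp add: that(1) algebra_simps)
      from this[OF refl nz, of "q powi tri (N - s) * (- 1) powi (N - s)" "q powi N"]
      show ?thesis unfolding v_def 1 2 by (simp add: mult_ac)
    qed
    have "- b * q powi N * g N = (\<Sum>\<^sub>\<infinity>s. - b * q powi N * v N s)"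
      unfolding g_def v_def by (rule infsum_cmult_right'[symmetric])
    also have "\<dots> = (\<Sum>\<^sub>\<infinity>s. v (N + 1) s + - (q powi tri (N + 1 - s) * (- 1) powi (N + 1 - s)))"
      by (simp only: eq diff_conv_add_uminus)
    also have "\<dots> = g (N + 1) + - (\<Sum>\<^sub>\<infinity>s. q powi tri (N + 1 - s) * (- 1) powi (N + 1 - s))"
    proof -
      have "(\<lambda>s. q powi tri (N + 1 - s) * (- 1) powi (N + 1 - s)) summable_on UNIV"
        using theta_terms_summable[OF assms(1,2), of "- 1"]
        by (subst summable_on_reindex_bij_witness[of _ "\<lambda>k. N + 1 - k" "\<lambda>k. N + 1 - k" UNIV "\<lambda>k. q powi tri k * (- 1) powi k"]) auto
      then have "(\<Sum>\<^sub>\<infinity>s. v (N + 1) s + - (q powi tri (N + 1 - s) * (- 1) powi (N + 1 - s)))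
        = (\<Sum>\<^sub>\<infinity>s. v (N + 1) s) + (\<Sum>\<^sub>\<infinity>s. - (q powi tri (N + 1 - s) * (- 1) powi (N + 1 - s)))"
        by (intro infsum_add v summable_on_uminus[THEN iffD2])
      then show ?thesis
        by (simp only: infsum_uminus g_def v_def)
    qed
    finally show ?thesis unfolding th0 by simp
  qed
  have gN: "g N = q powi tri N * (- b) powi N * g 0" for N
  proof -
    have "g (n + 1) / (q powi tri (n + 1) * (- b) powi (n + 1)) = g n / (q powi tri n * (- b) powi n)" for n
      unfolding g_rec using assms(2,3) by (simp add: tri_succ power_int_add)
    from int_shift_invariant[of "\<lambda>n. g n / (q powi tri n * (- b) powi n)", OF this, of N]
    show ?thesis using assms(2,3) by (simp add: field_simps)
  qed
  have g0: "g 0 = qpoch_inf q q ^ 3 / theta_j b q"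
    using reciprocal_theta_series[OF assms(1-4)] unfolding g_def summand by simp
  have "theta_j a q * (\<Sum>\<^sub>\<infinity>s. a powi s / (1 - b * q powi s))
      = (\<Sum>\<^sub>\<infinity>N. \<Sum>\<^sub>\<infinity>s. q powi tri (N - s) * (- a) powi (N - s) * (a powi s / (1 - b * q powi s)))"
    unfolding theta_j_series[OF assms(1,2) a0]
    by (rule infsum_convolution[OF theta_terms_abs_summable kronecker_terms_summable]) (use assms a0 in auto)
  also have "\<dots> = (\<Sum>\<^sub>\<infinity>N. g N * a powi N)"
  proof (rule infsum_cong)
    fix N
    have "q powi tri (N - s) * (- a) powi (N - s) * (a powi s / (1 - b * q powi s))
        = q powi tri (N - s) * (- 1) powi (N - s) / (1 - b * q powi s) * a powi N" for s
    proof -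
      have "(- a) powi (N - s) = (- 1) powi (N - s) * a powi (N - s)"
        using power_int_mult_distrib[of "-1" a "N - s"] by simp
      moreover have "a powi (N - s) * a powi s = a powi N"
        using a0 by (simp flip: power_int_add)
      ultimately show ?thesis by (simp add: mult_ac)
    qed
    then show "(\<Sum>\<^sub>\<infinity>s. q powi tri (N - s) * (- a) powi (N - s) * (a powi s / (1 - b * q powi s))) = g N * a powi N"
      unfolding g_def by (simp only: infsum_cmult_left')
  qed
  also have "\<dots> = (\<Sum>\<^sub>\<infinity>N. q powi tri N * (- (a * b)) powi N * g 0)"
  proof (rule infsum_cong)
    fix N show "g N * a powi N = q powi tri N * (- (a * b)) powi N * g 0"
      using power_int_mult_distrib[of "- b" a N] unfolding gN[of N] by (simp add: mult_ac)
  qed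
  also have "\<dots> = theta_j (a * b) q * g 0"
    unfolding infsum_cmult_left' by (subst theta_j_series[OF assms(1,2)]) (use a0 assms(3) in auto)
  finally have "theta_j a q * (\<Sum>\<^sub>\<infinity>s. a powi s / (1 - b * q powi s)) = theta_j (a * b) q * g 0" .
  then have "(\<Sum>\<^sub>\<infinity>s. a powi s / (1 - b * q powi s)) = theta_j (a * b) q * g 0 / theta_j a q"
    using tha by (metis nonzero_mult_div_cancel_left)
  then show ?thesis unfolding g0 by (simp add: mult_ac)
qed

section \<open>Laurent expansion of Appell sums\<close>

definition appell_sum :: "complex \<Rightarrow> complex \<Rightarrow> complex \<Rightarrow> complex" where
  "appell_sum x z q = (\<Sum>\<^sub>\<infinity>r. q powi tri r * (- z) powi r / (1 - q powi (r - 1) * x * z))"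

lemma neg_one_powi_mult: "(- 1) powi r * z powi r = (- z :: complex) powi r"
  using power_int_mult_distrib[of "-1" z r] by simp

lemma appell_m_eq: "appell_m x z q = appell_sum x z q / theta_j z q"
proof -
  have "(- 1) powi r * q powi (r * (r - 1) div 2) * z powi r = q powi tri r * (- z) powi r" for r
    unfolding neg_one_powi_mult[of r z, symmetric] tri_def by (simp only: mult_ac)
  then show ?thesis by (simp add: appell_m_def appell_sum_def)
qed

lemma appell_terms_summable:
  fixes q x z :: complex
  assumes "norm q < 1" "q \<noteq> 0" "x \<noteq> 0" "z \<noteq> 0" "\<And>s::int. x * z * q powi s \<noteq> 1"
  shows "(\<lambda>r. q powi tri r * (- z) powi r / (1 - q powi (r - 1) * x * z)) summable_on UNIV"
proof -
  have "x * z / q * q powi s = x * z * q powi (s - 1)" for s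
    using assms(2) by (simp add: power_int_diff)
  then have "(\<lambda>r. norm (q powi tri r * (- z) powi r / (1 - x * z / q * q powi r))) summable_on UNIV"
    using assms by (intro reciprocal_theta_terms_summable) auto
  moreover have "x * z / q * q powi r = q powi (r - 1) * x * z" for r
    using assms(2) by (simp add: power_int_diff)
  ultimately show ?thesis
    by (intro abs_summable_summable[of "\<lambda>r. q powi tri r * (- z) powi r / (1 - q powi (r - 1) * x * z)"]) simp
qed

text \<open>Partial sums of a series that diverges, continued to negative N so that the recurrence
  \<open>tri_sum_succ\<close> holds for every integer.\<close>

definition tri_sum :: "complex \<Rightarrow> complex \<Rightarrow> int \<Rightarrow> complex" where
  "tri_sum x q N = (\<Sum>k\<in>{0..<N}. (- x) powi k * q powi (- tri (k + 1)))
     - (\<Sum>k\<in>{N..<0}. (- x) powi k * q powi (- tri (k + 1)))"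

lemma tri_sum_0 [simp]: "tri_sum x q 0 = 0"
  by (simp add: tri_sum_def)

lemma tri_sum_succ: "tri_sum x q (N + 1) = tri_sum x q N + (- x) powi N * q powi (- tri (N + 1))"
proof (cases "N \<ge> 0")
  case True
  then have "{0..<N + 1} = insert N {0..<N}" by auto
  with True show ?thesis by (simp add: tri_sum_def)
next
  case False
  then have "{N..<0} = insert N {N + 1..<0}" by auto
  with False show ?thesis by (simp add: tri_sum_def)
qed

text \<open>The geometric expansion of 1 / (1 - q^(r-1) x z) runs over k \<open>\<ge>\<close> 0 when
  r \<open>\<ge>\<close> 1 and over k < 0, with the opposite sign, when r \<open>\<le>\<close> 0. This function
  is the coefficient of the k-th power in both cases.\<close>

definition cone_sign :: "int \<Rightarrow> int \<Rightarrow> complex" where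
  "cone_sign r k = (if r \<ge> 1 \<and> k \<ge> 0 then 1 else if r \<le> 0 \<and> k < 0 then - 1 else 0)"

lemma geometric_row:
  fixes y :: complex
  assumes "if r \<ge> 1 then norm y < 1 else norm y > 1"
  shows "(\<Sum>\<^sub>\<infinity>k. cone_sign r k * y powi k) = 1 / (1 - y)"
proof (cases "r \<ge> 1")
  case True
  with assms have y: "norm y < 1" by simp
  have "(\<Sum>\<^sub>\<infinity>k. cone_sign r k * y powi k) = (\<Sum>\<^sub>\<infinity>k\<in>{0..}. y powi k)"
    by (rule infsum_cong_neutral) (use True in \<open>auto simp: cone_sign_def\<close>)
  also have "\<dots> = (\<Sum>\<^sub>\<infinity>n. y ^ n)"
    by (rule infsum_reindex_bij_witness[of _ int nat]) (auto simp: power_int_nonneg_exp)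
  also have "\<dots> = 1 / (1 - y)"
  proof -
    have "summable (\<lambda>n. norm (y ^ n))"
      using y by (simp add: norm_power summable_geometric)
    from norm_summable_imp_has_sum[OF this geometric_sums[OF y]]
    show ?thesis by (rule infsumI)
  qed
  finally show ?thesis .
next
  case False
  with assms have y: "norm y > 1" by simp
  then have y0: "y \<noteq> 0" "y \<noteq> 1" by auto
  have iy: "norm (inverse y) < 1" using y by (simp add: norm_inverse inverse_less_1_iff)
  have "(\<Sum>\<^sub>\<infinity>k. cone_sign r k * y powi k) = (\<Sum>\<^sub>\<infinity>k\<in>{..<0}. - (y powi k))"
    by (rule infsum_cong_neutral) (use False in \<open>auto simp: cone_sign_def\<close>)
  also have "\<dots> = (\<Sum>\<^sub>\<infinity>n. - inverse y * inverse y ^ n)"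
  proof (rule infsum_reindex_bij_witness[of _ "\<lambda>n. - int (Suc n)" "\<lambda>k. nat (- k - 1)"])
    fix a :: int assume "a \<in> {..<0}"
    then have a: "a = - int (Suc (nat (- a - 1)))" by simp
    show "- inverse y * inverse y ^ nat (- a - 1) = - (y powi a)"
      by (subst (2) a) (simp only: power_int_minus power_int_of_nat power_inverse power_Suc, simp)
  qed auto
  also have "\<dots> = - inverse y * (1 / (1 - inverse y))"
  proof -
    have "summable (\<lambda>n. norm (inverse y ^ n))"
      using iy unfolding norm_power by (intro summable_geometric) simp
    from infsumI[OF norm_summable_imp_has_sum[OF this geometric_sums[OF iy]]]
    show ?thesis by (simp only: infsum_cmult_right')
  qed
  also have "\<dots> = 1 / (1 - y)"
    using y0 by (simp add: divide_simps)
  finally show ?thesis .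
qed

lemma annulus_not_lattice:
  fixes q a :: complex
  assumes "norm q < 1" "q \<noteq> 0" "norm q < norm a" "norm a < 1"
  shows "if r \<ge> 1 then norm (q powi (r - 1) * a) < 1 else norm (q powi (r - 1) * a) > 1"
proof (cases "r \<ge> 1")
  case True
  have "norm q powi (r - 1) * norm a \<le> 1 * norm a"
    using True assms by (intro mult_right_mono power_int_le_one) auto
  with True assms show ?thesis by (simp add: norm_mult norm_power_int)
next
  case False
  have "norm q powi (r - 1) = norm q powi r / norm q"
    using assms by (simp add: power_int_diff)
  moreover have "norm q powi r \<ge> 1"
    using False assms power_int_decreasing[of r 0 "norm q"] by simp
  ultimately have "norm q powi (r - 1) * norm a \<ge> 1 / norm q * norm a"
    by (intro mult_right_mono) (auto intro: divide_right_mono)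
  moreover have "1 / norm q * norm a > 1" using assms by (simp add: field_simps)
  ultimately show ?thesis using False by (simp add: norm_mult norm_power_int)
qed

text \<open>Expand every summand into a geometric series and collect the powers of z. For the exponent
  N = r + k the identity tri(N - k) + (N - k - 1) k = tri(N) - tri(k + 1) splits off a factor
  that does not depend on k, and the signs cut the remaining sum down to finitely many terms.\<close>

lemma appell_sum_laurent:
  assumes q: "norm q < 1" "q \<noteq> 0" and nz: "x \<noteq> 0" "z \<noteq> 0"
    and ann: "norm q < norm (x * z)" "norm (x * z) < 1"
  shows "((\<lambda>N. q powi tri N * (- z) powi N * tri_sum x q N) has_sum appell_sum x z q) UNIV"
proof -
  define F where "F = (\<lambda>r k. q powi tri r * (- z) powi r * (cone_sign r k * (q powi (r - 1) * (x * z)) powi k))"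
  \<comment> \<open>A majorant in k alone: the exponent r - 1 of q is at least 0 where k is nonnegative
    and at most -1 where k is negative.\<close>
  define g where "g = (\<lambda>k::int. if k \<ge> 0 then (x * z) powi k else (q / (x * z)) powi (- k))"
  have g: "(\<lambda>k. norm (g k)) summable_on UNIV"
  proof (rule summable_on_int_split)
    have "summable (\<lambda>n. norm (x * z) ^ n)" using ann by (intro summable_geometric) simp
    then show "summable (\<lambda>n. norm (g (int n)))" by (simp add: g_def norm_power)
    have "norm (q / (x * z)) < 1" using ann nz by (simp add: norm_divide)
    then have "summable (\<lambda>n. norm (q / (x * z)) ^ n)" by (intro summable_geometric) simp
    moreover have "norm (g (- int n)) = norm (q / (x * z)) ^ n" for n
    proof -
      have "g (- int n) = (q / (x * z)) ^ n" by (cases "n = 0") (simp_all add: g_def)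
      then show ?thesis by (simp add: norm_power)
    qed
    ultimately show "summable (\<lambda>n. norm (g (- int n)))" by simp
  qed
  have bound: "norm (F r k) \<le> norm (q powi tri r * (- z) powi r * g k)" for r k
  proof -
    have "norm (cone_sign r k * (q powi (r - 1) * (x * z)) powi k) \<le> norm (g k)"
    proof -
      consider "r \<ge> 1" "k \<ge> 0" | "r \<le> 0" "k < 0" | "cone_sign r k = 0"
        unfolding cone_sign_def by force
      then show ?thesis
      proof cases
        case 1
        have "norm (q powi (r - 1)) powi k \<le> 1"
          using 1 q by (simp add: norm_power_int power_int_le_one)
        then have "norm (q powi (r - 1)) powi k * norm (x * z) powi k \<le> 1 * norm (x * z) powi k"
          by (intro mult_right_mono) auto
        with 1 show ?thesis
          by (simp add: cone_sign_def g_def norm_mult norm_power_int power_int_mult_distrib)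
      next
        case 2
        have "norm (q powi (r - 1)) powi k = norm q powi ((1 - r) * (- k))"
          by (simp add: norm_power_int algebra_simps flip: power_int_mult)
        also have "\<dots> \<le> norm q powi (- k)"
        proof (rule power_int_decreasing)
          have "1 * (- k) \<le> (1 - r) * (- k)" using 2 by (intro mult_right_mono) auto
          then show "- k \<le> (1 - r) * (- k)" by simp
        qed (use q in auto)
        finally have "norm (q powi (r - 1)) powi k * norm (x * z) powi k \<le> norm q powi (- k) * norm (x * z) powi k"
          by (intro mult_right_mono) auto
        also have "\<dots> = norm (g k)"
          using 2 nz by (simp add: g_def norm_power_int norm_divide norm_mult power_int_divide_distrib power_int_minus divide_simps)
        finally show ?thesis using 2
          by (simp add: cone_sign_def norm_mult norm_power_int power_int_mult_distrib)
      qed simp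
    qed
    then have "norm (q powi tri r * (- z) powi r) * norm (cone_sign r k * (q powi (r - 1) * (x * z)) powi k)
        \<le> norm (q powi tri r * (- z) powi r) * norm (g k)"
      by (intro mult_left_mono) auto
    then show ?thesis unfolding F_def by (simp only: norm_mult)
  qed
  have F_sum: "(\<lambda>(r, k). norm (F r k)) summable_on UNIV \<times> UNIV"
  proof -
    have "(\<lambda>(r, k). norm (q powi tri r * (- z) powi r * g k)) summable_on UNIV \<times> UNIV"
      by (rule abs_summable_times[OF theta_terms_abs_summable g]) (use q nz in auto)
    then have "(\<lambda>p. norm (F (fst p) (snd p))) summable_on UNIV \<times> UNIV"
      by (intro Infinite_Sum.abs_summable_on_comparison_test') (use bound in auto)
    then show ?thesis by (simp add: case_prod_unfold)
  qed
  have "appell_sum x z q = (\<Sum>\<^sub>\<infinity>r. \<Sum>\<^sub>\<infinity>k. F r k)"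
    unfolding appell_sum_def
  proof (rule infsum_cong)
    fix r
    show "q powi tri r * (- z) powi r / (1 - q powi (r - 1) * x * z) = (\<Sum>\<^sub>\<infinity>k. F r k)"
      unfolding F_def infsum_cmult_right' geometric_row[OF annulus_not_lattice[OF q ann]]
      by (simp add: mult.assoc)
  qed
  also have "\<dots> = (\<Sum>\<^sub>\<infinity>N. \<Sum>\<^sub>\<infinity>k. F (N - k) k)"
    using infsum_rows_eq[OF F_sum] infsum_diagonal_eq[OF F_sum] by simp
  finally have eq: "appell_sum x z q = (\<Sum>\<^sub>\<infinity>N. \<Sum>\<^sub>\<infinity>k. F (N - k) k)" .
  have "(\<Sum>\<^sub>\<infinity>k. F (N - k) k) = q powi tri N * (- z) powi N * tri_sum x q N" for N
  proof -
    have F: "F (N - k) k = q powi tri N * (- z) powi N * (cone_sign (N - k) k * ((- x) powi k * q powi (- tri (k + 1))))" for k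
    proof -
      have e1: "q powi tri (N - k) * q powi ((N - k - 1) * k) = q powi tri N * q powi (- tri (k + 1))"
      proof -
        have "tri (N - k) + (N - k - 1) * k = tri N + - tri (k + 1)"
          using two_tri[of k] unfolding tri_diff tri_succ by (simp add: algebra_simps)
        then have "q powi (tri (N - k) + (N - k - 1) * k) = q powi (tri N + - tri (k + 1))"
          by (simp only:)
        then show ?thesis using q(2) power_int_add[of q] by metis
      qed
      have e2: "(q powi (N - k - 1) * (x * z)) powi k = q powi ((N - k - 1) * k) * (x * z) powi k"
        by (simp add: power_int_mult_distrib power_int_mult)
      have e3: "(- z) powi (N - k) * (x * z) powi k = (- z) powi N * (- x) powi k"
      proof -
        have "(x * z) powi k = (- x) powi k * (- z) powi k"
          by (simp flip: power_int_mult_distrib)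
        then show ?thesis using nz by (simp add: power_int_diff)
      qed
      have "F (N - k) k = (q powi tri (N - k) * q powi ((N - k - 1) * k)) * ((- z) powi (N - k) * (x * z) powi k)
          * cone_sign (N - k) k"
        unfolding F_def e2 by (simp only: mult_ac)
      then show ?thesis unfolding e1 e3 by (simp only: mult_ac)
    qed
    have "(\<Sum>\<^sub>\<infinity>k. cone_sign (N - k) k * ((- x) powi k * q powi (- tri (k + 1)))) = tri_sum x q N"
    proof (cases "N \<ge> 0")
      case True
      have "(\<Sum>\<^sub>\<infinity>k. cone_sign (N - k) k * ((- x) powi k * q powi (- tri (k + 1))))
          = (\<Sum>\<^sub>\<infinity>k\<in>{0..<N}. (- x) powi k * q powi (- tri (k + 1)))"
        by (rule infsum_cong_neutral) (use True in \<open>auto simp: cone_sign_def\<close>)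
      with True show ?thesis by (simp add: tri_sum_def)
    next
      case False
      have "(\<Sum>\<^sub>\<infinity>k. cone_sign (N - k) k * ((- x) powi k * q powi (- tri (k + 1))))
          = (\<Sum>\<^sub>\<infinity>k\<in>{N..<0}. - ((- x) powi k * q powi (- tri (k + 1))))"
        by (rule infsum_cong_neutral) (use False in \<open>auto simp: cone_sign_def\<close>)
      with False show ?thesis by (simp add: tri_sum_def sum_negf)
    qed
    then show ?thesis unfolding F infsum_cmult_right' by (simp only:)
  qed
  with eq diagonal_sums_summable[OF F_sum] show ?thesis
    by (simp add: has_sum_infsum)
qed

section \<open>Multisection of Appell sums\<close>

text \<open>Up to the factor (-1)^N q^tri(N), the coefficient of z^N in a sum of products of theta
  functions and Kronecker series; see \<open>multisection_product\<close>.\<close>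

definition section_kernel :: "complex \<Rightarrow> complex \<Rightarrow> nat \<Rightarrow> complex \<Rightarrow> int \<Rightarrow> complex" where
  "section_kernel q b n x N = (\<Sum>\<^sub>\<infinity>s. (- x) powi s * q powi (- tri s)
     * (b * (q ^ n) powi s) powi (- ((N - s) div int n)) / (1 - b * (q ^ n) powi s))"

text \<open>The term with index t of the theta series for the residue r has total index R = nt + r,
  so the sum over r of the products is one double sum over R and s. In it t = R div n
  survives only in the exponent of X(s) = b q^(ns). The antidiagonals N = R + s give the right-hand
  side. Summability is inherited from the products, and it is exported because the kernels have no
  convenient majorant of their own.\<close>

lemma multisection_product:
  assumes q: "norm q < 1" "q \<noteq> 0" and nz: "x \<noteq> 0" "z \<noteq> 0" "b \<noteq> 0" and n: "n > 0"
    and ann: "norm q < norm (x * z)" "norm (x * z) < 1"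
    and b: "\<And>s::int. b * (q ^ n) powi s \<noteq> 1"
  shows "(\<Sum>r<n. q powi tri (int r) * (- z) ^ r
           * theta_j (- ((- z) ^ n * q ^ (n * r) * q powi tri (int n) / b)) (q ^ (n\<^sup>2))
           * (\<Sum>\<^sub>\<infinity>s. (q ^ r * (x * z)) powi s / (1 - b * (q ^ n) powi s)))
       = (\<Sum>\<^sub>\<infinity>N. q powi tri N * (- z) powi N * section_kernel q b n x N)" (is "?L = _")
    and "(\<lambda>s. (- x) powi s * q powi (- tri s)
           * (b * (q ^ n) powi s) powi (- ((N - s) div int n)) / (1 - b * (q ^ n) powi s)) summable_on UNIV"
    and "(\<lambda>N. q powi tri N * (- z) powi N * section_kernel q b n x N) summable_on UNIV"
proof -
  define m where "m = int n"
  have m: "m > 0" using n by (simp add: m_def)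
  define X where "X = (\<lambda>s. b * (q ^ n) powi s)"
  have X: "X s \<noteq> 0" "X s \<noteq> 1" for s using b q nz by (auto simp: X_def)
  have X_eq: "X s = b * q powi (m * s)" for s
    by (simp add: X_def m_def power_int_mult)
  define H where "H = (\<lambda>R s. q powi (tri R + R * s) * (- z) powi R * (x * z) powi s * X s powi (- (R div m)) / (1 - X s))"
  define A where "A = (\<lambda>r t. (q ^ (n\<^sup>2)) powi tri t * ((- z) ^ n * q ^ (n * r) * q powi tri (int n) / b) powi t)"
  define B where "B = (\<lambda>r s. (q ^ r * (x * z)) powi s / (1 - X s))"
  have qn2: "norm (q ^ n\<^sup>2) < 1" "q ^ n\<^sup>2 \<noteq> 0" and qn: "norm (q ^ n) < 1" "q ^ n \<noteq> 0"
    using q n by (simp_all add: norm_power power_less_one_iff)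
  have row: "H (m * t + int r) s = (q powi tri (int r) * (- z) ^ r) * (A r t * B r s)" if "r < n" for r t s
  proof -
    have d: "(m * t + int r) div m = t"
      using that m by (simp add: m_def)
    have "A r t = q powi (m\<^sup>2 * tri t) * ((- z) powi (m * t) * q powi ((m * int r + tri m) * t) / b powi t)"
    proof -
      have "q ^ (n * r) * q powi tri (int n) = q powi (m * int r + tri m)"
        using q by (simp add: m_def power_int_add flip: power_int_of_nat)
      then have "(- z) ^ n * q ^ (n * r) * q powi tri (int n) / b = (- z) powi m * q powi (m * int r + tri m) / b"
        by (simp add: m_def mult.assoc)
      moreover have "(q ^ (n\<^sup>2)) powi tri t = q powi (m\<^sup>2 * tri t)"
        unfolding power_int_power m_def by simp
      ultimately have "A r t = q powi (m\<^sup>2 * tri t) * ((- z) powi m * q powi (m * int r + tri m) / b) powi t"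
        unfolding A_def by (simp only:)
      then show ?thesis
        by (simp only: power_int_mult_distrib power_int_divide_distrib power_int_mult)
    qed
    moreover have "B r s = q powi (int r * s) * (x * z) powi s / (1 - X s)"
      by (simp add: B_def power_int_mult_distrib power_int_mult)
    moreover have "X s powi (- t) = q powi (- (m * s * t)) / b powi t"
      unfolding X_eq by (simp add: power_int_mult_distrib power_int_minus divide_simps flip: power_int_mult)
    moreover have "(- z) powi (m * t + int r) = (- z) powi (m * t) * (- z) ^ r"
      using nz by (simp add: power_int_add)
    moreover have "q powi (tri (m * t + int r) + (m * t + int r) * s) * q powi (- (m * s * t))
        = q powi tri (int r) * (q powi (m\<^sup>2 * tri t) * q powi ((m * int r + tri m) * t)) * q powi (int r * s)"
    proof -
      have "tri (m * t + int r) + (m * t + int r) * s + - (m * s * t)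
          = tri (int r) + (m\<^sup>2 * tri t + (m * int r + tri m) * t) + int r * s"
        unfolding tri_add tri_mult by (simp add: algebra_simps)
      then have "q powi (tri (m * t + int r) + (m * t + int r) * s + - (m * s * t))
          = q powi (tri (int r) + (m\<^sup>2 * tri t + (m * int r + tri m) * t) + int r * s)"
        by (simp only:)
      then show ?thesis using q(2) by (simp only: power_int_add simp_thms)
    qed
    moreover have "a * (y * w) * v * (c / e) / f = g * w * (h * (y * k / e) * (l * v / f))"
      if "a * c = g * (h * k) * l" for a y w v c e f g h k l :: complex
    proof -
      have "a * (y * w) * v * (c / e) / f = (a * c) * (y * w * v / e / f)"
        by (simp add: mult_ac)
      also have "\<dots> = g * w * (h * (y * k / e) * (l * v / f))"
        unfolding that by (simp add: mult_ac)
      finally show ?thesis .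
    qed
    ultimately show ?thesis unfolding H_def d by simp
  qed
  have A_abs: "(\<lambda>t. norm (A r t)) summable_on UNIV" for r
    unfolding A_def by (rule theta_terms_abs_summable[OF qn2]) (use q nz in auto)
  have A_sum: "(\<Sum>\<^sub>\<infinity>t. A r t) = theta_j (- ((- z) ^ n * q ^ (n * r) * q powi tri (int n) / b)) (q ^ (n\<^sup>2))" for r
    unfolding A_def by (subst theta_j_series[OF qn2]) (use q nz in auto)
  have B_abs: "(\<lambda>s. norm (B r s)) summable_on UNIV" if "r < n" for r
    unfolding B_def X_def
  proof (rule kronecker_terms_summable[OF qn nz(3) b])
    have "norm q ^ r * norm (x * z) \<le> 1 * norm (x * z)"
      using q by (intro mult_right_mono) (auto simp: power_le_one)
    then show "norm (q ^ r * (x * z)) < 1" using ann by (simp add: norm_mult norm_power)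
    have "norm q ^ n \<le> norm q ^ Suc r" using that q by (intro power_decreasing) auto
    also have "\<dots> = norm q ^ r * norm q" by simp
    also have "\<dots> < norm q ^ r * norm (x * z)" using ann q by (intro mult_strict_left_mono) auto
    finally show "norm (q ^ n) < norm (q ^ r * (x * z))" by (simp add: norm_mult norm_power)
  qed
  \<comment> \<open>The plane of all (R, s) is the disjoint union of the classes of R modulo n.\<close>
  define cls where "cls = (\<lambda>r. {R. R mod m = int r} \<times> (UNIV :: int set))"
  have cls_bij: "bij_betw (\<lambda>(t, s). (m * t + int r, s)) (UNIV \<times> UNIV) (cls r)" if "r < n" for r
  proof -
    have "int r mod m = int r" "int r div m = 0" using that by (simp_all add: m_def)
    moreover have "m * (R div m) + int r = R" if "R mod m = int r" for R
      using mult_div_mod_eq[of m R] that by simp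
    ultimately show ?thesis
      using m by (intro bij_betwI[of _ _ _ "\<lambda>(R, s). (R div m, s)"]) (auto simp: cls_def)
  qed
  have prod_abs: "(\<lambda>(t, s). norm (A r t * B r s)) summable_on UNIV \<times> UNIV" if "r < n" for r
    by (rule abs_summable_times[OF A_abs B_abs[OF that]])
  have cls_abs: "(\<lambda>(R, s). norm (H R s)) summable_on cls r" if "r < n" for r
  proof -
    have "(\<lambda>p. norm (q powi tri (int r) * (- z) ^ r) * (case p of (t, s) \<Rightarrow> norm (A r t * B r s))) summable_on UNIV \<times> UNIV"
      by (rule summable_on_cmult_right[OF prod_abs[OF that]])
    then show ?thesis
      using summable_on_reindex_bij_betw[OF cls_bij[OF that], of "\<lambda>(R, s). norm (H R s)"]
      by (simp add: case_prod_unfold row[OF that] norm_mult mult.assoc)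
  qed
  have cls_sum: "(\<Sum>\<^sub>\<infinity>(R, s)\<in>cls r. H R s) = q powi tri (int r) * (- z) ^ r * ((\<Sum>\<^sub>\<infinity>t. A r t) * (\<Sum>\<^sub>\<infinity>s. B r s))"
    if "r < n" for r
  proof -
    have "(\<Sum>\<^sub>\<infinity>(R, s)\<in>cls r. H R s) = (\<Sum>\<^sub>\<infinity>(t, s)\<in>UNIV \<times> UNIV. H (m * t + int r) s)"
      using infsum_reindex_bij_betw[OF cls_bij[OF that], of "\<lambda>(R, s). H R s"]
      by (simp add: case_prod_unfold)
    also have "\<dots> = (\<Sum>\<^sub>\<infinity>p\<in>UNIV \<times> UNIV. (q powi tri (int r) * (- z) ^ r) * (case p of (t, s) \<Rightarrow> A r t * B r s))"
      by (simp add: row[OF that] case_prod_unfold)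
    also have "\<dots> = q powi tri (int r) * (- z) ^ r * ((\<Sum>\<^sub>\<infinity>t. A r t) * (\<Sum>\<^sub>\<infinity>s. B r s))"
      unfolding infsum_cmult_right' infsum_times[OF A_abs B_abs[OF that]] ..
    finally show ?thesis .
  qed
  have cover: "(\<Union>r<n. cls r) = UNIV \<times> UNIV"
  proof -
    have "\<exists>r<n. R mod m = int r" for R
      using m by (intro exI[of _ "nat (R mod m)"]) (simp add: m_def nat_less_iff)
    then show ?thesis by (fastforce simp: cls_def)
  qed
  have disj: "cls r \<inter> cls r' = {}" if "r \<noteq> r'" for r r'
    using that by (auto simp: cls_def)
  have H_abs: "(\<lambda>(R, s). norm (H R s)) summable_on UNIV \<times> UNIV"
    unfolding cover[symmetric]
    by (rule summable_on_finite_union_disjoint) (use cls_abs disj in auto)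
  have "?L = (\<Sum>r<n. \<Sum>\<^sub>\<infinity>(R, s)\<in>cls r. H R s)"
    by (intro sum.cong refl) (simp add: cls_sum A_sum B_def X_def mult.assoc)
  also have "\<dots> = (\<Sum>\<^sub>\<infinity>(R, s)\<in>(\<Union>r<n. cls r). H R s)"
  proof (rule sum_infsum)
    fix r assume "r \<in> {..<n}"
    then have "(\<lambda>p. norm (case p of (R, s) \<Rightarrow> H R s)) summable_on cls r"
      using cls_abs[of r] by (simp add: case_prod_unfold)
    then show "(\<lambda>(R, s). H R s) summable_on cls r"
      by (rule abs_summable_summable)
  qed (use disj in auto)
  also have "\<dots> = (\<Sum>\<^sub>\<infinity>N. \<Sum>\<^sub>\<infinity>s. H (N - s) s)"
    unfolding cover by (rule infsum_diagonal_eq[OF H_abs])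
  finally have L: "?L = (\<Sum>\<^sub>\<infinity>N. \<Sum>\<^sub>\<infinity>s. H (N - s) s)" .
  define d where "d = (\<lambda>N s. (- x) powi s * q powi (- tri s) * X s powi (- ((N - s) div m)) / (1 - X s))"
  have H_diag: "H (N - s) s = q powi tri N * (- z) powi N * d N s" for N s
  proof -
    have e1: "q powi (tri (N - s) + (N - s) * s) = q powi tri N * q powi (- tri s)"
    proof -
      have "tri (N - s) + (N - s) * s = tri N + - tri s"
        using two_tri[of s] unfolding tri_diff by (simp add: algebra_simps)
      then show ?thesis using q(2) by (simp only: power_int_add simp_thms)
    qed
    have e2: "(- z) powi (N - s) * (x * z) powi s = (- z) powi N * (- x) powi s"
    proof -
      have "(x * z) powi s = (- x) powi s * (- z) powi s"
        by (simp flip: power_int_mult_distrib)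
      then show ?thesis using nz by (simp add: power_int_diff)
    qed
    have "H (N - s) s = (q powi (tri (N - s) + (N - s) * s) * ((- z) powi (N - s) * (x * z) powi s))
        * (X s powi (- ((N - s) div m)) / (1 - X s))"
      unfolding H_def by simp
    then show ?thesis unfolding e1 e2 d_def by (simp only: mult_ac times_divide_eq_right)
  qed
  show "(\<lambda>s. (- x) powi s * q powi (- tri s)
           * (b * (q ^ n) powi s) powi (- ((N - s) div int n)) / (1 - b * (q ^ n) powi s)) summable_on UNIV"
  proof -
    have "(\<lambda>s. H (N - s) s) summable_on UNIV" by (rule diagonal_summable[OF H_abs])
    then have "(\<lambda>s. q powi tri N * (- z) powi N * d N s) summable_on UNIV" by (simp only: H_diag)
    then have "(\<lambda>s. d N s) summable_on UNIV"
      by (subst (asm) summable_on_cmult_right') (use q nz in auto)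
    then show ?thesis by (simp add: d_def X_def m_def)
  qed
  have eq: "(\<Sum>\<^sub>\<infinity>s. H (N - s) s) = q powi tri N * (- z) powi N * section_kernel q b n x N" for N
    unfolding H_diag infsum_cmult_right' by (simp add: d_def X_def m_def section_kernel_def)
  show "?L = (\<Sum>\<^sub>\<infinity>N. q powi tri N * (- z) powi N * section_kernel q b n x N)"
    unfolding L eq ..
  show "(\<lambda>N. q powi tri N * (- z) powi N * section_kernel q b n x N) summable_on UNIV"
    using diagonal_sums_summable[OF H_abs] by (simp add: eq)
qed

text \<open>The exponents \<open>(N - s) div n\<close> and \<open>(N - 1 - s) div n\<close> agree unless n divides
  N - s. In that case, with X = X(s) and N - s = nt, the difference of the two terms is
  (X^(-t) - X^(1-t)) / (1 - X) = X^(-t), the denominator cancels, and a theta series in t remains.\<close>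

lemma section_kernel_step:
  assumes q: "norm q < 1" "q \<noteq> 0" and nz: "x \<noteq> 0" "b \<noteq> 0" and n: "n > 0"
    and b: "\<And>s::int. b * (q ^ n) powi s \<noteq> 1"
    and sum: "\<And>N. (\<lambda>s. (- x) powi s * q powi (- tri s)
           * (b * (q ^ n) powi s) powi (- ((N - s) div int n)) / (1 - b * (q ^ n) powi s)) summable_on UNIV"
  shows "section_kernel q b n x N - section_kernel q b n x (N - 1)
    = theta_j (- (q powi tri (int n) / ((- x) ^ n * b))) (q ^ (n\<^sup>2)) * ((- x) powi N * q powi (- tri N))"
proof -
  define m where "m = int n"
  have m: "m > 0" using n by (simp add: m_def)
  define X where "X = (\<lambda>s. b * (q ^ n) powi s)"
  have X: "X s \<noteq> 0" "X s \<noteq> 1" for s using b q nz by (auto simp: X_def)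
  have X_eq: "X s = b * q powi (m * s)" for s
    by (simp add: X_def m_def power_int_mult)
  have qn2: "norm (q ^ n\<^sup>2) < 1" "q ^ n\<^sup>2 \<noteq> 0"
    using q n by (simp_all add: norm_power power_less_one_iff)
  define c where "c = (\<lambda>s. (- x) powi s * q powi (- tri s))"
  define d where "d = (\<lambda>N s. c s * X s powi (- ((N - s) div m)) / (1 - X s))"
  have d_sum: "d N summable_on UNIV" for N
    using sum[of N] by (simp add: d_def c_def X_def m_def)
  have sk: "section_kernel q b n x N = (\<Sum>\<^sub>\<infinity>s. d N s)" for N
    by (simp add: section_kernel_def d_def c_def X_def m_def)
  have "section_kernel q b n x N - section_kernel q b n x (N - 1) = (\<Sum>\<^sub>\<infinity>s. d N s + - d (N - 1) s)"
    unfolding sk using infsum_add[OF d_sum summable_on_uminus[THEN iffD2, OF d_sum]]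
    by (simp add: infsum_uminus)
  also have "\<dots> = (\<Sum>\<^sub>\<infinity>s\<in>range (\<lambda>t. N - m * t). d N s + - d (N - 1) s)"
  proof (rule infsum_cong_neutral)
    fix s assume s: "s \<in> UNIV - range (\<lambda>t. N - m * t)"
    have "(N - s) mod m \<noteq> 0"
    proof
      assume "(N - s) mod m = 0"
      then have "s = N - m * ((N - s) div m)"
        by (metis diff_diff_eq2 add_diff_cancel_left' add.commute minus_mod_eq_mult_div diff_zero)
      with s show False by blast
    qed
    then have "(N - 1 - s) div m = (N - s) div m"
    proof -
      assume nz: "(N - s) mod m \<noteq> 0"
      define u where "u = (N - s) div m"
      define v where "v = (N - s) mod m"
      have "v \<noteq> 0" "v \<ge> 0" "v < m" using nz m by (simp_all add: v_def)
      then have v: "v \<ge> 1" "v < m" by simp_all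
      have "N - 1 - s = (v - 1) + m * u"
        using mult_div_mod_eq[of m "N - s"] by (simp add: u_def v_def)
      also have "\<dots> div m = u"
        using v m by (simp add: div_pos_pos_trivial)
      finally have "(N - 1 - s) div m = u" .
      then show ?thesis by (simp add: u_def)
    qed
    then show "d N s + - d (N - 1) s = 0" by (simp add: d_def)
  qed auto
  also have "\<dots> = (\<Sum>\<^sub>\<infinity>t. d N (N - m * t) + - d (N - 1) (N - m * t))"
    using infsum_reindex[of "\<lambda>t. N - m * t" UNIV "\<lambda>s. d N s + - d (N - 1) s"] m
    by (simp add: inj_def o_def)
  also have "\<dots> = (\<Sum>\<^sub>\<infinity>t. (q ^ (n\<^sup>2)) powi tri t * (q powi tri m / ((- x) ^ n * b)) powi t * ((- x) powi N * q powi (- tri N)))"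
  proof (rule infsum_cong)
    fix t
    define s where "s = N - m * t"
    have d1: "(N - s) div m = t" "(N - 1 - s) div m = t - 1"
    proof -
      show "(N - s) div m = t" using m by (simp add: s_def)
      have "N - 1 - s = (m - 1) + m * (t - 1)" by (simp add: s_def algebra_simps)
      also have "\<dots> div m = t - 1" using m by (simp add: div_pos_pos_trivial)
      finally show "(N - 1 - s) div m = t - 1" .
    qed
    have "X s powi (- (t - 1)) = X s powi (- t) * X s"
      using X(1)[of s] power_int_add[of "X s" "- t" 1] by simp
    then have "d N s + - d (N - 1) s = c s * X s powi (- t)"
      unfolding d_def d1 using X[of s] by (simp add: divide_simps) (simp add: algebra_simps)
    moreover have "X s powi (- t) = q powi (- (m * s * t)) / b powi t"
      unfolding X_eq by (simp add: power_int_mult_distrib power_int_minus divide_simps flip: power_int_mult)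
    moreover have "(- x) powi s = (- x) powi N / ((- x) ^ n) powi t"
      using nz by (simp add: s_def m_def power_int_diff power_int_mult)
    moreover have "q powi (- tri s) * q powi (- (m * s * t)) = q powi (m\<^sup>2 * tri t) * q powi (tri m * t) * q powi (- tri N)"
    proof -
      have "2 * (- tri s + - (m * s * t)) = 2 * (m\<^sup>2 * tri t + tri m * t + - tri N)"
      proof -
        have "2 * (m\<^sup>2 * tri t + tri m * t + - tri N) = m\<^sup>2 * (2 * tri t) + 2 * tri m * t - 2 * tri N"
          by (simp add: algebra_simps)
        moreover have "2 * (- tri s + - (m * s * t)) = - (2 * tri s) - 2 * m * s * t" by simp
        ultimately show ?thesis
          unfolding two_tri s_def by (simp add: algebra_simps power2_eq_square)
      qed
      then have "- tri s + - (m * s * t) = m\<^sup>2 * tri t + tri m * t + - tri N" by simp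
      then have "q powi (- tri s + - (m * s * t)) = q powi (m\<^sup>2 * tri t + tri m * t + - tri N)"
        by (simp only:)
      then show ?thesis using q(2) by (simp only: power_int_add simp_thms)
    qed
    moreover have "(q ^ (n\<^sup>2)) powi tri t = q powi (m\<^sup>2 * tri t)"
      by (simp add: m_def power_int_power)
    moreover have "(q powi tri m / ((- x) ^ n * b)) powi t = q powi (tri m * t) / (((- x) ^ n) powi t * b powi t)"
      by (simp add: power_int_mult_distrib power_int_divide_distrib power_int_mult)
    moreover have "u / v * a * (c / e) = f * (g / (v * e)) * (u * h)" if "a * c = f * g * h"
      for u v a c e f g h :: complex
    proof -
      have "u / v * a * (c / e) = (a * c) * (u / v / e)" by (simp add: mult_ac)
      then show ?thesis unfolding that by (simp add: mult_ac)
    qed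
    ultimately show "d N (N - m * t) + - d (N - 1) (N - m * t)
        = (q ^ (n\<^sup>2)) powi tri t * (q powi tri m / ((- x) ^ n * b)) powi t * ((- x) powi N * q powi (- tri N))"
      unfolding s_def[symmetric] c_def by simp
  qed
  also have "\<dots> = theta_j (- (q powi tri (int n) / ((- x) ^ n * b))) (q ^ (n\<^sup>2)) * ((- x) powi N * q powi (- tri N))"
    unfolding infsum_cmult_left' m_def by (subst theta_j_series[OF qn2]) (use q nz in auto)
  finally show ?thesis .
qed

text \<open>By \<open>section_kernel_step\<close> the kernel and the partial sums \<open>tri_sum\<close> have
  proportional differences, hence the Laurent series in \<open>multisection_product\<close> and in
  \<open>appell_sum_laurent\<close> are proportional up to a constant multiple of the series for
  j(z; q).\<close>

lemma appell_multisection: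
  assumes q: "norm q < 1" "q \<noteq> 0" and nz: "x \<noteq> 0" "z \<noteq> 0" "b \<noteq> 0" and n: "n > 0"
    and ann: "norm q < norm (x * z)" "norm (x * z) < 1"
    and b: "\<And>s::int. b * (q ^ n) powi s \<noteq> 1"
  shows "x * theta_j (- (q powi tri (int n) / ((- x) ^ n * b))) (q ^ (n\<^sup>2)) * appell_sum x z q
    = theta_j z q * section_kernel q b n x 0
      - (\<Sum>r<n. q powi tri (int r) * (- z) ^ r
           * theta_j (- ((- z) ^ n * q ^ (n * r) * q powi tri (int n) / b)) (q ^ (n\<^sup>2))
           * (\<Sum>\<^sub>\<infinity>s. (q ^ r * (x * z)) powi s / (1 - b * (q ^ n) powi s)))"
proof -
  define th where "th = theta_j (- (q powi tri (int n) / ((- x) ^ n * b))) (q ^ (n\<^sup>2))"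
  define D where "D = section_kernel q b n x"
  note prod = multisection_product[OF q nz n ann b]
  note step = section_kernel_step[OF q nz(1,3) n b prod(2), folded D_def th_def]
  \<comment> \<open>Both sequences have proportional increments, so this combination is constant in N.\<close>
  have "D (N + 1) + x * th * tri_sum x q (N + 1) = D N + x * th * tri_sum x q N" for N
  proof -
    have "(- x) powi (N + 1) = (- x) powi N * (- x)" using nz by (simp add: power_int_add)
    then show ?thesis
      using step[of "N + 1"] unfolding tri_succ tri_sum_succ by (simp add: algebra_simps)
  qed
  from int_shift_invariant[of "\<lambda>N. D N + x * th * tri_sum x q N", OF this]
  have D: "D N = D 0 + - (x * th) * tri_sum x q N" for N by (simp add: eq_diff_eq)
  note lau = appell_sum_laurent[OF q nz(1,2) ann]
  have "(\<Sum>\<^sub>\<infinity>N. q powi tri N * (- z) powi N * D N)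
      = (\<Sum>\<^sub>\<infinity>N. q powi tri N * (- z) powi N * D 0 + - (x * th) * (q powi tri N * (- z) powi N * tri_sum x q N))"
  proof (rule infsum_cong)
    fix N
    show "q powi tri N * (- z) powi N * D N = q powi tri N * (- z) powi N * D 0 + - (x * th) * (q powi tri N * (- z) powi N * tri_sum x q N)"
      by (subst D) (simp add: algebra_simps)
  qed
  also have "\<dots> = (\<Sum>\<^sub>\<infinity>N. q powi tri N * (- z) powi N * D 0) + (\<Sum>\<^sub>\<infinity>N. - (x * th) * (q powi tri N * (- z) powi N * tri_sum x q N))"
    by (intro infsum_add summable_on_cmult_left summable_on_cmult_right theta_terms_summable has_sum_imp_summable[OF lau])
       (use q nz in auto)
  also have "\<dots> = theta_j z q * D 0 + - (x * th) * appell_sum x z q"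
    unfolding infsum_cmult_left' infsum_cmult_right' infsumI[OF lau] theta_j_series[OF q nz(2)] ..
  finally show ?thesis
    using prod(1) unfolding D_def[symmetric] th_def[symmetric] by simp
qed

lemma annulus_ne_1:
  fixes q a :: complex
  assumes "norm q < 1" "q \<noteq> 0" "norm q < norm a" "norm a < 1"
  shows "a * q powi i \<noteq> 1"
  using annulus_not_lattice[OF assms, of "i + 1"] by (auto simp: mult.commute split: if_splits)

text \<open>For n = 1 the kernel at 0 is an Appell sum at w, after the substitution s = 1 - r and
  1 / (1 - 1/Y) = - Y / (1 - Y).\<close>

lemma section_kernel_one:
  assumes q: "q \<noteq> 0" and nz: "x \<noteq> 0" "w \<noteq> 0" and xw: "\<And>s::int. x * w * q powi s \<noteq> 1"
  shows "section_kernel q (1 / (x * w)) 1 x 0 = x * appell_sum x w q"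
proof -
  have "section_kernel q (1 / (x * w)) 1 x 0
      = (\<Sum>\<^sub>\<infinity>r. x * (q powi tri r * (- w) powi r / (1 - q powi (r - 1) * x * w)))"
    unfolding section_kernel_def
  proof (rule infsum_reindex_bij_witness[of _ "\<lambda>r. 1 - r" "\<lambda>s. 1 - s"])
    fix s :: int
    define r where "r = 1 - s"
    have s: "s = 1 - r" by (simp add: r_def)
    define Y where "Y = q powi (r - 1) * (x * w)"
    have Y: "Y \<noteq> 0" "Y \<noteq> 1"
      using q nz xw[of "r - 1"] by (auto simp: Y_def mult_ac)
    have b: "1 / (x * w) * (q ^ 1) powi s = 1 / Y"
      using q nz by (simp add: Y_def s power_int_diff divide_simps)
    have tri_s: "tri s = tri r"
      unfolding s tri_diff by simp
    have "- ((0 - s) div int 1) = - (r - 1)" by (simp add: s)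
    then have "(1 / Y) powi (- ((0 - s) div int 1)) = inverse ((1 / Y) powi (r - 1))"
      by (simp only: power_int_minus)
    also have "\<dots> = Y powi (r - 1)" by (simp add: power_int_divide_distrib)
    also have "\<dots> = q powi ((r - 1) * (r - 1)) * (x * w) powi (r - 1)"
      unfolding Y_def by (simp add: power_int_mult_distrib power_int_mult)
    finally have Yp: "(1 / Y) powi (- ((0 - s) div int 1)) = q powi ((r - 1) * (r - 1)) * (x * w) powi (r - 1)" .
    have qp: "q powi (- tri s) * q powi ((r - 1) * (r - 1)) = q powi tri r / q powi (r - 1)"
    proof -
      have "- tri s + (r - 1) * (r - 1) = tri r - (r - 1)"
        using two_tri[of r] unfolding tri_s by (simp add: algebra_simps)
      then have "q powi (- tri s + (r - 1) * (r - 1)) = q powi (tri r - (r - 1))" by (simp only:)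
      then show ?thesis using q by (simp only: power_int_add power_int_diff simp_thms)
    qed
    have xp: "(- x) powi s * (x * w) powi (r - 1) = - ((- w) powi r) / w"
    proof -
      have "(x * w) powi (r - 1) = (- x) powi (r - 1) * (- w) powi (r - 1)"
        by (simp flip: power_int_mult_distrib)
      then have "(- x) powi s * (x * w) powi (r - 1) = ((- x) powi s * (- x) powi (r - 1)) * (- w) powi (r - 1)"
        by (simp only: mult.assoc)
      also have "(- x) powi s * (- x) powi (r - 1) = 1"
        using nz by (simp add: s flip: power_int_add)
      also have "1 * (- w) powi (r - 1) = - ((- w) powi r) / w"
        using nz by (simp add: power_int_diff)
      finally show ?thesis .
    qed
    have "(- x) powi s * q powi (- tri s) * (1 / (x * w) * (q ^ 1) powi s) powi (- ((0 - s) div int 1))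
        / (1 - 1 / (x * w) * (q ^ 1) powi s)
      = ((- x) powi s * (x * w) powi (r - 1)) * (q powi (- tri s) * q powi ((r - 1) * (r - 1))) / (1 - 1 / Y)"
      unfolding b Yp by simp
    also have "\<dots> = - ((- w) powi r) / w * (q powi tri r / q powi (r - 1)) * (- Y / (1 - Y))"
    proof -
      have "Y - 1 \<noteq> 0" "1 - Y \<noteq> 0" "1 - 1 / Y \<noteq> 0" using Y by auto
      then have "1 / (1 - 1 / Y) = - Y / (1 - Y)"
        using Y by (simp add: field_simps)
      then show ?thesis unfolding xp qp by (metis (no_types, lifting) mult.right_neutral times_divide_eq_right)
    qed
    also have "\<dots> = x * (q powi tri r * (- w) powi r / (1 - Y))"
      using q nz by (simp add: Y_def)
    finally show "x * (q powi tri (1 - s) * (- w) powi (1 - s) / (1 - q powi (1 - s - 1) * x * w))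
      = (- x) powi s * q powi (- tri s) * (1 / (x * w) * (q ^ 1) powi s) powi (- ((0 - s) div int 1))
        / (1 - 1 / (x * w) * (q ^ 1) powi s)"
      unfolding r_def[symmetric] Y_def by (simp only: mult.assoc)
  qed auto
  then show ?thesis
    unfolding infsum_cmult_right' appell_sum_def by simp
qed

text \<open>The case n = 1 of \<open>appell_multisection\<close>. The value b = 1 / (xw) makes the theta
  constant equal to j(w; q).\<close>

lemma appell_m_change_z:
  assumes q: "norm q < 1" "q \<noteq> 0" and nz: "x \<noteq> 0" "z \<noteq> 0" "w \<noteq> 0"
    and ann: "norm q < norm (x * z)" "norm (x * z) < 1"
    and z: "\<And>s::int. z * q powi s \<noteq> 1" and w: "\<And>s::int. w * q powi s \<noteq> 1"
    and xw: "\<And>s::int. x * w * q powi s \<noteq> 1"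
  shows "appell_m x z q - appell_m x w q
    = w * qpoch_inf q q ^ 3 * theta_j (z / w) q * theta_j (x * z * w) q
      / (theta_j z q * theta_j w q * theta_j (x * z) q * theta_j (x * w) q)"
proof -
  define b where "b = 1 / (x * w)"
  have b0: "b \<noteq> 0" using nz by (simp add: b_def)
  have b: "b * q powi s \<noteq> 1" for s
    using xw[of "- s"] nz q by (simp add: b_def power_int_minus divide_simps)
  have th: "theta_j z q \<noteq> 0" "theta_j w q \<noteq> 0" "theta_j (x * w) q \<noteq> 0" "theta_j (x * z) q \<noteq> 0"
    using theta_j_nonzero[OF q nz(2) z] theta_j_nonzero[OF q nz(3) w] theta_j_nonzero[OF q _ xw]
      theta_j_nonzero[OF q _ annulus_ne_1[OF q ann]] nz by auto
  have thb: "theta_j b q = - theta_j (x * w) q / (x * w)"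
    unfolding b_def by (rule theta_j_inverse[OF q]) (use nz in simp)
  have e1: "- (q powi tri (int 1) / ((- x) ^ 1 * b)) = w"
    using nz by (simp add: b_def)
  have e2: "- ((- z) ^ 1 * q ^ (1 * 0) * q powi tri (int 1) / b) = x * z * w"
    by (simp add: b_def)
  have e3: "x * z * b = z / w" using nz by (simp add: b_def)
  have K: "(\<Sum>\<^sub>\<infinity>s. (q ^ 0 * (x * z)) powi s / (1 - b * (q ^ 1) powi s))
      = qpoch_inf q q ^ 3 * theta_j (z / w) q / (theta_j (x * z) q * theta_j b q)"
    using kronecker[OF q b0 b ann] by (simp add: e3)
  have "x * theta_j w q * appell_sum x z q = theta_j z q * (x * appell_sum x w q)
      - theta_j (x * z * w) q * (qpoch_inf q q ^ 3 * theta_j (z / w) q / (theta_j (x * z) q * theta_j b q))"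
    using appell_multisection[OF q nz(1,2) b0 _ ann, of 1] b
      section_kernel_one[OF q(2) nz(1,3) xw]
    unfolding e1 K[symmetric] by (simp add: e2[simplified] b_def[symmetric])
  also have "\<dots> = x * (theta_j z q * appell_sum x w q
      + w * qpoch_inf q q ^ 3 * theta_j (z / w) q * theta_j (x * z * w) q / (theta_j (x * z) q * theta_j (x * w) q))"
    unfolding thb using nz by (simp add: algebra_simps)
  finally have "theta_j w q * appell_sum x z q = theta_j z q * appell_sum x w q
      + w * qpoch_inf q q ^ 3 * theta_j (z / w) q * theta_j (x * z * w) q / (theta_j (x * z) q * theta_j (x * w) q)"
    using nz by (simp add: mult.assoc)
  moreover have "a / c - b / d = t / (c * d * f)" if "d * a = c * b + t / f" "c \<noteq> 0" "d \<noteq> 0"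
    for a b c d t f :: complex
  proof -
    have "a / c - b / d = (d * a - c * b) / (c * d)" using that(2,3) by (simp add: divide_simps)
    then show ?thesis unfolding that(1) by (simp add: mult_ac)
  qed
  ultimately show ?thesis
    unfolding appell_m_eq using th by (metis (no_types, lifting) mult.assoc)
qed

text \<open>Sorting s by the residue r of -s modulo n, that is s = n (u - 1) - r, turns the exponents
  into those of Appell sums of base q^(n^2) in the summation variable u.\<close>

lemma section_kernel_odd:
  fixes h n :: nat
  assumes q: "norm q < 1" "q \<noteq> 0" and n: "n = 2 * h + 1"
    and sum: "(\<lambda>s. (- 1) powi s * q powi (- tri s)
           * (- (q ^ (n * h)) * (q ^ n) powi s) powi (- ((0 - s) div int n)) / (1 - - (q ^ (n * h)) * (q ^ n) powi s)) summable_on UNIV"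
  shows "section_kernel q (- (q ^ (n * h))) n 1 0
    = (\<Sum>r<n. (- 1) ^ r * q powi (- tri (int r + 1)) * appell_sum (q powi (int n * (int h - int r))) (- 1) (q ^ n\<^sup>2))"
proof -
  define m where "m = int n"
  have m: "m > 0" "odd m" using n by (simp_all add: m_def)
  have tri_m: "tri m = m * int h" 
    using two_tri[of m] by (simp add: m_def n)
  define X where "X = (\<lambda>s. - (q ^ (n * h)) * (q ^ n) powi s)"
  have X_eq: "X s = - (q powi (m * (s + int h)))" for s
  proof -
    have "q ^ (n * h) = q powi (m * int h)" unfolding m_def by (metis of_nat_mult power_int_of_nat)
    moreover have "(q ^ n) powi s = q powi (m * s)" unfolding power_int_power m_def ..
    ultimately show ?thesis using q by (simp add: X_def distrib_left power_int_add)
  qed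
  define d where "d = (\<lambda>s. (- 1) powi s * q powi (- tri s) * X s powi (- ((0 - s) div m)) / (1 - X s))"
  have d_sum: "d summable_on UNIV"
    using sum by (simp add: d_def X_def m_def)
  define cls where "cls = (\<lambda>r::nat. {s. (- s) mod m = int r})"
  have cls_bij: "bij_betw (\<lambda>u. m * (u - 1) - int r) UNIV (cls r)" if "r < n" for r
  proof -
    have r: "int r mod m = int r" using that by (simp add: m_def)
    have 1: "(- (m * (u - 1) - int r)) mod m = int r" for u
    proof -
      have "- (m * (u - 1) - int r) = int r + m * (1 - u)" by (simp add: algebra_simps)
      then show ?thesis using r by (metis mod_mult_self2)
    qed
    have 2: "m * ((- ((- s) div m) + 1) - 1) - int r = s" if "(- s) mod m = int r" for s
      using mult_div_mod_eq[of m "- s"] that by (simp add: algebra_simps)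
    have 3: "- ((- (m * (u - 1) - int r)) div m) + 1 = u" for u
    proof -
      have "- (m * (u - 1) - int r) = int r + m * (1 - u)" by (simp add: algebra_simps)
      also have "\<dots> div m = 1 - u" using that m by (simp add: m_def div_pos_pos_trivial)
      finally show ?thesis by simp
    qed
    show ?thesis
      by (rule bij_betwI[of _ _ _ "\<lambda>s. - ((- s) div m) + 1"]) (use 1 2 3 in \<open>auto simp: cls_def simp del: add_uminus_conv_diff minus_diff_eq\<close>)
  qed
  have cover: "(\<Union>r<n. cls r) = UNIV"
  proof -
    have "\<exists>r<n. (- R) mod m = int r" for R
      using m by (intro exI[of _ "nat ((- R) mod m)"]) (simp add: m_def nat_less_iff)
    then show ?thesis by (fastforce simp: cls_def)
  qed
  have disj: "cls r \<inter> cls r' = {}" if "r \<noteq> r'" for r r'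
    using that by (auto simp: cls_def)
  have cls_sum: "infsum d (cls r) = (- 1) ^ r * q powi (- tri (int r + 1)) * appell_sum (q powi (m * (int h - int r))) (- 1) (q ^ n\<^sup>2)"
    if "r < n" for r
  proof -
    have "infsum d (cls r) = (\<Sum>\<^sub>\<infinity>u. d (m * (u - 1) - int r))"
      by (rule infsum_reindex_bij_betw[OF cls_bij[OF that], symmetric])
    also have "\<dots> = (\<Sum>\<^sub>\<infinity>u. (- 1) ^ r * q powi (- tri (int r + 1))
        * ((q ^ n\<^sup>2) powi tri u * (- (- 1)) powi u / (1 - (q ^ n\<^sup>2) powi (u - 1) * q powi (m * (int h - int r)) * (- 1))))"
    proof (rule infsum_cong)
      fix u :: int
      define v where "v = u - 1"
      define s where "s = m * v - int r"
      have dv: "- ((0 - s) div m) = v"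
      proof -
        have "0 - s = int r + m * (- v)" by (simp add: s_def)
        also have "\<dots> div m = - v"
        proof -
          have "(int r + m * w) div m = w" for w using that m by (simp add: m_def)
          then show ?thesis .
        qed
        finally show ?thesis by simp
      qed
      have sgn: "(- 1 :: complex) powi s * (- 1) powi v = (- 1) ^ r"
        using m by (auto simp: s_def power_int_minus_left power_int_diff uminus_power_if)
      have X: "X s = - ((q ^ n\<^sup>2) powi v * q powi (m * (int h - int r)))"
      proof -
        have "(q ^ n\<^sup>2) powi v = q powi (m\<^sup>2 * v)" unfolding power_int_power m_def by simp
        moreover have "m * (s + int h) = m\<^sup>2 * v + m * (int h - int r)"
          by (simp add: s_def algebra_simps power2_eq_square)
        ultimately show ?thesis unfolding X_eq using q by (simp add: power_int_add)
      qed
      have Xv: "X s powi v = (- 1) powi v * q powi (m * (s + int h) * v)"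
        unfolding X_eq power_int_mult[of q "m * (s + int h)" v] by (simp only: neg_one_powi_mult)
      have qp: "q powi (- tri s) * q powi (m * (s + int h) * v) = q powi (- tri (int r + 1)) * (q ^ n\<^sup>2) powi tri u"
      proof -
        have "2 * (- tri s + m * (s + int h) * v) = 2 * (- tri (int r + 1) + m\<^sup>2 * tri u)"
        proof -
          have "2 * (- tri s + m * (s + int h) * v) = - (2 * tri s) + 2 * (m * s * v) + (2 * (m * int h)) * v"
            by (simp add: algebra_simps)
          also have "\<dots> = - (s * (s - 1)) + 2 * (m * s * v) + m * (m - 1) * v"
            unfolding tri_m[symmetric] two_tri ..
          also have "\<dots> = - ((int r + 1) * (int r + 1 - 1)) + m\<^sup>2 * (u * (u - 1))"
            by (simp add: s_def v_def algebra_simps power2_eq_square)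
          also have "\<dots> = 2 * (- tri (int r + 1) + m\<^sup>2 * tri u)"
            unfolding two_tri[symmetric] by (simp add: algebra_simps)
          finally show ?thesis .
        qed
        then have "- tri s + m * (s + int h) * v = - tri (int r + 1) + m\<^sup>2 * tri u" by simp
        then have "q powi (- tri s + m * (s + int h) * v) = q powi (- tri (int r + 1) + m\<^sup>2 * tri u)"
          by (simp only:)
        moreover have "(q ^ n\<^sup>2) powi tri u = q powi (m\<^sup>2 * tri u)" unfolding power_int_power m_def by simp
        ultimately show ?thesis using q(2) by (simp only: power_int_add simp_thms)
      qed
      have "d s = ((- 1) powi s * (- 1) powi v) * (q powi (- tri s) * q powi (m * (s + int h) * v)) / (1 - X s)"
        unfolding d_def dv Xv by simp
      then show "d (m * (u - 1) - int r) = (- 1) ^ r * q powi (- tri (int r + 1))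
        * ((q ^ n\<^sup>2) powi tri u * (- (- 1)) powi u / (1 - (q ^ n\<^sup>2) powi (u - 1) * q powi (m * (int h - int r)) * (- 1)))"
        unfolding sgn qp unfolding X unfolding s_def v_def by simp
    qed
    finally show ?thesis unfolding infsum_cmult_right' appell_sum_def .
  qed
  have "section_kernel q (- (q ^ (n * h))) n 1 0 = infsum d (\<Union>r<n. cls r)"
    unfolding cover by (simp add: section_kernel_def d_def X_def m_def)
  also have "\<dots> = (\<Sum>r<n. infsum d (cls r))"
    by (rule sum_infsum[symmetric]) (use disj summable_on_subset[OF d_sum] in auto)
  finally show ?thesis by (simp add: cls_sum m_def)
qed

text \<open>The case x = 1 of \<open>appell_multisection\<close> with n = 2h + 1 and b = - q^(nh). This b makes
  the theta constant j(-1; q^(n^2)), and as it is a power of the base q^n up to sign, the theta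
  functions in Kronecker's formula reduce to those with argument -1 and - q^r z.\<close>

lemma appell_m_odd_section:
  fixes h n :: nat
  assumes q: "norm q < 1" "q \<noteq> 0" and n: "n = 2 * h + 1"
    and ann: "norm q < norm z" "norm z < 1"
  shows "appell_m 1 z q
    = (\<Sum>r<n. (- 1) ^ r * q powi (- tri (int r + 1)) * appell_m (q powi (int n * (int h - int r))) (- 1) (q ^ n\<^sup>2))
      - qpoch_inf (q ^ n) (q ^ n) ^ 3 / (theta_j z q * theta_j (- 1) (q ^ n\<^sup>2))
        * (\<Sum>r<n. q powi tri (int r) * (- z) ^ r * (q ^ r * z) powi (- int h)
             * theta_j (- (q ^ r * z)) (q ^ n) * theta_j (- (z ^ n * q ^ (n * r))) (q ^ n\<^sup>2)
             / (theta_j (- 1) (q ^ n) * theta_j (q ^ r * z) (q ^ n)))"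
    (is "_ = sum ?D _ - _ * sum ?S _")
proof -
  define b where "b = - (q ^ (n * h))"
  have n0: "n > 0" and odd: "odd n" using n by auto
  have z0: "z \<noteq> 0" using ann q by auto
  have b0: "b \<noteq> 0" using q by (simp add: b_def)
  have qn: "norm (q ^ n) < 1" "q ^ n \<noteq> 0" and qn2: "norm (q ^ n\<^sup>2) < 1" "q ^ n\<^sup>2 \<noteq> 0"
    using q n0 by (simp_all add: norm_power power_less_one_iff)
  have ne: "- (Q powi s) \<noteq> 1" if Q: "norm Q < 1" "Q \<noteq> 0" for Q :: complex and s
  proof
    assume *: "- (Q powi s) = 1"
    then have "Q powi s = - 1" by (simp add: minus_equation_iff)
    then have "Q powi (s + s) = 1" unfolding power_int_add[OF disjI1[OF Q(2)]] by simp
    then have "s = 0" using powi_ne_1[OF Q, of "s + s"] by auto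
    with * show False by simp
  qed
  have b: "b * (q ^ n) powi s \<noteq> 1" for s
  proof -
    have "b * (q ^ n) powi s = - ((q ^ n) powi (int h + s))"
      using qn by (simp add: b_def power_int_add power_mult)
    then show ?thesis using ne[OF qn] by simp
  qed
  have m1: "- 1 * Q powi s \<noteq> 1" if "norm Q < 1" "Q \<noteq> 0" for Q :: complex and s
    using ne[OF that, of s] by simp
  have tri_n: "q powi tri (int n) = q ^ (n * h)"
  proof -
    have "tri (int n) = int (n * h)" using two_tri[of "int n"] by (simp add: n algebra_simps)
    then show ?thesis by (simp only: power_int_of_nat)
  qed
  have ann': "norm q < norm (1 * z)" "norm (1 * z) < 1" using ann by simp_all
  have e1: "- (q powi tri (int n) / ((- 1) ^ n * b)) = - 1"
    unfolding tri_n using odd q by (simp add: b_def)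
  have e2: "- ((- z) ^ n * q ^ (n * r) * q powi tri (int n) / b) = - (z ^ n * q ^ (n * r))" for r
    unfolding tri_n using odd q by (simp add: b_def)
  have shift: "theta_j b (q ^ n) = (q ^ n) powi (- tri (int h)) * theta_j (- 1) (q ^ n)"
    using theta_j_shift[OF qn, of "- 1" "int h"] by (simp add: b_def power_mult)
  have K: "(\<Sum>\<^sub>\<infinity>s. (q ^ r * (1 * z)) powi s / (1 - b * (q ^ n) powi s))
      = qpoch_inf (q ^ n) (q ^ n) ^ 3 * ((q ^ r * z) powi (- int h) * theta_j (- (q ^ r * z)) (q ^ n))
        / (theta_j (- 1) (q ^ n) * theta_j (q ^ r * z) (q ^ n))" if "r < n" for r
  proof -
    have a: "norm (q ^ n) < norm (q ^ r * z)" "norm (q ^ r * z) < 1"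
    proof -
      have "norm q ^ r * norm z \<le> 1 * norm z"
        using q by (intro mult_right_mono) (auto simp: power_le_one)
      then show "norm (q ^ r * z) < 1" using ann by (simp add: norm_mult norm_power)
      have "norm q ^ n \<le> norm q ^ Suc r" using that q by (intro power_decreasing) auto
      also have "\<dots> = norm q ^ r * norm q" by simp
      also have "\<dots> < norm q ^ r * norm z" using ann q by (intro mult_strict_left_mono) auto
      finally show "norm (q ^ n) < norm (q ^ r * z)" by (simp add: norm_mult norm_power)
    qed
    have "theta_j (q ^ r * z * b) (q ^ n)
        = (q ^ r * z) powi (- int h) * (q ^ n) powi (- tri (int h)) * theta_j (- (q ^ r * z)) (q ^ n)"
      using theta_j_shift[OF qn, of "- (q ^ r * z)" "int h"] z0 q
      unfolding b_def power_mult by (simp add: mult_ac)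
    then show ?thesis
      using kronecker[OF qn b0 b a] q unfolding shift by simp
  qed
  have th: "theta_j z q \<noteq> 0" "theta_j (- 1) (q ^ n\<^sup>2) \<noteq> 0"
    using theta_j_nonzero[OF q z0 annulus_ne_1[OF q ann]] theta_j_nonzero[OF qn2 _ m1[OF qn2]] by auto
  define D where "D = (\<Sum>r<n. (- 1) ^ r * q powi (- tri (int r + 1)) * appell_sum (q powi (int n * (int h - int r))) (- 1) (q ^ n\<^sup>2))"
  have D: "section_kernel q b n 1 0 = D"
    unfolding D_def b_def
    by (rule section_kernel_odd[OF q n])
       (use multisection_product(2)[OF q _ z0 b0 n0 ann' b, of 0] in \<open>simp add: b_def\<close>)
  define S where "S = sum ?S {..<n}"
  have S: "(\<Sum>r<n. q powi tri (int r) * (- z) ^ r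
           * theta_j (- ((- z) ^ n * q ^ (n * r) * q powi tri (int n) / b)) (q ^ (n\<^sup>2))
           * (\<Sum>\<^sub>\<infinity>s. (q ^ r * (1 * z)) powi s / (1 - b * (q ^ n) powi s)))
      = qpoch_inf (q ^ n) (q ^ n) ^ 3 * S"
    unfolding S_def sum_distrib_left
  proof (intro sum.cong refl)
    fix r assume "r \<in> {..<n}"
    then have r: "r < n" by simp
    show "q powi tri (int r) * (- z) ^ r
           * theta_j (- ((- z) ^ n * q ^ (n * r) * q powi tri (int n) / b)) (q ^ (n\<^sup>2))
           * (\<Sum>\<^sub>\<infinity>s. (q ^ r * (1 * z)) powi s / (1 - b * (q ^ n) powi s))
      = qpoch_inf (q ^ n) (q ^ n) ^ 3 * ?S r"
      unfolding K[OF r] e2 by (simp only: times_divide_eq_right times_divide_eq_left mult_ac)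
  qed
  have main: "theta_j (- 1) (q ^ n\<^sup>2) * appell_sum 1 z q = theta_j z q * D - qpoch_inf (q ^ n) (q ^ n) ^ 3 * S"
    using appell_multisection[OF q _ z0 b0 n0 ann' b] unfolding e1 S D by simp
  have "appell_m 1 z q = D / theta_j (- 1) (q ^ n\<^sup>2) - qpoch_inf (q ^ n) (q ^ n) ^ 3 / (theta_j z q * theta_j (- 1) (q ^ n\<^sup>2)) * S"
  proof -
    have "appell_sum 1 z q = (theta_j z q * D - qpoch_inf (q ^ n) (q ^ n) ^ 3 * S) / theta_j (- 1) (q ^ n\<^sup>2)"
      unfolding main[symmetric] using th by simp
    then show ?thesis unfolding appell_m_eq using th by (simp add: divide_simps)
  qed
  moreover have "D / theta_j (- 1) (q ^ n\<^sup>2) = sum ?D {..<n}"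
    by (simp add: D_def appell_m_eq sum_divide_distrib)
  ultimately show ?thesis by (simp only: S_def)
qed

section \<open>The mock theta function as a bilateral series\<close>

lemma norm_power_antimono:
  assumes "norm (q :: complex) \<le> 1" "m \<ge> k"
  shows "norm (q ^ m) \<le> norm q ^ k"
  using assms by (simp add: norm_power power_decreasing)

lemma qpoch_odd_index_split:
  assumes "norm q < 1"
  shows "qpoch q (q\<^sup>2) (2 * n + 1) = qpoch q (q ^ 4) (Suc n) * qpoch (q ^ 3) (q ^ 4) n"
proof (induction n)
  case (Suc n)
  have "qpoch q (q\<^sup>2) (2 * Suc n + 1)
      = qpoch q (q\<^sup>2) (2 * n + 1) * (1 - (q\<^sup>2) ^ (2 * n + 1) * q) * (1 - (q\<^sup>2) ^ (2 * n + 2) * q)"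
    by (simp add: qpoch_Suc)
  moreover have "(q\<^sup>2) ^ (2 * n + 1) * q = (q ^ 4) ^ n * q ^ 3"
  proof -
    have "2 * (2 * n + 1) + 1 = 4 * n + 3" by simp
    then show ?thesis by (metis power_add power_mult power_one_right)
  qed
  moreover have "(q\<^sup>2) ^ (2 * n + 2) * q = (q ^ 4) ^ Suc n * q"
  proof -
    have "2 * (2 * n + 2) = 4 * Suc n" by simp
    then show ?thesis by (metis power_mult)
  qed
  ultimately show ?case
    unfolding Suc qpoch_Suc[of _ _ "Suc n"] qpoch_Suc[of "q ^ 3"] by (simp only: mult_ac)
qed (simp add: qpoch_Suc)

lemma odd_powers_ne_1:
  assumes "norm (q :: complex) < 1"
  shows "(q ^ k) ^ i * q \<noteq> 1"
  using power_mult_ne_1[OF assms assms, of "k * i"] by (simp add: power_mult)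

text \<open>Adding the terms 2M and 2M + 1 of the left-hand series gives
  q^(4M^2) (-q; q^2)_(2M) (1 + q^(8M+2)) / (q; q^2)_(2M+1). The family \<open>\<phi>\<close> interpolates between the two
  series: its row M = 0 is the right-hand series, the difference of two consecutive rows
  telescopes in k with the certificate \<open>G\<close>, and \<open>G M 0\<close> is exactly that sum of two terms.
  Since the row sums tend to 0, the sum of the first row is the sum of the left-hand series.\<close>

lemma mock_V0_rearranged:
  assumes q: "norm q < 1" "q \<noteq> 0"
  shows "(\<Sum>n. q ^ n\<^sup>2 * qpoch (- q) (q\<^sup>2) n / qpoch q (q\<^sup>2) n)
    = (\<Sum>k. q ^ (2 * k\<^sup>2) * qpoch (- (q\<^sup>2)) (q ^ 4) k / qpoch q (q\<^sup>2) (2 * k + 1))"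
proof -
  define t where "t = (\<lambda>n. q ^ n\<^sup>2 * qpoch (- q) (q\<^sup>2) n / qpoch q (q\<^sup>2) n)"
  define \<phi> where "\<phi> = (\<lambda>M k. q ^ (4 * M\<^sup>2 + 2 * k\<^sup>2 + 8 * M * k) * qpoch (- q) (q\<^sup>2) (2 * M)
      * qpoch (- (q\<^sup>2)) (q ^ 4) k / qpoch q (q\<^sup>2) (2 * M + 2 * k + 1))"
  \<comment> \<open>The telescoping certificate is the summand times a polynomial of degree 1 in q^(4k).\<close>
  define G where "G = (\<lambda>M k. \<phi> M k * (1 + q ^ (2 + 8 * M + 4 * k)))"
  have q2: "norm (q\<^sup>2) < 1" "norm (q ^ 4) < 1"
    using q by (simp_all add: norm_power power_less_one_iff)
  have den: "qpoch q (q\<^sup>2) n \<noteq> 0" for n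
    by (rule qpoch_nonzero) (rule odd_powers_ne_1[OF q(1)])
  obtain C1 where C1: "C1 > 0" "\<And>n. norm (qpoch (- q) (q\<^sup>2) n) \<le> C1"
    using qpoch_bounded[OF q2(1)] by blast
  obtain C2 where C2: "C2 > 0" "\<And>n. norm (qpoch (- (q\<^sup>2)) (q ^ 4) n) \<le> C2"
    using qpoch_bounded[OF q2(2)] by blast
  obtain C3 where C3: "C3 > 0" "\<And>n. norm (inverse (qpoch q (q\<^sup>2) n)) \<le> C3"
    by (rule inverse_qpoch_bounded[OF q2(1) odd_powers_ne_1[OF q(1)]]) (rule that)
  define C where "C = C1 * C2 * C3"
  have C: "C > 0" using C1 C2 C3 by (simp add: C_def)
  have sq: "k \<le> k\<^sup>2" for k :: nat by (simp add: power2_eq_square)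
  have \<phi>_bound: "norm (\<phi> M k) \<le> C * norm q ^ M * norm q ^ k" for M k
  proof -
    have e: "M + k \<le> 4 * M\<^sup>2 + 2 * k\<^sup>2 + 8 * M * k" using sq[of M] sq[of k] by linarith
    have "norm (\<phi> M k) = norm (q ^ (4 * M\<^sup>2 + 2 * k\<^sup>2 + 8 * M * k)) * (norm (qpoch (- q) (q\<^sup>2) (2 * M))
      * norm (qpoch (- (q\<^sup>2)) (q ^ 4) k) * norm (inverse (qpoch q (q\<^sup>2) (2 * M + 2 * k + 1))))"
      by (simp add: \<phi>_def norm_mult norm_divide norm_inverse divide_inverse)
    also have "\<dots> \<le> norm q ^ (M + k) * (C1 * C2 * C3)"
      using C1 C2 C3 q by (intro mult_mono norm_power_antimono e) auto
    finally show ?thesis by (simp add: C_def power_add mult_ac)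
  qed
  have geo: "summable (\<lambda>k. C * norm q ^ M * norm q ^ k)" for M
    using q by (intro summable_mult summable_geometric) simp
  have \<phi>_sum: "summable (\<phi> M)" for M
    by (rule summable_comparison_test'[OF geo[of M], of 0]) (rule \<phi>_bound)
  have \<phi>_lim: "\<phi> M \<longlonglongrightarrow> 0" for M by (rule summable_LIMSEQ_zero[OF \<phi>_sum])
  have G_lim: "G M \<longlonglongrightarrow> 0" for M
  proof -
    have "(\<lambda>k. q ^ (2 + 8 * M) * (q ^ 4) ^ k) \<longlonglongrightarrow> q ^ (2 + 8 * M) * 0"
      by (intro tendsto_intros LIMSEQ_power_zero q2)
    from tendsto_mult[OF \<phi>_lim tendsto_add[OF tendsto_const this, of 1]] show ?thesis by (simp add: G_def power_add power_mult mult.assoc)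
  qed
  have tele: "\<phi> M k - \<phi> (Suc M) k = G M k - G M (Suc k)" for M k
  proof -
    \<comment> \<open>In terms of a = q^(4M) and K = q^(4k) the telescoping relation is polynomial.\<close>
    define a where "a = q ^ (4 * M)"
    define K where "K = q ^ (4 * k)"
    define P where "P = q ^ (4 * M\<^sup>2 + 2 * k\<^sup>2 + 8 * M * k) * qpoch (- q) (q\<^sup>2) (2 * M) * qpoch (- (q\<^sup>2)) (q ^ 4) k"
    define D where "D = qpoch q (q\<^sup>2) (2 * M + 2 * k + 1)"
    define u where "u = (1 - a * K * q ^ 3) * (1 - a * K * q ^ 5)"
    have D': "qpoch q (q\<^sup>2) (2 * M + 2 * k + 3) = D * u"
    proof -
      have "qpoch q (q\<^sup>2) (2 * M + 2 * k + 3) = D * ((1 - (q\<^sup>2) ^ (2 * M + 2 * k + 1) * q) * (1 - (q\<^sup>2) ^ (2 * M + 2 * k + 2) * q))"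
        unfolding D_def by (simp add: qpoch_Suc eval_nat_numeral)
      moreover have "(q\<^sup>2) ^ (2 * M + 2 * k + 1) * q = a * K * q ^ 3"
      proof -
        have "(q\<^sup>2) ^ (2 * M + 2 * k + 1) * q = q ^ (2 * (2 * M + 2 * k + 1) + 1)"
          by (simp only: power_add power_mult power_one_right)
        also have "2 * (2 * M + 2 * k + 1) + 1 = 4 * M + 4 * k + 3" by simp
        finally show ?thesis unfolding a_def K_def by (simp only: power_add)
      qed
      moreover have "(q\<^sup>2) ^ (2 * M + 2 * k + 2) * q = a * K * q ^ 5"
      proof -
        have "(q\<^sup>2) ^ (2 * M + 2 * k + 2) * q = q ^ (2 * (2 * M + 2 * k + 2) + 1)"
          by (simp only: power_add power_mult power_one_right)
        also have "2 * (2 * M + 2 * k + 2) + 1 = 4 * M + 4 * k + 5" by simp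
        finally show ?thesis unfolding a_def K_def by (simp only: power_add)
      qed
      ultimately show ?thesis by (simp only: u_def)
    qed
    have nz: "D \<noteq> 0" "u \<noteq> 0" using den[of "2 * M + 2 * k + 1"] den[of "2 * M + 2 * k + 3"] D' by (auto simp: D_def)
    have 1: "\<phi> M k = P / D" by (simp add: \<phi>_def P_def D_def)
    have 2: "\<phi> (Suc M) k = P * (q ^ 4 * a\<^sup>2 * K\<^sup>2 * ((1 + a * q) * (1 + a * q ^ 3))) / (D * u)"
    proof -
      have "qpoch (- q) (q\<^sup>2) (2 * Suc M) = qpoch (- q) (q\<^sup>2) (2 * M) * ((1 + a * q) * (1 + a * q ^ 3))"
      proof -
        have "(q\<^sup>2) ^ (2 * M) = a" by (simp add: a_def flip: power_mult)
        then have "qpoch (- q) (q\<^sup>2) (Suc (Suc (2 * M))) = qpoch (- q) (q\<^sup>2) (2 * M) * ((1 + a * q) * (1 + a * q ^ 3))"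
          unfolding qpoch_Suc power_Suc by (simp add: eval_nat_numeral mult_ac)
        then show ?thesis by simp
      qed
      moreover have "q ^ (4 * (Suc M)\<^sup>2 + 2 * k\<^sup>2 + 8 * Suc M * k) = q ^ (4 * M\<^sup>2 + 2 * k\<^sup>2 + 8 * M * k) * (q ^ 4 * a\<^sup>2 * K\<^sup>2)"
      proof -
        have "4 * (Suc M)\<^sup>2 + 2 * k\<^sup>2 + 8 * Suc M * k = (4 * M\<^sup>2 + 2 * k\<^sup>2 + 8 * M * k) + (4 + 2 * (4 * M) + 2 * (4 * k))"
          by (simp add: power2_eq_square algebra_simps)
        then show ?thesis
          unfolding a_def K_def by (simp only: power_add power_mult[symmetric] mult.commute[of "4 * M" 2] mult.commute[of "4 * k" 2])
      qed
      moreover have "2 * Suc M + 2 * k + 1 = 2 * M + 2 * k + 3" by simp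
      ultimately show ?thesis unfolding \<phi>_def P_def D'[symmetric] by (simp only: mult_ac)
    qed
    have 3: "\<phi> M (Suc k) = P * (q\<^sup>2 * a\<^sup>2 * K * (1 + K * q\<^sup>2)) / (D * u)"
    proof -
      have "qpoch (- (q\<^sup>2)) (q ^ 4) (Suc k) = qpoch (- (q\<^sup>2)) (q ^ 4) k * (1 + K * q\<^sup>2)"
        by (simp add: qpoch_Suc K_def flip: power_mult)
      moreover have "q ^ (4 * M\<^sup>2 + 2 * (Suc k)\<^sup>2 + 8 * M * Suc k) = q ^ (4 * M\<^sup>2 + 2 * k\<^sup>2 + 8 * M * k) * (q\<^sup>2 * a\<^sup>2 * K)"
      proof -
        have "4 * M\<^sup>2 + 2 * (Suc k)\<^sup>2 + 8 * M * Suc k = (4 * M\<^sup>2 + 2 * k\<^sup>2 + 8 * M * k) + (2 + 2 * (4 * M) + 4 * k)"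
          by (simp add: power2_eq_square algebra_simps)
        then show ?thesis
          unfolding a_def K_def by (simp only: power_add power_mult[symmetric] mult.commute[of "4 * M" 2])
      qed
      moreover have "2 * M + 2 * Suc k + 1 = 2 * M + 2 * k + 3" by simp
      ultimately show ?thesis unfolding \<phi>_def P_def D'[symmetric] by (simp only: mult_ac)
    qed
    have g1: "q ^ (2 + 8 * M + 4 * k) = q\<^sup>2 * a\<^sup>2 * K"
      by (simp add: a_def K_def flip: power_mult power_add)
    have g2: "q ^ (2 + 8 * M + 4 * Suc k) = q ^ 6 * a\<^sup>2 * K"
      by (simp add: a_def K_def add.assoc flip: power_mult power_add)
    have "u - q ^ 4 * a\<^sup>2 * K\<^sup>2 * ((1 + a * q) * (1 + a * q ^ 3))
        = u * (1 + q\<^sup>2 * a\<^sup>2 * K) - q\<^sup>2 * a\<^sup>2 * K * (1 + K * q\<^sup>2) * (1 + q ^ 6 * a\<^sup>2 * K)"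
      unfolding u_def by (simp add: algebra_simps eval_nat_numeral)
    moreover have "P / D - P * \<alpha> / (D * u) = P / D * \<gamma> - P * \<beta> / (D * u) * \<delta>"
      if "u - \<alpha> = u * \<gamma> - \<beta> * \<delta>" for \<alpha> \<beta> \<gamma> \<delta>
    proof -
      have "P / D - P * \<alpha> / (D * u) = P / (D * u) * (u - \<alpha>)"
        using nz by (simp add: right_diff_distrib)
      also have "\<dots> = P / D * \<gamma> - P * \<beta> / (D * u) * \<delta>"
        unfolding that using nz by (simp add: right_diff_distrib)
      finally show ?thesis .
    qed
    ultimately show ?thesis
      unfolding G_def g1 g2 1 2 3 by blast
  qed
  have start: "G M 0 = t (2 * M) + t (2 * M + 1)" for M
  proof -
    define c where "c = q ^ (4 * M + 1)"
    have c: "(q\<^sup>2) ^ (2 * M) * q = c" by (simp add: c_def flip: power_mult power_Suc2)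
    have c2: "q ^ (2 + 8 * M) = c\<^sup>2"
    proof -
      have "2 + 8 * M = (4 * M + 1) * 2" by simp
      then show ?thesis unfolding c_def by (simp only: power_mult)
    qed
    have qe: "q ^ (2 * M + 1)\<^sup>2 = q ^ (4 * M\<^sup>2) * c"
      by (simp add: c_def power2_eq_square algebra_simps flip: power_add)
    have qe': "q ^ (2 * M)\<^sup>2 = q ^ (4 * M\<^sup>2)" by (simp add: power2_eq_square mult_ac)
    have n1: "qpoch (- q) (q\<^sup>2) (2 * M + 1) = qpoch (- q) (q\<^sup>2) (2 * M) * (1 + c)"
      unfolding c[symmetric] by (simp add: qpoch_Suc)
    have d1: "qpoch q (q\<^sup>2) (2 * M + 1) = qpoch q (q\<^sup>2) (2 * M) * (1 - c)"
      unfolding c[symmetric] by (simp add: qpoch_Suc)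
    have nz: "qpoch q (q\<^sup>2) (2 * M) \<noteq> 0" "1 - c \<noteq> 0"
      using den[of "2 * M"] den[of "2 * M + 1"] d1 by auto
    have "G M 0 = q ^ (4 * M\<^sup>2) * qpoch (- q) (q\<^sup>2) (2 * M) / (qpoch q (q\<^sup>2) (2 * M) * (1 - c)) * (1 + c\<^sup>2)"
      unfolding G_def \<phi>_def by (simp only: d1 c2 mult_0_right add_0_right power_zero_numeral qpoch_0 mult_1_right)
    also have "\<dots> = t (2 * M) + t (2 * M + 1)"
    proof -
      have "E * A / (B * (1 - c)) * (1 + c\<^sup>2) = E * A / B + E * c * (A * (1 + c)) / (B * (1 - c))"
        if "B \<noteq> 0" for E A B :: complex
        using that nz(2) by (simp add: divide_simps) (simp add: algebra_simps power2_eq_square)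
      from this[OF nz(1)] show ?thesis unfolding t_def qe qe' n1 d1 .
    qed
    finally show ?thesis .
  qed
  define \<Phi> where "\<Phi> = (\<lambda>M. \<Sum>k. \<phi> M k)"
  have step: "\<Phi> M - \<Phi> (Suc M) = t (2 * M) + t (2 * M + 1)" for M
  proof -
    have "(\<lambda>k. G M k - G M (Suc k)) sums (G M 0 - 0)"
      by (rule telescope_sums'[OF G_lim])
    then have "(\<lambda>k. \<phi> M k - \<phi> (Suc M) k) sums (G M 0)" by (simp add: tele)
    moreover have "(\<lambda>k. \<phi> M k - \<phi> (Suc M) k) sums (\<Phi> M - \<Phi> (Suc M))"
      unfolding \<Phi>_def by (intro sums_diff summable_sums \<phi>_sum)
    ultimately show ?thesis using start sums_unique2 by metis
  qed
  have partial: "(\<Sum>n<2 * M. t n) = \<Phi> 0 - \<Phi> M" for M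
  proof (induction M)
    case (Suc M)
    have "(\<Sum>n<2 * Suc M. t n) = (\<Sum>n<2 * M. t n) + (t (2 * M) + t (2 * M + 1))" by simp
    then show ?case unfolding Suc step[symmetric] by simp
  qed simp
  have \<Phi>_lim: "\<Phi> \<longlonglongrightarrow> 0"
  proof (rule Lim_null_comparison)
    show "\<forall>\<^sub>F M in sequentially. norm (\<Phi> M) \<le> C * norm q ^ M * (1 / (1 - norm q))"
    proof (rule always_eventually, rule allI)
      fix M
      have "norm (\<Phi> M) \<le> (\<Sum>k. C * norm q ^ M * norm q ^ k)"
        unfolding \<Phi>_def by (rule norm_suminf_le[OF \<phi>_bound geo])
      also have "\<dots> = C * norm q ^ M * (1 / (1 - norm q))"
        using q by (subst suminf_mult) (auto simp: suminf_geometric summable_geometric)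
      finally show "norm (\<Phi> M) \<le> C * norm q ^ M * (1 / (1 - norm q))" .
    qed
    have "(\<lambda>M. C * norm q ^ M * (1 / (1 - norm q))) \<longlonglongrightarrow> C * 0 * (1 / (1 - norm q))"
      using q by (intro tendsto_intros LIMSEQ_power_zero) simp
    then show "(\<lambda>M. C * norm q ^ M * (1 / (1 - norm q))) \<longlonglongrightarrow> 0" by simp
  qed
  have t_sum: "summable t"
  proof (rule summable_comparison_test')
    show "summable (\<lambda>n. C1 * C3 * norm q ^ n)"
      using q by (intro summable_mult summable_geometric) simp
    fix n :: nat assume "n \<ge> 0"
    have "norm (t n) = norm (q ^ n\<^sup>2) * (norm (qpoch (- q) (q\<^sup>2) n) * norm (inverse (qpoch q (q\<^sup>2) n)))"
      by (simp add: t_def norm_mult norm_divide norm_inverse divide_inverse)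
    also have "\<dots> \<le> norm q ^ n * (C1 * C3)"
      using C1 C3 q by (intro mult_mono norm_power_antimono sq) auto
    finally show "norm (t n) \<le> C1 * C3 * norm q ^ n" by (simp add: mult_ac)
  qed
  have "(\<lambda>M. \<Sum>n<2 * M. t n) \<longlonglongrightarrow> suminf t"
    by (rule filterlim_compose[OF summable_LIMSEQ[OF t_sum]]) (rule mult_nat_left_at_top, simp)
  moreover have "(\<lambda>M. \<Sum>n<2 * M. t n) \<longlonglongrightarrow> \<Phi> 0 - 0"
    unfolding partial by (intro tendsto_intros \<Phi>_lim)
  ultimately have "suminf t = \<Phi> 0" using LIMSEQ_unique by fastforce
  then show ?thesis by (simp add: t_def \<Phi>_def \<phi>_def)
qed

definition gauss_weight :: "complex \<Rightarrow> int \<Rightarrow> complex" where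
  "gauss_weight p n = p powi (n * n) * qpoch (- p) (p\<^sup>2) (nat n)"

lemma gauss_weight_bound:
  assumes "norm p < 1" "p \<noteq> 0"
  obtains C where "C > 0" "\<And>n. norm (gauss_weight p n) \<le> C * norm (p powi (n * n))"
proof -
  have "norm (p\<^sup>2) < 1" using assms by (simp add: norm_power power_less_one_iff)
  then obtain C where C: "C > 0" "\<And>n. norm (qpoch (- p) (p\<^sup>2) n) \<le> C"
    using qpoch_bounded by blast
  show ?thesis
  proof (rule that[OF C(1)])
    fix n
    have "norm (p powi (n * n)) * norm (qpoch (- p) (p\<^sup>2) (nat n)) \<le> norm (p powi (n * n)) * C"
      by (rule mult_left_mono[OF C(2)]) simp
    then show "norm (gauss_weight p n) \<le> C * norm (p powi (n * n))"
      by (simp add: gauss_weight_def norm_mult mult.commute)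
  qed
qed

lemma summable_square_powers:
  fixes p :: complex
  assumes "norm p < 1" "p \<noteq> 0"
  shows "(\<lambda>n. norm (p powi (n * n))) summable_on UNIV"
proof -
  have "(p\<^sup>2) powi tri n * p powi n = p powi (n * n)" for n
  proof -
    have "(p\<^sup>2) powi tri n * p powi n = p powi (2 * tri n + n)"
      using assms by (simp add: power_int_power power_int_add)
    then show ?thesis unfolding two_tri by (simp add: algebra_simps)
  qed
  then show ?thesis
    using theta_terms_abs_summable[of "p\<^sup>2" p] assms by (simp add: norm_power power_less_one_iff)
qed

text \<open>The sums U(r) on the left satisfy U(r + 1) = p^(2r+1) U(r), because the difference of the
  two sides telescopes in n with certificate - (1 - p^(2r+1)) H(n). Hence p^(-r^2) U(r) does not
  depend on r. Its limit for r to infinity is the value of U(0): after the shift n = m + r all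
  terms except m = 0 tend to 0.\<close>

lemma gauss_weight_moment:
  assumes p: "norm p < 1" "p \<noteq> 0"
  shows "(\<Sum>\<^sub>\<infinity>n. gauss_weight p n * (rfac (p\<^sup>2) (n - r) * rfac (p\<^sup>2) (n + r)))
    = p powi (r * r) * (qpoch_inf (- p) (p\<^sup>2) / qpoch_inf (p\<^sup>2) (p\<^sup>2))"
proof -
  define P where "P = p\<^sup>2"
  have P: "norm P < 1" "P \<noteq> 0" using p by (simp_all add: P_def norm_power power_less_one_iff)
  define W where "W = gauss_weight p"
  obtain C where C: "C > 0" "\<And>n. norm (W n) \<le> C * norm (p powi (n * n))"
    unfolding W_def using gauss_weight_bound[OF p] by blast
  obtain B where B: "B > 0" "\<And>k. norm (rfac P k) \<le> B"
    using rfac_bounded[OF P(1)] by blast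
  have sum: "(\<lambda>n. W n * (rfac P (n + i) * rfac P (n + j))) summable_on UNIV" for i j
  proof (rule abs_summable_summable, rule Infinite_Sum.abs_summable_on_comparison_test')
    show "(\<lambda>n. C * (B * B) * norm (p powi (n * n))) summable_on UNIV"
      by (rule summable_on_cmult_right[OF summable_square_powers[OF p]])
    fix n
    have "norm (W n) * (norm (rfac P (n + i)) * norm (rfac P (n + j))) \<le> C * norm (p powi (n * n)) * (B * B)"
      by (intro mult_mono C B) (use B C in auto)
    then show "norm (W n * (rfac P (n + i) * rfac P (n + j))) \<le> C * (B * B) * norm (p powi (n * n))"
      by (simp add: norm_mult mult_ac)
  qed
  define U where "U = (\<lambda>r. \<Sum>\<^sub>\<infinity>n. W n * (rfac P (n + - r) * rfac P (n + r)))"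
  have rec: "U (r + 1) = p powi (2 * r + 1) * U r" for r
  proof -
    define c where "c = p powi (2 * r + 1)"
    have c: "c \<noteq> 0" using p by (simp add: c_def)
    define H where "H = (\<lambda>n. W n * (rfac P (n + (- r - 1)) * rfac P (n + r)))"
    have H_sum: "H summable_on UNIV" unfolding H_def by (rule sum)
    have eq: "W n * (rfac P (n + - (r + 1)) * rfac P (n + (r + 1))) + - c * (W n * (rfac P (n + - r) * rfac P (n + r)))
        = - (1 - c) * H (n + 1) + (1 - c) * H n" for n
    proof (cases "n \<ge> 0")
      case True
      \<comment> \<open>In terms of N = P^n and c = p^(2r+1) the relation is polynomial.\<close>
      define N where "N = P powi n"
      have N0: "N \<noteq> 0" using P by (simp add: N_def)
      define A where "A = P powi (n - r)"
      define B' where "B' = P powi (n + r + 1)"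
      define R where "R = rfac P (n - r) * rfac P (n + r + 1)"
      have Pr: "P powi r = c / p"
        using p by (simp add: c_def P_def power_int_add power_int_power)
      have A: "A = N * p / c" 
        using P p by (simp add: A_def N_def power_int_diff Pr)
      have B': "B' = N * c * p"
        using P p by (simp add: B'_def N_def power_int_add Pr) (simp add: P_def power2_eq_square)
      have r1: "rfac P (n - r - 1) = (1 - A) * rfac P (n - r)" "rfac P (n + r) = (1 - B') * rfac P (n + r + 1)"
        using rfac_pred[OF P(1), of "n - r"] rfac_pred[OF P(1), of "n + r + 1"] by (simp_all add: A_def B'_def)
      have W1: "W (n + 1) = W n * (N * p * (1 + p * N))"
      proof -
        have "p powi ((n + 1) * (n + 1)) = p powi (n * n) * (N * p)"
        proof -
          have "(n + 1) * (n + 1) = n * n + (2 * n + 1)" by (simp add: algebra_simps)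
          then show ?thesis using p by (simp add: N_def P_def power_int_add power_int_power)
        qed
        moreover have "qpoch (- p) P (nat (n + 1)) = qpoch (- p) P (nat n) * (1 + p * N)"
          using True by (simp add: nat_add_distrib qpoch_Suc N_def power_int_nonneg_exp)
        ultimately show ?thesis by (simp add: W_def gauss_weight_def flip: P_def)
      qed
      have i: "n + - (r + 1) = n - r - 1" "n + (r + 1) = n + r + 1" "n + - r = n - r" "n + (- r - 1) = n - r - 1"
        "n + 1 + (- r - 1) = n - r" "n + 1 + r = n + r + 1" by simp_all
      have "(1 - A) + - c * (1 - B') = - (1 - c) * (N * p * (1 + p * N)) + (1 - c) * ((1 - A) * (1 - B'))"
        unfolding A B' using c by (simp add: field_simps)
      then have "W n * R * ((1 - A) + - c * (1 - B')) = W n * R * (- (1 - c) * (N * p * (1 + p * N)) + (1 - c) * ((1 - A) * (1 - B')))"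
        by (simp only:)
      then show ?thesis
        unfolding H_def i W1 r1 R_def by (simp only: distrib_left mult_ac)
    next
      case False
      then have n: "n < 0" by simp
      \<comment> \<open>For negative n one of the two indices is negative, so every term vanishes.\<close>
      have z: "rfac P (n + i) * rfac P (n + j) = 0" if "i + j \<le> 0" for i j
        using n that by (auto simp: rfac_def)
      have z1: "rfac P (n + 1 + (- r - 1)) * rfac P (n + 1 + r) = 0"
        using n by (auto simp: rfac_def)
      have z2: "rfac P (n + - (r + 1)) * rfac P (n + (r + 1)) = 0" "rfac P (n + - r) * rfac P (n + r) = 0"
        "rfac P (n + (- r - 1)) * rfac P (n + r) = 0"
        by (rule z, simp)+
      show ?thesis unfolding H_def z1 z2 by simp
    qed
    have "U (r + 1) + - c * U r = (\<Sum>\<^sub>\<infinity>n. W n * (rfac P (n + - (r + 1)) * rfac P (n + (r + 1))) + - c * (W n * (rfac P (n + - r) * rfac P (n + r))))"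
      unfolding U_def using infsum_add[OF sum summable_on_cmult_right[OF sum, of "- c"]]
      by (simp only: infsum_cmult_right')
    also have "\<dots> = (\<Sum>\<^sub>\<infinity>n. - (1 - c) * H (n + 1) + (1 - c) * H n)"
      by (simp only: eq)
    also have "\<dots> = (\<Sum>\<^sub>\<infinity>n. - (1 - c) * H (n + 1)) + (\<Sum>\<^sub>\<infinity>n. (1 - c) * H n)"
      by (intro infsum_add summable_on_cmult_right H_sum summable_int_shift[THEN iffD2])
    also have "\<dots> = 0"
      unfolding infsum_cmult_right' infsum_int_shift by (simp add: algebra_simps)
    finally show ?thesis by (simp add: c_def)
  qed
  have const: "p powi (- (r * r)) * U r = U 0" for r
  proof -
    have "p powi (- ((n + 1) * (n + 1))) * U (n + 1) = p powi (- (n * n)) * U n" for n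
    proof -
      have "- ((n + 1) * (n + 1)) + (2 * n + 1) = - (n * n)" by (simp add: algebra_simps)
      then have "p powi (- ((n + 1) * (n + 1)) + (2 * n + 1)) = p powi (- (n * n))" by (simp only:)
      then have "p powi (- ((n + 1) * (n + 1))) * p powi (2 * n + 1) = p powi (- (n * n))"
        using p(2) by (simp only: power_int_add simp_thms)
      then show ?thesis unfolding rec by (simp only: mult.assoc[symmetric])
    qed
    from int_shift_invariant[of "\<lambda>n. p powi (- (n * n)) * U n", OF this, of r] show ?thesis by simp
  qed
  have U_shift: "U 0 = (\<Sum>\<^sub>\<infinity>m. p powi (m * m + 2 * int r * m) * qpoch (- p) P (nat (m + int r)) * (rfac P m * rfac P (m + 2 * int r)))" for r
  proof -
    have "U 0 = p powi (- (int r * int r)) * (\<Sum>\<^sub>\<infinity>m. W (m + int r) * (rfac P (m + int r + - int r) * rfac P (m + int r + int r)))"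
    proof -
      have "U (int r) = (\<Sum>\<^sub>\<infinity>m. W (m + int r) * (rfac P (m + int r + - int r) * rfac P (m + int r + int r)))"
        unfolding U_def
        by (rule infsum_int_shift[where f = "\<lambda>n. W n * (rfac P (n + - int r) * rfac P (n + int r))", symmetric])
      then show ?thesis using const[of "int r"] by (simp only:)
    qed
    also have "\<dots> = (\<Sum>\<^sub>\<infinity>m. p powi (- (int r * int r)) * (W (m + int r) * (rfac P (m + int r + - int r) * rfac P (m + int r + int r))))"
      by (rule infsum_cmult_right'[symmetric])
    also have "\<dots> = (\<Sum>\<^sub>\<infinity>m. p powi (m * m + 2 * int r * m) * qpoch (- p) P (nat (m + int r)) * (rfac P m * rfac P (m + 2 * int r)))"
    proof (rule infsum_cong)
      fix m
      have "- (int r * int r) + (m + int r) * (m + int r) = m * m + 2 * int r * m" by (simp add: algebra_simps)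
      then have "p powi (- (int r * int r) + (m + int r) * (m + int r)) = p powi (m * m + 2 * int r * m)" by (simp only:)
      then have "p powi (- (int r * int r)) * p powi ((m + int r) * (m + int r)) = p powi (m * m + 2 * int r * m)"
        using p(2) by (simp only: power_int_add simp_thms)
      moreover have "m + int r + int r = m + 2 * int r" "m + int r + - int r = m" by simp_all
      ultimately show "p powi (- (int r * int r)) * (W (m + int r) * (rfac P (m + int r + - int r) * rfac P (m + int r + int r)))
        = p powi (m * m + 2 * int r * m) * qpoch (- p) P (nat (m + int r)) * (rfac P m * rfac P (m + 2 * int r))"
        by (simp only: W_def gauss_weight_def P_def mult.assoc[symmetric])
    qed
    finally show ?thesis .
  qed
  obtain C' where C': "C' > 0" "\<And>n. norm (qpoch (- p) P n) \<le> C'"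
    using qpoch_bounded[OF P(1)] by blast
  have lim: "(\<lambda>r::nat. \<Sum>\<^sub>\<infinity>m. p powi (m * m + 2 * int r * m) * qpoch (- p) P (nat (m + int r)) * (rfac P m * rfac P (m + 2 * int r)))
      \<longlonglongrightarrow> (\<Sum>\<^sub>\<infinity>m::int. if m = 0 then qpoch_inf (- p) P / qpoch_inf P P else 0)"
  proof (rule tendsto_infsum_int_dominated)
    fix m :: int
    have l1: "(\<lambda>r. qpoch (- p) P (nat (m + int r))) \<longlonglongrightarrow> qpoch_inf (- p) P"
    proof (rule filterlim_compose[OF qpoch_LIMSEQ[OF P(1)]])
      show "filterlim (\<lambda>r. nat (m + int r)) sequentially sequentially"
        unfolding filterlim_at_top
      proof
        fix Z :: nat
        show "\<forall>\<^sub>F n in sequentially. Z \<le> nat (m + int n)"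
          using eventually_ge_at_top[of "Z + nat (- m)"] by eventually_elim linarith
      qed
    qed
    have l2: "(\<lambda>r. rfac P (m + 2 * int r)) \<longlonglongrightarrow> inverse (qpoch_inf P P)"
    proof -
      have "(\<lambda>r. rfac P (int (2 * r) + m)) \<longlonglongrightarrow> inverse (qpoch_inf P P)"
        by (rule filterlim_compose[OF rfac_LIMSEQ[OF P(1)]]) (rule mult_nat_left_at_top, simp)
      then show ?thesis by (simp add: add.commute)
    qed
    show "(\<lambda>r. p powi (m * m + 2 * int r * m) * qpoch (- p) P (nat (m + int r)) * (rfac P m * rfac P (m + 2 * int r)))
        \<longlonglongrightarrow> (if m = 0 then qpoch_inf (- p) P / qpoch_inf P P else 0)"
    proof (cases m "0::int" rule: linorder_cases)
      case less
      then show ?thesis by (simp add: rfac_def)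
    next
      case equal
      then show ?thesis using tendsto_mult[OF l1 l2] by (simp add: rfac_def divide_inverse)
    next
      case greater
      define k where "k = nat m"
      have k: "m = int k" "k > 0" using greater by (simp_all add: k_def)
      have "p powi (m * m + 2 * int r * m) = p powi (m * m) * (p ^ (2 * k)) ^ r" for r
      proof -
        have "2 * int r * m = int (2 * k * r)" by (simp add: k)
        then show ?thesis using p by (simp only: power_int_add power_int_of_nat power_mult simp_thms)
      qed
      moreover have "(\<lambda>r. p powi (m * m) * (p ^ (2 * k)) ^ r) \<longlonglongrightarrow> p powi (m * m) * 0"
        by (intro tendsto_intros LIMSEQ_power_zero) (use p k in \<open>simp add: norm_power power_less_one_iff\<close>)
      ultimately have "(\<lambda>r. p powi (m * m + 2 * int r * m)) \<longlonglongrightarrow> 0" by simp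
      from tendsto_mult[OF tendsto_mult[OF this l1] tendsto_mult[OF tendsto_const l2], of "rfac P m"]
      show ?thesis using greater by simp
    qed
  next
    fix r :: nat and m :: int
    show "norm (p powi (m * m + 2 * int r * m) * qpoch (- p) P (nat (m + int r)) * (rfac P m * rfac P (m + 2 * int r)))
        \<le> norm (p powi (m * m)) * (C' * (B * B))"
    proof (cases "m \<ge> 0")
      case True
      have "norm (p powi (m * m + 2 * int r * m)) \<le> norm (p powi (m * m))"
        unfolding norm_power_int by (rule power_int_decreasing) (use True p in auto)
      then have "norm (p powi (m * m + 2 * int r * m)) * (norm (qpoch (- p) P (nat (m + int r))) * (norm (rfac P m) * norm (rfac P (m + 2 * int r))))
          \<le> norm (p powi (m * m)) * (C' * (B * B))"
        by (intro mult_mono B C') (use B C' in auto)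
      then show ?thesis by (simp only: norm_mult mult.assoc)
    next
      case False
      then show ?thesis using B C' by (simp add: rfac_def)
    qed
  next
    show "(\<lambda>m. norm (p powi (m * m)) * (C' * (B * B))) summable_on UNIV"
      by (rule summable_on_cmult_left[OF summable_square_powers[OF p]])
  qed
  have "U 0 = (\<Sum>\<^sub>\<infinity>m::int. if m = 0 then qpoch_inf (- p) P / qpoch_inf P P else 0)"
    using lim unfolding U_shift[symmetric] by (simp add: LIMSEQ_const_iff)
  also have "\<dots> = (\<Sum>\<^sub>\<infinity>m\<in>{0::int}. qpoch_inf (- p) P / qpoch_inf P P)"
    by (rule infsum_cong_neutral) auto
  finally have U0: "U 0 = qpoch_inf (- p) P / qpoch_inf P P" by simp
  have "U r = p powi (r * r) * (p powi (- (r * r)) * U r)"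
    using p by (simp add: power_int_minus)
  also have "\<dots> = p powi (r * r) * (qpoch_inf (- p) P / qpoch_inf P P)"
    unfolding const U0 ..
  finally show ?thesis by (simp add: U_def W_def P_def)
qed

text \<open>By \<open>qpoch_odd_index_split\<close> the denominators are of the form treated in
  \<open>finite_partial_fractions\<close>, with base q^4 and x = q. Interchanging the summations
  leaves the moments computed in \<open>gauss_weight_moment\<close>.\<close>

lemma bilateral_form:
  assumes q: "norm q < 1" "q \<noteq> 0"
  shows "(\<Sum>k. q ^ (2 * k\<^sup>2) * qpoch (- (q\<^sup>2)) (q ^ 4) k / qpoch q (q\<^sup>2) (2 * k + 1))
    = qpoch_inf (- (q\<^sup>2)) (q ^ 4) / qpoch_inf (q ^ 4) (q ^ 4)
      * (\<Sum>\<^sub>\<infinity>r. (- 1) powi r * q powi (4 * (r * r) + 2 * r) / (1 - q powi (4 * r + 1)))"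
proof -
  define p where "p = q\<^sup>2"
  define P where "P = q ^ 4"
  have p: "norm p < 1" "p \<noteq> 0" and P: "norm P < 1" "P \<noteq> 0"
    using q by (simp_all add: p_def P_def norm_power power_less_one_iff)
  have pP: "p\<^sup>2 = P" by (simp add: p_def P_def flip: power_mult)
  have xP: "q * P powi s = q powi (4 * s + 1)" for s
    using q by (simp add: P_def power_int_power power_int_add)
  have x1: "q * P powi s \<noteq> 1" for s
    unfolding xP by (rule powi_ne_1[OF q]) presburger
  define W where "W = gauss_weight p"
  define e where "e = (\<lambda>r. (- 1) powi r * P powi (tri r + r) / (1 - q * P powi r))"
  define g where "g = (\<lambda>n r. W n * (e r * (rfac P (n - r) * rfac P (n + r))))"
  define f where "f = (\<lambda>k. q ^ (2 * k\<^sup>2) * qpoch (- (q\<^sup>2)) (q ^ 4) k / qpoch q (q\<^sup>2) (2 * k + 1))"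
  obtain C where C: "C > 0" "\<And>n. norm (W n) \<le> C * norm (p powi (n * n))"
    unfolding W_def using gauss_weight_bound[OF p] by blast
  obtain B where B: "B > 0" "\<And>k. norm (rfac P k) \<le> B"
    using rfac_bounded[OF P(1)] by blast
  have e_eq: "e r = P powi tri r * (- P) powi r / (1 - q * P powi r)" for r
    unfolding e_def neg_one_powi_mult[of r P, symmetric] using P by (simp add: power_int_add)
  have e_abs: "(\<lambda>r. norm (e r)) summable_on UNIV"
    unfolding e_eq by (rule reciprocal_theta_terms_summable[OF P q(2) x1]) (use P in auto)
  have g_sum: "(\<lambda>(n, r). g n r) summable_on UNIV \<times> UNIV"
  proof (rule abs_summable_summable, rule Infinite_Sum.abs_summable_on_comparison_test')
    have "(\<lambda>(n, r). norm (p powi (n * n) * e r)) summable_on UNIV \<times> UNIV"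
      by (rule abs_summable_times[OF summable_square_powers[OF p] e_abs])
    then show "(\<lambda>nr. C * (B * B) * (case nr of (n, r) \<Rightarrow> norm (p powi (n * n) * e r))) summable_on UNIV \<times> UNIV"
      by (rule summable_on_cmult_right)
    fix nr :: "int \<times> int"
    obtain n r where nr: "nr = (n, r)" by (cases nr)
    have "norm (W n) * (norm (e r) * (norm (rfac P (n - r)) * norm (rfac P (n + r))))
        \<le> C * norm (p powi (n * n)) * (norm (e r) * (B * B))"
      by (intro mult_mono C B) (use B C in auto)
    then show "norm (case nr of (n, r) \<Rightarrow> g n r) \<le> C * (B * B) * (case nr of (n, r) \<Rightarrow> norm (p powi (n * n) * e r))"
      by (simp add: nr g_def norm_mult mult_ac)
  qed
  define F where "F = (\<lambda>n. \<Sum>\<^sub>\<infinity>r. g n r)"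
  have F_sum: "F summable_on UNIV"
    unfolding F_def by (rule summable_on_Sigma_banach[OF g_sum])
  \<comment> \<open>The series over the naturals may be read as one over the integers.\<close>
  have F_neg: "F n = 0" if "n < 0" for n
  proof -
    have "g n r = 0" for r using that by (auto simp: g_def rfac_def)
    then show ?thesis unfolding F_def by (intro infsum_0) simp
  qed
  have F_nat: "F (int k) = f k" for k
  proof -
    have "F (int k) = W (int k) * (\<Sum>\<^sub>\<infinity>r. e r * (rfac P (int k - r) * rfac P (int k + r)))"
      unfolding F_def g_def by (rule infsum_cmult_right')
    also have "\<dots> = W (int k) * (1 / (qpoch q P (Suc k) * qpoch (P / q) P k))"
      unfolding e_def finite_partial_fractions[OF P q(2) x1] ..
    also have "P / q = q ^ 3" using q by (simp add: P_def eval_nat_numeral)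
    also have "qpoch q P (Suc k) * qpoch (q ^ 3) P k = qpoch q (q\<^sup>2) (2 * k + 1)"
      unfolding P_def qpoch_odd_index_split[OF q(1)] ..
    also have "W (int k) = q ^ (2 * k\<^sup>2) * qpoch (- (q\<^sup>2)) (q ^ 4) k"
    proof -
      have "p powi (int k * int k) = q ^ (2 * k\<^sup>2)"
        by (simp add: p_def power2_eq_square power_mult flip: of_nat_mult)
      then show ?thesis by (simp add: W_def gauss_weight_def pP) (simp add: p_def P_def)
    qed
    finally show ?thesis by (simp add: f_def)
  qed
  have "(\<Sum>k. f k) = (\<Sum>\<^sub>\<infinity>n. F n)"
  proof -
    have "infsum F UNIV = infsum F {0..}"
      by (rule infsum_cong_neutral) (use F_neg in auto)
    also have "\<dots> = (\<Sum>\<^sub>\<infinity>k. F (int k))"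
      by (rule infsum_reindex_bij_witness[of _ int nat]) auto
    finally have 1: "infsum F UNIV = (\<Sum>\<^sub>\<infinity>k. f k)" by (simp add: F_nat)
    have "F summable_on {0..}" by (rule summable_on_subset[OF F_sum]) simp
    then have "(\<lambda>k. F (int k)) summable_on UNIV"
      by (subst summable_on_reindex_bij_witness[of _ nat int "{0..}" F]) auto
    then have "f summable_on UNIV" by (simp add: F_nat)
    from has_sum_imp_sums[OF has_sum_infsum[OF this]] show ?thesis by (simp add: 1 sums_iff)
  qed
  also have "\<dots> = (\<Sum>\<^sub>\<infinity>r. \<Sum>\<^sub>\<infinity>n. g n r)"
    unfolding F_def by (rule infsum_swap_banach[OF g_sum])
  also have "\<dots> = (\<Sum>\<^sub>\<infinity>r. qpoch_inf (- (q\<^sup>2)) (q ^ 4) / qpoch_inf (q ^ 4) (q ^ 4)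
      * ((- 1) powi r * q powi (4 * (r * r) + 2 * r) / (1 - q powi (4 * r + 1))))"
  proof (rule infsum_cong)
    fix r
    have "(\<Sum>\<^sub>\<infinity>n. g n r) = (\<Sum>\<^sub>\<infinity>n. e r * (W n * (rfac P (n - r) * rfac P (n + r))))"
      unfolding g_def by (simp only: mult_ac)
    also have "\<dots> = e r * (p powi (r * r) * (qpoch_inf (- p) P / qpoch_inf P P))"
      unfolding infsum_cmult_right' using gauss_weight_moment[OF p, of r] by (simp add: W_def pP)
    also have "\<dots> = qpoch_inf (- p) P / qpoch_inf P P * ((- 1) powi r * (P powi (tri r + r) * p powi (r * r)) / (1 - q powi (4 * r + 1)))"
      unfolding e_def xP by (simp add: mult_ac)
    also have "P powi (tri r + r) * p powi (r * r) = q powi (4 * (r * r) + 2 * r)"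
    proof -
      have "4 * (tri r + r) + 2 * (r * r) = 4 * (r * r) + 2 * r"
        using two_tri[of r] by (simp add: algebra_simps)
      then have "q powi (4 * (tri r + r) + 2 * (r * r)) = q powi (4 * (r * r) + 2 * r)" by (simp only:)
      then show ?thesis using q by (simp add: P_def p_def power_int_power power_int_add)
    qed
    finally show "(\<Sum>\<^sub>\<infinity>n. g n r) = qpoch_inf (- (q\<^sup>2)) (q ^ 4) / qpoch_inf (q ^ 4) (q ^ 4)
      * ((- 1) powi r * q powi (4 * (r * r) + 2 * r) / (1 - q powi (4 * r + 1)))"
      by (simp only: p_def P_def)
  qed
  finally show ?thesis unfolding infsum_cmult_right' f_def .
qed

section \<open>Theta identities of base q^8\<close>

text \<open>The product on the right is a double theta series over pairs (k, l). The pairs with k + l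
  even are (i + j, i - j), and their contribution factors into the square of j(q^3; q^8). The pairs
  with k + l odd are (i + j + 1, i - j), which gives the square of j(q^7; q^8) = j(q; q^8).\<close>

lemma theta_square_difference:
  assumes q: "norm q < 1" "q \<noteq> 0"
  shows "(theta_j (q ^ 3) (q ^ 8))\<^sup>2 - q * (theta_j q (q ^ 8))\<^sup>2 = theta_j q (q ^ 4) * theta_j (- (q\<^sup>2)) (q ^ 4)"
proof -
  have q4: "norm (q ^ 4) < 1" "q ^ 4 \<noteq> 0" and q8: "norm (q ^ 8) < 1" "q ^ 8 \<noteq> 0"
    using q by (simp_all add: norm_power power_less_one_iff)
  define f where "f = (\<lambda>k. (q ^ 4) powi tri k * (- q) powi k)"
  define g where "g = (\<lambda>l. (q ^ 4) powi tri l * (q\<^sup>2) powi l)"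
  define a where "a = (\<lambda>k. (q ^ 8) powi tri k * (- (q ^ 3)) powi k)"
  define b where "b = (\<lambda>k. (q ^ 8) powi tri k * (- (q ^ 7)) powi k)"
  have abs: "(\<lambda>k. norm (f k)) summable_on UNIV" "(\<lambda>k. norm (g k)) summable_on UNIV"
    "(\<lambda>k. norm (a k)) summable_on UNIV" "(\<lambda>k. norm (b k)) summable_on UNIV"
    unfolding f_def g_def a_def b_def
    by (rule theta_terms_abs_summable[OF q4] theta_terms_abs_summable[OF q8], use q in simp)+
  have sums: "theta_j q (q ^ 4) = infsum f UNIV" "theta_j (- (q\<^sup>2)) (q ^ 4) = infsum g UNIV"
    "theta_j (q ^ 3) (q ^ 8) = infsum a UNIV" "theta_j q (q ^ 8) = infsum b UNIV"
  proof -
    show "theta_j q (q ^ 4) = infsum f UNIV" unfolding f_def by (rule theta_j_series[OF q4 q(2)])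
    show "theta_j (- (q\<^sup>2)) (q ^ 4) = infsum g UNIV"
      unfolding g_def using theta_j_series[OF q4, of "- (q\<^sup>2)"] q by simp
    show "theta_j (q ^ 3) (q ^ 8) = infsum a UNIV"
      unfolding a_def by (rule theta_j_series[OF q8]) (use q in simp)
    have "q ^ 8 / q = q ^ 7" using q by (simp add: eval_nat_numeral)
    then have "theta_j q (q ^ 8) = theta_j (q ^ 7) (q ^ 8)" using theta_j_reflect[OF q8(2), of q] by simp
    also have "\<dots> = infsum b UNIV"
      unfolding b_def by (rule theta_j_series[OF q8]) (use q in simp)
    finally show "theta_j q (q ^ 8) = infsum b UNIV" .
  qed
  have summand: "(q ^ m) powi tri k * (- (q ^ j)) powi k = (- 1) powi k * q powi (int m * tri k + int j * k)" for m j k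
  proof -
    have "(- (q ^ j)) powi k = (- 1) powi k * q powi (int j * k)"
      unfolding neg_one_powi_mult[of k "q ^ j", symmetric] power_int_power ..
    then show ?thesis using q by (simp add: power_int_power power_int_add)
  qed
  have f: "f k = (- 1) powi k * q powi (4 * tri k + k)" for k
    unfolding f_def using summand[of 4 k 1] by simp
  have g: "g l = q powi (4 * tri l + 2 * l)" for l
    unfolding g_def using q by (simp add: power_int_power power_int_add)
  have a: "a k = (- 1) powi k * q powi (8 * tri k + 3 * k)" for k
    unfolding a_def using summand[of 8 k 3] by simp
  have b: "b k = (- 1) powi k * q powi (8 * tri k + 7 * k)" for k
    unfolding b_def using summand[of 8 k 7] by simp
  define Ev where "Ev = {(k, l). even (k + l :: int)}"
  define Od where "Od = {(k, l). odd (k + l :: int)}"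
  define H where "H = (\<lambda>(k, l). f k * g l)"
  have H_sum: "H summable_on UNIV \<times> UNIV"
    unfolding H_def using abs_summable_times[OF abs(1,2)] abs_summable_summable[of "\<lambda>(k, l). f k * g l"]
    by (simp add: case_prod_unfold)
  have un: "Ev \<union> Od = UNIV \<times> UNIV" "Ev \<inter> Od = {}" by (auto simp: Ev_def Od_def)
  have "theta_j q (q ^ 4) * theta_j (- (q\<^sup>2)) (q ^ 4) = infsum H (UNIV \<times> UNIV)"
    unfolding sums(1,2) infsum_times[OF abs(1,2)] H_def ..
  also have "\<dots> = infsum H Ev + infsum H Od"
    unfolding un(1)[symmetric]
    by (rule infsum_Un_disjoint) (use un H_sum in \<open>auto intro: summable_on_subset\<close>)
  also have "infsum H Ev = (\<Sum>\<^sub>\<infinity>(i, j)\<in>UNIV \<times> UNIV. a i * a j)"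
  proof (rule infsum_reindex_bij_witness[of _ "\<lambda>(i, j). (i + j, i - j)" "\<lambda>(k, l). ((k + l) div 2, (k - l) div 2)"])
    fix kl :: "int \<times> int" assume "kl \<in> Ev"
    then obtain i j where kl: "kl = (i + j, i - j)"
    proof -
      obtain k l where kl: "kl = (k, l)" by (cases kl)
      with \<open>kl \<in> Ev\<close> have "even (k + l)" by (simp add: Ev_def)
      then obtain i where i: "k + l = 2 * i" by (elim evenE)
      have "k = i + (k - i)" "l = i - (k - i)" using i by simp_all
      with kl that show thesis by metis
    qed
    have d: "(i + j + (i - j)) div 2 = i" "(i + j - (i - j)) div 2 = j" by simp_all
    show "(case case kl of (k, l) \<Rightarrow> ((k + l) div 2, (k - l) div 2) of (i, j) \<Rightarrow> (i + j, i - j)) = kl"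
      by (simp add: kl)
    have "4 * tri (i + j) + (i + j) + (4 * tri (i - j) + 2 * (i - j)) = (8 * tri i + 3 * i) + (8 * tri j + 3 * j)"
      using two_tri[of i] two_tri[of j] unfolding tri_add tri_diff by (simp add: algebra_simps)
    then have "q powi (4 * tri (i + j) + (i + j) + (4 * tri (i - j) + 2 * (i - j))) = q powi ((8 * tri i + 3 * i) + (8 * tri j + 3 * j))"
      by (simp only:)
    then have e: "q powi (4 * tri (i + j) + (i + j)) * q powi (4 * tri (i - j) + 2 * (i - j)) = q powi (8 * tri i + 3 * i) * q powi (8 * tri j + 3 * j)"
      using q(2) by (metis power_int_add)
    have "H kl = ((- 1) powi i * (- 1) powi j) * (q powi (4 * tri (i + j) + (i + j)) * q powi (4 * tri (i - j) + 2 * (i - j)))"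
      unfolding kl H_def f g by (simp add: power_int_add)
    then have "H kl = a i * a j" unfolding e a by (simp only: mult_ac)
    then show "(case case kl of (k, l) \<Rightarrow> ((k + l) div 2, (k - l) div 2) of (i, j) \<Rightarrow> a i * a j) = H kl"
      by (simp add: kl)
  qed (auto simp: Ev_def)
  also have "\<dots> = (theta_j (q ^ 3) (q ^ 8))\<^sup>2"
    unfolding sums(3) power2_eq_square infsum_times[OF abs(3,3)] ..
  also have "infsum H Od = (\<Sum>\<^sub>\<infinity>ij\<in>UNIV \<times> UNIV. - q * (case ij of (i, j) \<Rightarrow> b i * b j))"
  proof (rule infsum_reindex_bij_witness[of _ "\<lambda>(i, j). (i + j + 1, i - j)" "\<lambda>(k, l). ((k + l - 1) div 2, (k - l - 1) div 2)"])
    fix kl :: "int \<times> int" assume "kl \<in> Od"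
    then obtain i j where kl: "kl = (i + j + 1, i - j)"
    proof -
      obtain k l where kl: "kl = (k, l)" by (cases kl)
      with \<open>kl \<in> Od\<close> have "odd (k + l)" by (simp add: Od_def)
      then obtain i where i: "k + l = 2 * i + 1" by (elim oddE)
      have "k = i + (k - i - 1) + 1" "l = i - (k - i - 1)" using i by simp_all
      with kl that show thesis by metis
    qed
    show "(case case kl of (k, l) \<Rightarrow> ((k + l - 1) div 2, (k - l - 1) div 2) of (i, j) \<Rightarrow> (i + j + 1, i - j)) = kl"
      by (simp add: kl)
    have "4 * tri (i + j + 1) + (i + j + 1) + (4 * tri (i - j) + 2 * (i - j)) = 1 + (8 * tri i + 7 * i) + (8 * tri j + 7 * j)"
      using two_tri[of i] two_tri[of j] unfolding tri_succ tri_add tri_diff by (simp add: algebra_simps)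
    then have "q powi (4 * tri (i + j + 1) + (i + j + 1) + (4 * tri (i - j) + 2 * (i - j))) = q powi (1 + (8 * tri i + 7 * i) + (8 * tri j + 7 * j))"
      by (simp only:)
    then have e: "q powi (4 * tri (i + j + 1) + (i + j + 1)) * q powi (4 * tri (i - j) + 2 * (i - j)) = q * q powi (8 * tri i + 7 * i) * q powi (8 * tri j + 7 * j)"
      using q(2) by (metis power_int_add power_int_1_right)
    have "H kl = - ((- 1) powi i * (- 1) powi j) * (q powi (4 * tri (i + j + 1) + (i + j + 1)) * q powi (4 * tri (i - j) + 2 * (i - j)))"
      unfolding kl H_def f g by (simp add: power_int_add)
    then have "H kl = - q * (b i * b j)" unfolding e b by (simp add: mult_ac)
    then show "- q * (case case kl of (k, l) \<Rightarrow> ((k + l - 1) div 2, (k - l - 1) div 2) of (i, j) \<Rightarrow> b i * b j) = H kl"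
      by (simp add: kl)
  qed (auto simp: Od_def)
  also have "\<dots> = - q * (theta_j q (q ^ 8))\<^sup>2"
    unfolding sums(4) power2_eq_square infsum_times[OF abs(4,4)] infsum_cmult_right' ..
  finally show ?thesis by simp
qed

text \<open>Both identities compare infinite products, after these are written in terms of
  (q; q^2), (q^2; q^4), (-q^2; q^4), (q^4; q^8) and (q^8; q^8).\<close>

lemma theta_eight_products:
  assumes q: "norm q < 1" "q \<noteq> 0"
  shows "theta_j (q\<^sup>2) (q ^ 8) * (qpoch_inf (- (q\<^sup>2)) (q ^ 4) / qpoch_inf (q ^ 4) (q ^ 4)) = 1"
    and "(theta_j (q ^ 4) (q ^ 8))\<^sup>2 * theta_j q (q ^ 8) * theta_j (q ^ 3) (q ^ 8)
      = (theta_j (q\<^sup>2) (q ^ 8))\<^sup>2 * (theta_j q (q ^ 4) * theta_j (- (q\<^sup>2)) (q ^ 4))"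
proof -
  have n2: "norm (q\<^sup>2) < 1" and n4: "norm (q ^ 4) < 1" and n8: "norm (q ^ 8) < 1"
    using q by (simp_all add: norm_power power_less_one_iff)
  define E where "E = qpoch_inf (q ^ 8) (q ^ 8)"
  define F where "F = qpoch_inf (q ^ 4) (q ^ 8)"
  define A where "A = qpoch_inf (q\<^sup>2) (q ^ 4)"
  define B where "B = qpoch_inf (- (q\<^sup>2)) (q ^ 4)"
  define Od where "Od = qpoch_inf q (q\<^sup>2)"
  have pw: "q ^ 8 / q = q ^ 7" "q ^ 8 / q\<^sup>2 = q ^ 6" "q ^ 8 / q ^ 3 = q ^ 5" "q ^ 8 / q ^ 4 = q ^ 4" "q ^ 4 / q = q ^ 3"
    "q ^ 4 / - (q\<^sup>2) = - (q\<^sup>2)"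
    using q by (simp_all add: eval_nat_numeral)
  have pm: "(q ^ 4)\<^sup>2 = q ^ 8" "(q\<^sup>2)\<^sup>2 = q ^ 4" "q ^ 4 * q ^ 4 = q ^ 8" "q ^ 4 * q\<^sup>2 = q ^ 6"
    "q ^ 4 * q ^ 3 = q ^ 7" "q ^ 4 * q = q ^ 5" "q\<^sup>2 * q = q ^ 3"
    by (simp_all add: eval_nat_numeral)
  have AB: "A * B = F"
    using qpoch_inf_mult_minus[OF n4, of "q\<^sup>2"] unfolding pm A_def B_def F_def .
  have E4: "qpoch_inf (q ^ 4) (q ^ 4) = F * E"
    using qpoch_inf_bisect[OF n4, of "q ^ 4"] unfolding pm F_def E_def .
  have A2: "qpoch_inf (q\<^sup>2) (q ^ 8) * qpoch_inf (q ^ 6) (q ^ 8) = A"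
    using qpoch_inf_bisect[OF n4, of "q\<^sup>2"] unfolding pm A_def by simp
  have Od2: "qpoch_inf q (q ^ 4) * qpoch_inf (q ^ 3) (q ^ 4) = Od"
    using qpoch_inf_bisect[OF n2, of q] unfolding pm Od_def by simp
  have Od4: "qpoch_inf q (q ^ 8) * qpoch_inf (q ^ 7) (q ^ 8) * (qpoch_inf (q ^ 3) (q ^ 8) * qpoch_inf (q ^ 5) (q ^ 8)) = Od"
    using qpoch_inf_bisect[OF n4, of q] qpoch_inf_bisect[OF n4, of "q ^ 3"]
    unfolding pm Od2[symmetric] by (simp only: mult_ac)
  have j2: "theta_j (q\<^sup>2) (q ^ 8) = A * E" unfolding theta_j_def pw A2 E_def ..
  have j4: "theta_j (q ^ 4) (q ^ 8) = F * F * E" unfolding theta_j_def pw F_def E_def ..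
  have j13: "theta_j q (q ^ 8) * theta_j (q ^ 3) (q ^ 8) = Od * (E * E)"
    unfolding theta_j_def pw Od4[symmetric] E_def by (simp only: mult_ac)
  have jq: "theta_j q (q ^ 4) = Od * (F * E)" unfolding theta_j_def pw Od2 E4 ..
  have jm: "theta_j (- (q\<^sup>2)) (q ^ 4) = B * B * (F * E)" unfolding theta_j_def pw E4 B_def ..
  have nz: "F * E \<noteq> 0" using qpoch_inf_self_nonzero[OF n4] E4 by simp
  have "A * E * (B / (F * E)) = A * B * E / (F * E)" by (simp add: mult_ac)
  also have "\<dots> = 1" unfolding AB using nz by simp
  finally show "theta_j (q\<^sup>2) (q ^ 8) * (qpoch_inf (- (q\<^sup>2)) (q ^ 4) / qpoch_inf (q ^ 4) (q ^ 4)) = 1"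
    unfolding j2 E4 B_def .
  have "(theta_j (q ^ 4) (q ^ 8))\<^sup>2 * theta_j q (q ^ 8) * theta_j (q ^ 3) (q ^ 8) = (F * F * E)\<^sup>2 * (Od * (E * E))"
    unfolding j4 j13[symmetric] by (simp only: mult.assoc)
  also have "\<dots> = (A * E)\<^sup>2 * (Od * (F * E) * (B * B * (F * E)))"
    unfolding AB[symmetric] by (simp add: power2_eq_square mult_ac)
  finally show "(theta_j (q ^ 4) (q ^ 8))\<^sup>2 * theta_j q (q ^ 8) * theta_j (q ^ 3) (q ^ 8)
      = (theta_j (q\<^sup>2) (q ^ 8))\<^sup>2 * (theta_j q (q ^ 4) * theta_j (- (q\<^sup>2)) (q ^ 4))"
    unfolding j2 jq jm .
qed

section \<open>The mock theta function as a sum of Appell functions\<close>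

text \<open>With y = q^(4r+1) one has 1 / (1 - y) = (1 + y) / (1 - y^2), which splits the bilateral
  series into two Appell sums of base q^8, with x = q^4 and with x = 1. The constant -1 in V0 is
  absorbed by m(q^4, q^6; q^8) + m(q^4, q^2; q^8) = 1: reversing the summation in the second
  function gives both the same denominators, and their numerators add up to the theta series.\<close>

lemma mock_V0_half_shift:
  assumes q: "norm q < 1" "q \<noteq> 0"
  shows "mock_V0 q = appell_m (q ^ 4) (q ^ 6) (q ^ 8) - appell_m (q ^ 4) (q\<^sup>2) (q ^ 8)
    - 2 * appell_m 1 (q\<^sup>2) (q ^ 8) / q"
proof -
  define Q where "Q = q ^ 8"
  have Q: "norm Q < 1" "Q \<noteq> 0" using q by (simp_all add: Q_def norm_power power_less_one_iff)
  define E where "E = (\<lambda>r. Q powi tri r * (- (q ^ 6)) powi r)"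
  define Z where "Z = (\<lambda>r. q powi (8 * r + 2))"
  define y where "y = (\<lambda>r. q powi (4 * r + 1))"
  have y2: "Z r = y r * y r" for r
  proof -
    have "8 * r + 2 = (4 * r + 1) + (4 * r + 1)" by simp
    then show ?thesis unfolding Z_def y_def using q(2) by (metis power_int_add)
  qed
  have Z1: "Z r \<noteq> 1" and y1: "y r \<noteq> 1" for r
    unfolding Z_def y_def by (rule powi_ne_1[OF q], presburger)+
  have Z0: "Z r \<noteq> 0" for r using q by (simp add: Z_def)
  have E_eq: "E r = (- 1) powi r * q powi (4 * (r * r) + 2 * r)" for r
  proof -
    have "8 * tri r + 6 * r = 4 * (r * r) + 2 * r" using two_tri[of r] by (simp add: algebra_simps)
    then have "q powi (8 * tri r + 6 * r) = q powi (4 * (r * r) + 2 * r)" by (simp only:)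
    then show ?thesis
      unfolding E_def neg_one_powi_mult[of r "q ^ 6", symmetric] using q
      by (simp add: Q_def power_int_power power_int_add)
  qed
  have Qpow: "Q powi k * q powi l = q powi (8 * k + l)" for k l
    using q by (simp add: Q_def power_int_power power_int_add)
  have lattice: "x * z * Q powi s \<noteq> 1" if "x * z = q powi k" "k mod 8 \<noteq> 0" for x z k s
  proof -
    have "x * z * Q powi s = q powi (8 * s + k)" unfolding that(1) Qpow[of s k, symmetric] by simp
    moreover have "8 * s + k \<noteq> 0" using that(2) by presburger
    ultimately show ?thesis using powi_ne_1[OF q] by simp
  qed
  have s64: "(\<lambda>r. E r / (1 - Z r)) summable_on UNIV" and A64: "appell_sum (q ^ 4) (q ^ 6) Q = (\<Sum>\<^sub>\<infinity>r. E r / (1 - Z r))"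
  proof -
    have t: "Q powi tri r * (- (q ^ 6)) powi r / (1 - Q powi (r - 1) * q ^ 4 * q ^ 6) = E r / (1 - Z r)" for r
    proof -
      have "Q powi (r - 1) * q ^ 4 * q ^ 6 = Z r"
        using Qpow[of "r - 1" 10] by (simp add: Z_def mult.assoc add.commute flip: power_add)
      then show ?thesis by (simp only: E_def)
    qed
    show "(\<lambda>r. E r / (1 - Z r)) summable_on UNIV"
      unfolding t[symmetric] by (rule appell_terms_summable[OF Q]) (use q lattice[of "q ^ 4" "q ^ 6" 10] in \<open>auto simp flip: power_add\<close>)
    show "appell_sum (q ^ 4) (q ^ 6) Q = (\<Sum>\<^sub>\<infinity>r. E r / (1 - Z r))"
      unfolding appell_sum_def t ..
  qed
  have s42: "(\<lambda>r. E r * - Z r / (1 - Z r)) summable_on UNIV" and A42: "appell_sum (q ^ 4) (q\<^sup>2) Q = (\<Sum>\<^sub>\<infinity>r. E r * - Z r / (1 - Z r))"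
  proof -
    define T where "T = (\<lambda>r. Q powi tri r * (- (q\<^sup>2)) powi r / (1 - Q powi (r - 1) * q ^ 4 * q\<^sup>2))"
    have t: "T (- r) = E r * - Z r / (1 - Z r)" for r
    proof -
      have "Q powi (- r - 1) * q ^ 4 * q\<^sup>2 = q powi (- (8 * r + 2))"
      proof -
        have e: "8 * (- r - 1) + 6 = - (8 * r + 2)" by simp
        have "Q powi (- r - 1) * q ^ 4 * q\<^sup>2 = Q powi (- r - 1) * q powi 6"
          by (simp add: mult.assoc flip: power_add)
        then show ?thesis by (simp only: Qpow e)
      qed
      then have den: "Q powi (- r - 1) * q ^ 4 * q\<^sup>2 = 1 / Z r"
        unfolding Z_def by (simp only: power_int_minus_divide)
      have "Q powi tri (- r) * (- (q\<^sup>2)) powi (- r) = (- 1) powi (- r) * (Q powi tri (- r) * q powi (- 2 * r))"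
        unfolding neg_one_powi_mult[of "- r" "q\<^sup>2", symmetric] power_int_power by simp
      also have "Q powi tri (- r) * q powi (- 2 * r) = q powi (4 * (r * r) + 2 * r)"
      proof -
        have "8 * tri (- r) + - 2 * r = 4 * (r * r) + 2 * r"
          using two_tri[of r] unfolding tri_minus by (simp add: algebra_simps)
        then show ?thesis unfolding Qpow by (simp only:)
      qed
      also have "(- 1) powi (- r) = ((- 1) powi r :: complex)"
        by (simp add: power_int_minus_left)
      finally have num: "Q powi tri (- r) * (- (q\<^sup>2)) powi (- r) = E r" by (simp only: E_eq)
      have "1 / (1 - 1 / Z r) = - Z r / (1 - Z r)"
      proof -
        have "1 - 1 / Z r \<noteq> 0" "1 - Z r \<noteq> 0" using Z1[of r] Z0[of r] by auto
        then show ?thesis using Z0[of r] by (simp add: field_simps)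
      qed
      then show ?thesis
        unfolding T_def num den by (metis mult.right_neutral times_divide_eq_right)
    qed
    have T: "T summable_on UNIV"
      unfolding T_def by (rule appell_terms_summable[OF Q]) (use q lattice[of "q ^ 4" "q\<^sup>2" 6] in \<open>auto simp flip: power_add\<close>)
    have "(\<lambda>r. T (- r)) summable_on UNIV"
      using T by (subst summable_on_reindex_bij_witness[of _ uminus uminus UNIV T]) auto
    then show "(\<lambda>r. E r * - Z r / (1 - Z r)) summable_on UNIV" by (simp only: t)
    have "appell_sum (q ^ 4) (q\<^sup>2) Q = infsum T UNIV" by (simp add: appell_sum_def T_def)
    also have "\<dots> = (\<Sum>\<^sub>\<infinity>r. T (- r))" by (rule infsum_int_uminus[symmetric])
    finally show "appell_sum (q ^ 4) (q\<^sup>2) Q = (\<Sum>\<^sub>\<infinity>r. E r * - Z r / (1 - Z r))" by (simp only: t)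
  qed
  have s12: "(\<lambda>r. - q * (E r * y r / (1 - Z r))) summable_on UNIV"
    and A12: "appell_sum 1 (q\<^sup>2) Q = (\<Sum>\<^sub>\<infinity>r. - q * (E r * y r / (1 - Z r)))"
  proof -
    define T where "T = (\<lambda>r. Q powi tri r * (- (q\<^sup>2)) powi r / (1 - Q powi (r - 1) * 1 * q\<^sup>2))"
    have t: "T (r + 1) = - q * (E r * y r / (1 - Z r))" for r
    proof -
      have den: "Q powi (r + 1 - 1) * 1 * q\<^sup>2 = Z r"
        using Qpow[of r 2] by (simp add: Z_def)
      have "Q powi tri (r + 1) * (- (q\<^sup>2)) powi (r + 1) = (- 1) powi (r + 1) * (Q powi tri (r + 1) * q powi (2 * (r + 1)))"
        unfolding neg_one_powi_mult[of "r + 1" "q\<^sup>2", symmetric] power_int_power by simp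
      also have "Q powi tri (r + 1) * q powi (2 * (r + 1)) = q * q powi (4 * (r * r) + 2 * r) * y r"
      proof -
        have "8 * tri (r + 1) + 2 * (r + 1) = 1 + (4 * (r * r) + 2 * r) + (4 * r + 1)"
          using two_tri[of r] unfolding tri_succ by (simp add: algebra_simps)
        then have "q powi (8 * tri (r + 1) + 2 * (r + 1)) = q powi (1 + (4 * (r * r) + 2 * r) + (4 * r + 1))" by (simp only:)
        then show ?thesis unfolding Qpow y_def using q(2) by (metis power_int_add power_int_1_right)
      qed
      also have "(- 1) powi (r + 1) = - ((- 1) powi r :: complex)"
        by (simp add: power_int_minus_left)
      finally have num: "Q powi tri (r + 1) * (- (q\<^sup>2)) powi (r + 1) = - q * (E r * y r)"
        by (simp add: E_eq mult_ac)
      show ?thesis unfolding T_def num den by simp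
    qed
    have T: "T summable_on UNIV"
      unfolding T_def by (rule appell_terms_summable[OF Q]) (use q lattice[of 1 "q\<^sup>2" 2] in auto)
    show "(\<lambda>r. - q * (E r * y r / (1 - Z r))) summable_on UNIV"
      using summable_int_shift[THEN iffD2, OF T, of 1] by (simp only: t)
    have "appell_sum 1 (q\<^sup>2) Q = infsum T UNIV" by (simp add: appell_sum_def T_def)
    also have "\<dots> = (\<Sum>\<^sub>\<infinity>r. T (r + 1))" by (rule infsum_int_shift[symmetric])
    finally show "appell_sum 1 (q\<^sup>2) Q = (\<Sum>\<^sub>\<infinity>r. - q * (E r * y r / (1 - Z r)))" by (simp only: t)
  qed
  have j6: "theta_j (q ^ 6) Q = theta_j (q\<^sup>2) Q"
  proof -
    have "Q / q\<^sup>2 = q ^ 6" using q by (simp add: Q_def eval_nat_numeral)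
    then show ?thesis using theta_j_reflect[OF Q(2), of "q\<^sup>2"] by simp
  qed
  have sum_j: "appell_sum (q ^ 4) (q ^ 6) Q + appell_sum (q ^ 4) (q\<^sup>2) Q = theta_j (q\<^sup>2) Q"
  proof -
    have "appell_sum (q ^ 4) (q ^ 6) Q + appell_sum (q ^ 4) (q\<^sup>2) Q = (\<Sum>\<^sub>\<infinity>r. E r / (1 - Z r) + E r * - Z r / (1 - Z r))"
      unfolding A64 A42 by (rule infsum_add[OF s64 s42, symmetric])
    also have "\<dots> = (\<Sum>\<^sub>\<infinity>r. E r)"
    proof (rule infsum_cong)
      fix r
      have "1 - Z r \<noteq> 0" using Z1[of r] by simp
      moreover have "E r / (1 - Z r) + E r * - Z r / (1 - Z r) = E r * (1 - Z r) / (1 - Z r)"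
        by (simp add: right_diff_distrib diff_divide_distrib)
      ultimately show "E r / (1 - Z r) + E r * - Z r / (1 - Z r) = E r" by simp
    qed
    also have "\<dots> = theta_j (q ^ 6) Q" unfolding E_def by (rule theta_j_series[OF Q, symmetric]) (use q in simp)
    finally show ?thesis unfolding j6 .
  qed
  have bil: "(\<Sum>\<^sub>\<infinity>r. (- 1) powi r * q powi (4 * (r * r) + 2 * r) / (1 - q powi (4 * r + 1)))
      = appell_sum (q ^ 4) (q ^ 6) Q - appell_sum 1 (q\<^sup>2) Q / q"
  proof -
    have "(\<Sum>\<^sub>\<infinity>r. (- 1) powi r * q powi (4 * (r * r) + 2 * r) / (1 - q powi (4 * r + 1)))
        = (\<Sum>\<^sub>\<infinity>r. E r / (1 - Z r) + (- 1 / q) * (- q * (E r * y r / (1 - Z r))))"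
    proof (rule infsum_cong)
      fix r
      have n: "1 - y r \<noteq> 0" "1 + y r \<noteq> 0"
        using y1[of r] Z1[of r] y2[of r] by (auto simp: add_eq_0_iff)
      have "E r / (1 - y r) = E r * (1 + y r) / (1 - Z r)"
      proof -
        have "1 - Z r = (1 - y r) * (1 + y r)" unfolding y2 by (simp add: algebra_simps)
        then show ?thesis using n by simp
      qed
      also have "\<dots> = E r / (1 - Z r) + (- 1 / q) * (- q * (E r * y r / (1 - Z r)))"
        using q by (simp add: distrib_left add_divide_distrib)
      finally show "(- 1) powi r * q powi (4 * (r * r) + 2 * r) / (1 - q powi (4 * r + 1))
          = E r / (1 - Z r) + (- 1 / q) * (- q * (E r * y r / (1 - Z r)))"
        by (simp only: E_eq y_def)
    qed
    also have "\<dots> = appell_sum (q ^ 4) (q ^ 6) Q + (- 1 / q) * appell_sum 1 (q\<^sup>2) Q"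
      unfolding A64 A12 infsum_cmult_right'[symmetric]
      by (rule infsum_add[OF s64 summable_on_cmult_right[OF s12]])
    finally show ?thesis by simp
  qed
  define \<kappa> where "\<kappa> = qpoch_inf (- (q\<^sup>2)) (q ^ 4) / qpoch_inf (q ^ 4) (q ^ 4)"
  have \<kappa>: "theta_j (q\<^sup>2) Q * \<kappa> = 1" unfolding Q_def \<kappa>_def by (rule theta_eight_products(1)[OF q])
  then have nz: "theta_j (q\<^sup>2) Q \<noteq> 0" by auto
  with \<kappa> have \<kappa>': "\<kappa> = 1 / theta_j (q\<^sup>2) Q" "theta_j (q\<^sup>2) Q \<noteq> 0"
    by (simp_all add: nonzero_eq_divide_eq mult.commute)
  have "mock_V0 q = - 1 + 2 * (\<kappa> * (appell_sum (q ^ 4) (q ^ 6) Q - appell_sum 1 (q\<^sup>2) Q / q))"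
    unfolding mock_V0_def mock_V0_rearranged[OF q] bilateral_form[OF q] bil \<kappa>_def ..
  also have "\<dots> = - ((appell_sum (q ^ 4) (q ^ 6) Q + appell_sum (q ^ 4) (q\<^sup>2) Q) / theta_j (q\<^sup>2) Q)
      + 2 * ((appell_sum (q ^ 4) (q ^ 6) Q - appell_sum 1 (q\<^sup>2) Q / q) / theta_j (q\<^sup>2) Q)"
    unfolding sum_j \<kappa>'(1) using \<kappa>'(2) by simp
  also have "\<dots> = appell_m (q ^ 4) (q ^ 6) Q - appell_m (q ^ 4) (q\<^sup>2) Q - 2 * appell_m 1 (q\<^sup>2) Q / q"
    unfolding appell_m_eq j6 by (simp add: add_divide_distrib diff_divide_distrib)
  finally show ?thesis by (simp only: Q_def)
qed

text \<open>All Appell functions with x = 1 are moved to the argument q^2, and the remaining difference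
  with x = q^4 is a theta quotient as well. With jk = j(q^k; q^8), the claim then reduces to
  j4^2 j1 j3 = j2^2 (j3^2 - q j1^2).\<close>

lemma mock_V0_appell:
  assumes q: "norm q < 1" "q \<noteq> 0"
  shows "mock_V0 q = - (appell_m 1 q (q ^ 8) / q) - appell_m 1 (q ^ 3) (q ^ 8) / q"
proof -
  define Q where "Q = q ^ 8"
  have Q: "norm Q < 1" "Q \<noteq> 0" using q by (simp_all add: Q_def norm_power power_less_one_iff)
  define J where "J = qpoch_inf Q Q ^ 3"
  have lat: "q ^ k * Q powi s \<noteq> 1" if "k mod 8 \<noteq> 0" for k s
  proof -
    have "q ^ k * Q powi s = q powi (int k + 8 * s)"
      using q by (simp add: Q_def power_int_power power_int_add)
    moreover have "int k + 8 * s \<noteq> 0" using that by presburger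
    ultimately show ?thesis using powi_ne_1[OF q] by simp
  qed
  define j1 where "j1 = theta_j q Q"
  define j2 where "j2 = theta_j (q\<^sup>2) Q"
  define j3 where "j3 = theta_j (q ^ 3) Q"
  define j4 where "j4 = theta_j (q ^ 4) Q"
  have nz: "j1 \<noteq> 0" "j2 \<noteq> 0" "j3 \<noteq> 0"
  proof -
    have th: "theta_j (q ^ k) Q \<noteq> 0" if "k mod 8 \<noteq> 0" for k
      by (rule theta_j_nonzero[OF Q _ lat[OF that]]) (use q in simp)
    show "j1 \<noteq> 0" "j2 \<noteq> 0" "j3 \<noteq> 0"
      using th[of 1] th[of 2] th[of 3] by (simp_all add: j1_def j2_def j3_def)
  qed
  have inv: "theta_j (q ^ a / q ^ b) Q = - theta_j (q ^ (b - a)) Q / q ^ (b - a)" if "a \<le> b" for a b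
  proof -
    have "q ^ a / q ^ b = 1 / q ^ (b - a)" using q that by (simp add: power_diff)
    then show ?thesis using theta_j_inverse[OF Q, of "q ^ (b - a)"] q by simp
  qed
  have refl: "theta_j (q ^ (8 - a)) Q = theta_j (q ^ a) Q" if "a \<le> 8" for a
  proof -
    have "Q / q ^ a = q ^ (8 - a)" using q that by (simp add: Q_def power_diff)
    then show ?thesis using theta_j_reflect[OF Q(2), of "q ^ a"] by simp
  qed
  have up: "theta_j (q ^ (8 + a)) Q = - theta_j (q ^ a) Q / q ^ a" for a
  proof -
    have "theta_j (Q powi 1 * q ^ a) Q = (- (q ^ a)) powi (- 1) * Q powi (- tri 1) * theta_j (q ^ a) Q"
      by (rule theta_j_shift[OF Q]) (use q in simp)
    then show ?thesis using q by (simp add: Q_def power_add power_int_minus divide_simps)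
  qed
  have ann: "norm Q < norm (q ^ k)" "norm (q ^ k) < 1" if "0 < k" "k < 8" for k
  proof -
    show "norm (q ^ k) < 1" using q that by (simp add: norm_power power_less_one_iff)
    show "norm Q < norm (q ^ k)"
      unfolding Q_def norm_power using q that by (intro power_strict_decreasing) auto
  qed
  have c1: "appell_m 1 q Q - appell_m 1 (q\<^sup>2) Q = - q * J * j3 / (j1 * j2\<^sup>2)"
  proof -
    have "appell_m 1 q Q - appell_m 1 (q\<^sup>2) Q = q\<^sup>2 * J * theta_j (q / q\<^sup>2) Q * theta_j (1 * q * q\<^sup>2) Q
        / (theta_j q Q * theta_j (q\<^sup>2) Q * theta_j (1 * q) Q * theta_j (1 * q\<^sup>2) Q)"
      unfolding J_def by (rule appell_m_change_z[OF Q]) (use q ann[of 1] lat[of 1] lat[of 2] in auto)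
    moreover have "theta_j (q / q\<^sup>2) Q = - j1 / q" using inv[of 1 2] by (simp add: j1_def)
    moreover have "1 * q * q\<^sup>2 = q ^ 3" by (simp add: eval_nat_numeral)
    ultimately have "appell_m 1 q Q - appell_m 1 (q\<^sup>2) Q = q\<^sup>2 * J * (- j1 / q) * j3 / (j1 * j2 * j1 * j2)"
      by (simp only: j1_def j2_def j3_def mult_1_left)
    also have "\<dots> = - q * J * j3 / (j1 * j2\<^sup>2)"
      using nz q by (simp add: power2_eq_square mult_ac)
    finally show ?thesis .
  qed
  have c3: "appell_m 1 (q ^ 3) Q - appell_m 1 (q\<^sup>2) Q = q\<^sup>2 * J * j1 / (j3 * j2\<^sup>2)"
  proof -
    have "appell_m 1 (q ^ 3) Q - appell_m 1 (q\<^sup>2) Q = q\<^sup>2 * J * theta_j (q ^ 3 / q\<^sup>2) Q * theta_j (1 * q ^ 3 * q\<^sup>2) Q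
        / (theta_j (q ^ 3) Q * theta_j (q\<^sup>2) Q * theta_j (1 * q ^ 3) Q * theta_j (1 * q\<^sup>2) Q)"
      unfolding J_def by (rule appell_m_change_z[OF Q]) (use q ann[of 3] lat[of 3] lat[of 2] in auto)
    moreover have "q ^ 3 / q\<^sup>2 = q" using q by (simp add: eval_nat_numeral)
    moreover have "theta_j (1 * q ^ 3 * q\<^sup>2) Q = j3"
      using refl[of 3] by (simp add: j3_def flip: power_add)
    ultimately have "appell_m 1 (q ^ 3) Q - appell_m 1 (q\<^sup>2) Q = q\<^sup>2 * J * j1 * j3 / (j3 * j2 * j3 * j2)"
      by (simp only: j1_def j2_def j3_def mult_1_left)
    also have "\<dots> = q\<^sup>2 * J * j1 / (j3 * j2\<^sup>2)"
      using nz by (simp add: power2_eq_square mult_ac)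
    finally show ?thesis .
  qed
  have c4: "appell_m (q ^ 4) (q\<^sup>2) Q - appell_m (q ^ 4) (q ^ 6) Q = - J * j4\<^sup>2 / j2 ^ 4"
  proof -
    have pw: "q ^ 4 * q\<^sup>2 = q ^ 6" "q ^ 4 * q ^ 6 = q ^ 10" "q ^ 6 * q ^ 6 = q ^ 12"
      by (simp_all flip: power_add)
    have "appell_m (q ^ 4) (q\<^sup>2) Q - appell_m (q ^ 4) (q ^ 6) Q
        = q ^ 6 * J * theta_j (q\<^sup>2 / q ^ 6) Q * theta_j (q ^ 4 * q\<^sup>2 * q ^ 6) Q
        / (theta_j (q\<^sup>2) Q * theta_j (q ^ 6) Q * theta_j (q ^ 4 * q\<^sup>2) Q * theta_j (q ^ 4 * q ^ 6) Q)"
      unfolding J_def by (rule appell_m_change_z[OF Q]) (use q ann[of 6] lat[of 2] lat[of 6] lat[of 10] in \<open>auto simp: pw\<close>)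
    also have "\<dots> = q ^ 6 * J * (- j4 / q ^ 4) * (- j4 / q ^ 4) / (j2 * j2 * j2 * (- j2 / q\<^sup>2))"
      unfolding pw using inv[of 2 6] refl[of 2] up[of 4] up[of 2] by (simp add: j2_def j4_def)
    also have "\<dots> = - J * j4\<^sup>2 / j2 ^ 4"
      using q nz by (simp add: divide_simps) (simp add: eval_nat_numeral)
    finally show ?thesis .
  qed
  have theta: "j4\<^sup>2 * j1 * j3 = j2\<^sup>2 * (j3\<^sup>2 - q * j1\<^sup>2)"
    using theta_eight_products(2)[OF q] theta_square_difference[OF q]
    by (simp only: j1_def j2_def j3_def j4_def Q_def)
  have V: "mock_V0 q = J * j4\<^sup>2 / j2 ^ 4 - 2 * appell_m 1 (q\<^sup>2) Q / q"
  proof -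
    have "appell_m (q ^ 4) (q ^ 6) Q - appell_m (q ^ 4) (q\<^sup>2) Q = - (appell_m (q ^ 4) (q\<^sup>2) Q - appell_m (q ^ 4) (q ^ 6) Q)"
      by simp
    also have "\<dots> = J * j4\<^sup>2 / j2 ^ 4" unfolding c4 by simp
    finally show ?thesis using mock_V0_half_shift[OF q] unfolding Q_def[symmetric] by (simp only:)
  qed
  have "J * j4\<^sup>2 / j2 ^ 4 = J * (j3\<^sup>2 - q * j1\<^sup>2) / (j1 * j3 * j2\<^sup>2)"
  proof -
    have "J * j4\<^sup>2 / j2 ^ 4 = J * (j4\<^sup>2 * j1 * j3) / (j1 * j3 * j2 ^ 4)"
      using nz by simp
    also have "\<dots> = J * (j3\<^sup>2 - q * j1\<^sup>2) / (j1 * j3 * j2\<^sup>2)"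
      unfolding theta using nz by (simp add: eval_nat_numeral)
    finally show ?thesis .
  qed
  also have "\<dots> = J * j3 / (j1 * j2\<^sup>2) - q * J * j1 / (j3 * j2\<^sup>2)"
    using nz by (simp add: divide_simps) (simp add: algebra_simps power2_eq_square)
  finally have th: "J * j4\<^sup>2 / j2 ^ 4 = J * j3 / (j1 * j2\<^sup>2) - q * J * j1 / (j3 * j2\<^sup>2)" .
  have m1: "appell_m 1 q Q = appell_m 1 (q\<^sup>2) Q + - q * J * j3 / (j1 * j2\<^sup>2)"
    and m3: "appell_m 1 (q ^ 3) Q = appell_m 1 (q\<^sup>2) Q + q\<^sup>2 * J * j1 / (j3 * j2\<^sup>2)"
    using c1 c3 by (simp_all add: algebra_simps)
  have "- (appell_m 1 q Q / q) - appell_m 1 (q ^ 3) Q / q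
      = - 2 * appell_m 1 (q\<^sup>2) Q / q + (J * j3 / (j1 * j2\<^sup>2) - q * J * j1 / (j3 * j2\<^sup>2))"
  proof -
    have "- ((m + - q * u * v / w) / q) - (m + q\<^sup>2 * u * v' / w') / q = - 2 * m / q + (u * v / w - q * u * v' / w')"
      for m u v w v' w' :: complex
      using q by (simp add: add_divide_distrib diff_divide_distrib power2_eq_square)
    then show ?thesis unfolding m1 m3 .
  qed
  then show ?thesis unfolding V th by (simp add: Q_def)
qed

section \<open>The multisection of the mock theta function\<close>

text \<open>The odd section for the base q^8 and z = q^k, with all exponents written as powers of q.\<close>

lemma appell_section_eighth:
  fixes p :: int and k :: nat
  assumes q: "norm q < 1" "q \<noteq> 0" and p: "p \<ge> 3" "odd p" and k: "0 < k" "k < 8"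
  shows "- (appell_m 1 (q ^ k) (q ^ 8) / q)
    = - (\<Sum>r\<in>{0..p - 1}. (-1) powi r * q powi (- ((2 * r + 1) ^ 2))
             * appell_m (q powi (8 * p * ((p - 1) div 2 - r))) (-1) (q powi (8 * p ^ 2)))
    + theta_J1 q (8 * p) ^ 3 / (theta_J q (int k) 8 * theta_Jbar q 0 (8 * p ^ 2))
      * (\<Sum>r\<in>{0..p - 1}.
           (-1) powi r * q powi (4 * r * (r - p) - 1) * q powi (int k * r - int k * ((p - 1) div 2))
             * theta_j (- (q powi (8 * r + int k))) (q powi (8 * p))
             * theta_j (- (q powi (p * (8 * r + int k)))) (q powi (8 * p ^ 2))
           / (theta_Jbar q 0 (8 * p) * theta_j (q powi (8 * r + int k)) (q powi (8 * p))))"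
    (is "_ = - sum ?A _ + _ * sum ?B _")
proof -
  define n where "n = nat p"
  define h where "h = nat ((p - 1) div 2)"
  define Q where "Q = q ^ 8"
  define z where "z = q ^ k"
  have ph: "p = int n" "(p - 1) div 2 = int h" using p by (simp_all add: n_def h_def)
  have n: "n = 2 * h + 1" 
  proof -
    obtain m where m: "p = 2 * m + 1" using p(2) by (elim oddE)
    with p(1) have "m \<ge> 0" by simp
    with m show ?thesis by (simp add: n_def h_def nat_add_distrib nat_mult_distrib)
  qed
  have Q: "norm Q < 1" "Q \<noteq> 0" using q by (simp_all add: Q_def norm_power power_less_one_iff)
  have ann: "norm Q < norm z" "norm z < 1"
    unfolding Q_def z_def norm_power using q k by (auto intro: power_strict_decreasing simp: power_less_one_iff)
  have Qn: "Q ^ n = q powi (8 * p)" and Qn2: "Q ^ n\<^sup>2 = q powi (8 * p ^ 2)"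
  proof -
    have "Q ^ n = q ^ (8 * n)" by (simp add: Q_def power_mult)
    then show "Q ^ n = q powi (8 * p)" unfolding ph by (simp flip: power_int_of_nat)
    have "Q ^ n\<^sup>2 = q ^ (8 * n\<^sup>2)" by (simp add: Q_def power_mult)
    then show "Q ^ n\<^sup>2 = q powi (8 * p ^ 2)" unfolding ph by (simp flip: power_int_of_nat)
  qed
  have reindex: "(\<Sum>r<n. f (int r)) = (\<Sum>r\<in>{0..p - 1}. f r)" for f :: "int \<Rightarrow> complex"
    by (rule sum.reindex_bij_witness[of _ nat int]) (auto simp: ph)
  have J: "qpoch_inf (Q ^ n) (Q ^ n) = theta_J1 q (8 * p)"
  proof -
    define R where "R = q powi (8 * p)"
    have "n > 0" using n by simp
    then have R: "norm R < 1" "R \<noteq> 0" using Q by (simp_all add: R_def Qn[symmetric] norm_power power_less_one_iff)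
    have R3: "q powi (3 * (8 * p)) = R ^ 3" unfolding R_def power_int_power' by (simp add: mult.commute)
    have "theta_J1 q (8 * p) = theta_j R (R ^ 3)"
      unfolding theta_J1_def theta_J_def R3 by (simp add: R_def)
    also have "\<dots> = qpoch_inf R (R ^ 3) * qpoch_inf (R * R) (R ^ 3) * qpoch_inf (R ^ 3) (R ^ 3)"
    proof -
      have "R ^ 3 / R = R * R" using R by (simp add: eval_nat_numeral)
      then show ?thesis by (simp add: theta_j_def)
    qed
    also have "\<dots> = qpoch_inf R R"
      using qpoch_inf_dissect[OF R(1), of 3 R] by (simp add: lessThan_nat_numeral eval_nat_numeral mult_ac)
    finally show ?thesis unfolding Qn R_def by simp
  qed
  have den: "theta_j z Q = theta_J q (int k) 8" "theta_j (- 1) (Q ^ n\<^sup>2) = theta_Jbar q 0 (8 * p ^ 2)"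
    "theta_j (- 1) (Q ^ n) = theta_Jbar q 0 (8 * p)"
    by (simp_all add: theta_J_def theta_Jbar_def z_def Q_def[symmetric] Qn Qn2)
  let ?S = "\<lambda>r. Q powi tri (int r) * (- z) ^ r * (Q ^ r * z) powi (- int h)
             * theta_j (- (Q ^ r * z)) (Q ^ n) * theta_j (- (z ^ n * Q ^ (n * r))) (Q ^ n\<^sup>2)
             / (theta_j (- 1) (Q ^ n) * theta_j (Q ^ r * z) (Q ^ n))"
  have main: "appell_m 1 z Q
    = (\<Sum>r<n. (- 1) ^ r * Q powi (- tri (int r + 1)) * appell_m (Q powi (int n * (int h - int r))) (- 1) (Q ^ n\<^sup>2))
      - theta_J1 q (8 * p) ^ 3 / (theta_J q (int k) 8 * theta_Jbar q 0 (8 * p ^ 2))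
        * sum ?S {..<n}"
    using appell_m_odd_section[OF Q n ann] unfolding J den(1,2) .
  have Qp: "Q powi i = q powi (8 * i)" for i by (simp add: Q_def power_int_power)
  have first: "(\<Sum>r<n. (- 1) ^ r * Q powi (- tri (int r + 1)) * appell_m (Q powi (int n * (int h - int r))) (- 1) (Q ^ n\<^sup>2)) / q
     = sum ?A {0..p - 1}"
    unfolding reindex[symmetric] sum_divide_distrib
  proof (rule sum.cong[OF refl])
    fix r
    have "- ((2 * int r + 1) ^ 2) = 8 * - tri (int r + 1) - 1"
      using two_tri[of "int r"] unfolding tri_succ by (simp add: algebra_simps power2_eq_square)
    then have "q powi (- ((2 * int r + 1) ^ 2)) = Q powi (- tri (int r + 1)) / q"
      unfolding Qp using q(2) by (simp only: power_int_diff simp_thms power_int_1_right)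
    moreover have "Q powi (int n * (int h - int r)) = q powi (8 * p * ((p - 1) div 2 - int r))"
      unfolding Qp ph(2) by (simp add: ph(1) mult.assoc)
    ultimately show "(- 1) ^ r * Q powi (- tri (int r + 1)) * appell_m (Q powi (int n * (int h - int r))) (- 1) (Q ^ n\<^sup>2) / q
      = ?A (int r)"
      unfolding Qn2 by simp
  qed
  have second: "sum ?S {..<n} / q
     = sum ?B {0..p - 1}"
    unfolding reindex[symmetric] sum_divide_distrib
  proof (rule sum.cong[OF refl])
    fix r
    have e1: "Q ^ r * z = q powi (8 * int r + int k)"
    proof -
      have "Q ^ r * z = q powi int (8 * r + k)"
        unfolding power_int_of_nat by (simp add: Q_def z_def power_add power_mult)
      then show ?thesis by simp
    qed
    have e2: "z ^ n * Q ^ (n * r) = q powi (p * (8 * int r + int k))"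
    proof -
      have "z ^ n * Q ^ (n * r) = (Q ^ r * z) ^ n" by (simp add: power_mult_distrib mult.commute[of n r] power_mult)
      then show ?thesis unfolding e1 power_int_power' by (simp add: ph(1) mult.commute)
    qed
    have e3: "Q powi tri (int r) * (- z) ^ r * (Q ^ r * z) powi (- int h) / q
        = (-1) powi int r * q powi (4 * int r * (int r - p) - 1) * q powi (int k * int r - int k * ((p - 1) div 2))"
    proof -
      have "8 * tri (int r) + int k * int r + (8 * int r + int k) * (- int h) - 1
          = (4 * int r * (int r - p) - 1) + (int k * int r - int k * ((p - 1) div 2))"
        using two_tri[of "int r"] unfolding ph(2) unfolding ph(1) n by (simp add: algebra_simps)
      then have "q powi (8 * tri (int r) + int k * int r + (8 * int r + int k) * (- int h) - 1)
          = q powi ((4 * int r * (int r - p) - 1) + (int k * int r - int k * ((p - 1) div 2)))"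
        by (simp only:)
      then have e: "Q powi tri (int r) * q powi (int k * int r) * q powi ((8 * int r + int k) * (- int h)) / q
          = q powi (4 * int r * (int r - p) - 1) * q powi (int k * int r - int k * ((p - 1) div 2))"
        unfolding Qp using q(2) by (simp only: power_int_add power_int_diff power_int_1_right simp_thms)
      have "(- z) ^ r = (- 1) powi int r * q powi (int k * int r)"
        unfolding z_def by (simp add: power_minus[of "q ^ k"] power_int_mult power_mult)
      moreover have "(Q ^ r * z) powi (- int h) = q powi ((8 * int r + int k) * (- int h))"
        unfolding e1 power_int_mult ..
      ultimately have "Q powi tri (int r) * (- z) ^ r * (Q ^ r * z) powi (- int h) / q
          = (- 1) powi int r * (Q powi tri (int r) * q powi (int k * int r) * q powi ((8 * int r + int k) * (- int h)) / q)"
        by simp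
      then show ?thesis unfolding e by (simp only: mult.assoc)
    qed
    have "?S r / q
      = (Q powi tri (int r) * (- z) ^ r * (Q ^ r * z) powi (- int h) / q)
             * theta_j (- (Q ^ r * z)) (Q ^ n) * theta_j (- (z ^ n * Q ^ (n * r))) (Q ^ n\<^sup>2)
             / (theta_j (- 1) (Q ^ n) * theta_j (Q ^ r * z) (Q ^ n))"
      by simp
    also have "\<dots> = ?B (int r)"
      unfolding e3 e2 den(3) Qn2 unfolding e1 Qn ..
    finally show "?S r / q = ?B (int r)" .
  qed
  have "- ((A - c * S) / q) = - (A / q) + c * (S / q)" for A c S
    by (simp add: diff_divide_distrib)
  then show ?thesis
    unfolding main[unfolded z_def Q_def] first[symmetric] second[symmetric] by (simp only: z_def Q_def)
qed

theorem theorem1p2: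
  fixes \<tau> q :: complex and p :: int
  assumes tau: "Im \<tau> > 0"
    and q: "q = exp (2 * of_real pi * \<i> * \<tau>)"
    and p: "p \<ge> 3" "odd p"
  shows "mock_V0 q =
    - 2 * (\<Sum>r\<in>{0..p - 1}. (-1) powi r * q powi (- ((2 * r + 1) ^ 2))
             * appell_m (q powi (8 * p * ((p - 1) div 2 - r))) (-1) (q powi (8 * p ^ 2)))
    + theta_J1 q (8 * p) ^ 3 / (theta_J q 1 8 * theta_Jbar q 0 (8 * p ^ 2))
      * (\<Sum>r\<in>{0..p - 1}.
           (-1) powi r * q powi (4 * r * (r - p) - 1) * q powi (r - (p - 1) div 2)
             * theta_j (- (q powi (8 * r + 1))) (q powi (8 * p))
             * theta_j (- (q powi (p * (8 * r + 1)))) (q powi (8 * p ^ 2))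
           / (theta_Jbar q 0 (8 * p) * theta_j (q powi (8 * r + 1)) (q powi (8 * p))))
    + theta_J1 q (8 * p) ^ 3 / (theta_J q 3 8 * theta_Jbar q 0 (8 * p ^ 2))
      * (\<Sum>r\<in>{0..p - 1}.
           (-1) powi r * q powi (4 * r * (r - p) - 1) * q powi (3 * r - 3 * ((p - 1) div 2))
             * theta_j (- (q powi (8 * r + 3))) (q powi (8 * p))
             * theta_j (- (q powi (p * (8 * r + 3)))) (q powi (8 * p ^ 2))
           / (theta_Jbar q 0 (8 * p) * theta_j (q powi (8 * r + 3)) (q powi (8 * p))))"
proof -
  have q0: "q \<noteq> 0" unfolding q by simp
  have "norm q = exp (- (2 * pi * Im \<tau>))" unfolding q by (simp add: norm_exp_eq_Re)
  then have q1: "norm q < 1" using tau by simp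
  show ?thesis
    using mock_V0_appell[OF q1 q0]
      appell_section_eighth[OF q1 q0 p, of 1, simplified]
      appell_section_eighth[OF q1 q0 p, of 3, simplified]
    by simp
qed

end
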